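(* Let $k$ be an infinite field and $R=k[[x,y]]$. For every pair $A,B$ with $0\le A\le B\le+\infty$, there is a graded filtration $\mathcal I=\{I_n\}_{n\ge0}$ of ideals of $R$, with $I_n$ nonzero, proper and integrally closed for every $n\ge1$, such that $\sqrt{I_n}=(x)$, $\operatorname{ht}I_n=1$ and $\ell(I_n)=2$ for every $n\ge1$, and $$\lim_{n\to\infty}c_0(I_n;R)=0,\qquad \lim_{n\to\infty}\frac{c_1(I_n;R)}{n}=1,\qquad \liminf_{n\to\infty}\frac{c_2(I_n;R)}{n^2}=A,\qquad \limsup_{n\to\infty}\frac{c_2(I_n;R)}{n^2}=B.$$
   Context: Multiplicity sequence: for a proper ideal $I$ of a Noetherian local ring $(R,\mathfrak m)$ of dimension $d\ge1$, the function $H_I(r,s)=\sum_{v=0}^{s}\lambda_R\bigl(I^v/(\mathfrak m^{r+1}I^v+I^{v+1})\bigr)$ ($\lambda_R$ = length) agrees for $r,s\gg0$ with a polynomial whose homogeneous part of total degree $d$ is $\sum_{i=0}^{d}\frac{c_i(I;R)}{(d-i)!\,i!}r^{d-i}s^i$; this defines the nonnegative integers $c_0(I;R),\dots,c_d(I;R)$ (here $d=2$). Graded filtration: a sequence $\mathcal I=\{I_n\}_{n\ge0}$ of ideals of $R$ with $I_0=R$, $I_mI_n\subseteq I_{m+n}$ for all $m,n\ge 0$, $I_n\subsetneq R$ for $n\ge1$, and $I_{n+1}\subseteq I_n$ for $n\ge1$. The analytic spread is $\ell(I)=\dim(R[It]/\mathfrak mR[It])$. *)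

theory Defs
  imports
    "HOL-Algebra.Module"
    "HOL-Algebra.QuotRing"
    "HOL-Algebra.Ideal_Product"
    "HOL-Algebra.UnivPoly"
    "HOL-Algebra.Algebraic_Closure_Type"
    "HOL-Computational_Algebra.Formal_Power_Series"
    "HOL-Library.Extended_Real"
    "HOL-Library.Liminf_Limsup"
begin

section \<open>Ideals\<close>

text \<open>Powers are taken in the multiplicative monoid of ideals, so \<open>I\<close> to the power \<open>0\<close> is
  the unit ideal.\<close>

abbreviation ideal_power :: "('a, 'b) ring_scheme \<Rightarrow> 'a set \<Rightarrow> nat \<Rightarrow> 'a set" where
  "ideal_power R I n \<equiv> I [^]\<^bsub>ideals_set R\<^esub> n"

text \<open>Meaningful for local rings only, where the maximal ideal is unique.\<close>

definition max_ideal :: "('a, 'b) ring_scheme \<Rightarrow> 'a set" where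
  "max_ideal R = (THE M. maximalideal M R)"

definition ideal_radical :: "('a, 'b) ring_scheme \<Rightarrow> 'a set \<Rightarrow> 'a set" where
  "ideal_radical R I = {a \<in> carrier R. \<exists>n::nat. n \<ge> 1 \<and> a [^]\<^bsub>R\<^esub> n \<in> I}"

definition integral_closure :: "('a, 'b) ring_scheme \<Rightarrow> 'a set \<Rightarrow> 'a set" where
  "integral_closure R I = {z \<in> carrier R. \<exists>(n::nat) a. n \<ge> 1 \<and>
     (\<forall>i\<in>{1..n}. a i \<in> ideal_power R I i) \<and>
     z [^]\<^bsub>R\<^esub> n \<oplus>\<^bsub>R\<^esub> (\<Oplus>\<^bsub>R\<^esub>i\<in>{1..n}. a i \<otimes>\<^bsub>R\<^esub> z [^]\<^bsub>R\<^esub> (n - i)) = \<zero>\<^bsub>R\<^esub>}"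

definition integrally_closed :: "('a, 'b) ring_scheme \<Rightarrow> 'a set \<Rightarrow> bool" where
  "integrally_closed R I \<longleftrightarrow> integral_closure R I = I"

definition graded_filtration :: "('a, 'b) ring_scheme \<Rightarrow> (nat \<Rightarrow> 'a set) \<Rightarrow> bool" where
  "graded_filtration R I \<longleftrightarrow>
     (\<forall>n. ideal (I n) R) \<and> I 0 = carrier R \<and>
     (\<forall>m n. ideal_prod R (I m) (I n) \<subseteq> I (m + n)) \<and>
     (\<forall>n\<ge>1. I n \<subset> carrier R) \<and>
     (\<forall>n\<ge>1. I (Suc n) \<subseteq> I n)"


section \<open>Krull dimension and height\<close>

definition prime_chain :: "('a, 'b) ring_scheme \<Rightarrow> nat \<Rightarrow> (nat \<Rightarrow> 'a set) \<Rightarrow> bool" where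
  "prime_chain R n P \<longleftrightarrow> (\<forall>i\<le>n. primeideal (P i) R) \<and> (\<forall>i<n. P i \<subset> P (Suc i))"

text \<open>The supremum is taken in \<^typ>\<open>enat\<close>, so the zero ring gets dimension \<open>0\<close>.\<close>

definition krull_dim :: "('a, 'b) ring_scheme \<Rightarrow> enat" where
  "krull_dim R = Sup {enat n | n. \<exists>P. prime_chain R n P}"

definition prime_height :: "('a, 'b) ring_scheme \<Rightarrow> 'a set \<Rightarrow> enat" where
  "prime_height R Q = Sup {enat n | n. \<exists>P. prime_chain R n P \<and> P n = Q}"

definition ideal_height :: "('a, 'b) ring_scheme \<Rightarrow> 'a set \<Rightarrow> enat" where
  "ideal_height R I = Inf {prime_height R Q | Q. primeideal Q R \<and> I \<subseteq> Q}"


section \<open>Analytic spread\<close>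

text \<open>An element of \<^term>\<open>carrier (UP R)\<close> is its coefficient function. The subring below is
  the Rees algebra \<open>R[It]\<close>, the direct sum of the \<open>I\<^sup>n t\<^sup>n\<close>.\<close>

definition rees_algebra :: "('a, 'b) ring_scheme \<Rightarrow> 'a set \<Rightarrow> ('a, nat \<Rightarrow> 'a) up_ring" where
  "rees_algebra R I =
     (UP R)\<lparr>carrier := {p \<in> carrier (UP R). \<forall>n. p n \<in> ideal_power R I n}\<rparr>"

definition analytic_spread :: "('a, 'b) ring_scheme \<Rightarrow> 'a set \<Rightarrow> enat" where
  "analytic_spread R I =
     krull_dim (rees_algebra R I Quot
       (Idl\<^bsub>rees_algebra R I\<^esub> ((\<lambda>a. up_ring.monom (UP R) a 0) ` max_ideal R)))"


section \<open>Length\<close>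

text \<open>The record type for modules extends that for rings; its fields \<open>mult\<close> and \<open>one\<close> play no
  role for modules.\<close>

definition ideal_module :: "('a, 'b) ring_scheme \<Rightarrow> 'a set \<Rightarrow> ('a, 'a) module" where
  "ideal_module R I =
     \<lparr>carrier = I, monoid.mult = undefined, monoid.one = undefined,
      ring.zero = \<zero>\<^bsub>R\<^esub>, ring.add = ring.add R, module.smult = monoid.mult R\<rparr>"

definition quot_module :: "('a, 'm, 'c) module_scheme \<Rightarrow> 'm set \<Rightarrow> ('a, 'm set) module"
  where
  "quot_module M N =
     \<lparr>carrier = a_rcosets\<^bsub>M\<^esub> N, monoid.mult = undefined, monoid.one = undefined,
      ring.zero = N, ring.add = set_add M,
      module.smult = (\<lambda>r C. \<Union>c\<in>C. N +>\<^bsub>M\<^esub> (r \<odot>\<^bsub>M\<^esub> c))\<rparr>"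

definition module_length :: "('a, 'b) ring_scheme \<Rightarrow> ('a, 'm, 'c) module_scheme \<Rightarrow> enat" where
  "module_length R M = Sup {enat n | n. \<exists>N. (\<forall>i\<le>n. submodule (N i) R M) \<and>
                                              (\<forall>i<n. N i \<subset> N (Suc i))}"


section \<open>Multiplicity sequence\<close>

definition hilbert_sum :: "('a, 'b) ring_scheme \<Rightarrow> 'a set \<Rightarrow> nat \<Rightarrow> nat \<Rightarrow> enat" where
  "hilbert_sum R I r s = (\<Sum>v\<in>{0..s}. module_length R
     (quot_module (ideal_module R (ideal_power R I v))
        (ideal_prod R (ideal_power R (max_ideal R) (r + 1)) (ideal_power R I v)
          <+>\<^bsub>R\<^esub> ideal_power R I (v + 1))))"

text \<open>Polynomials in \<open>r\<close> and \<open>s\<close> are polynomials in \<open>s\<close> whose coefficients are polynomials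
  in \<open>r\<close>.\<close>

definition is_hilbert_poly :: "('a, 'b) ring_scheme \<Rightarrow> 'a set \<Rightarrow> real poly poly \<Rightarrow> bool" where
  "is_hilbert_poly R I P \<longleftrightarrow> (\<exists>N::nat. \<forall>r\<ge>N. \<forall>s\<ge>N.
     ereal_of_enat (hilbert_sum R I r s) = ereal (poly (poly P [:real s:]) (real r)))"

text \<open>There is at most one such polynomial, since it is determined by its values at large
  integers. It exists when \<open>R\<close> is a Noetherian local ring and \<open>I\<close> is a proper ideal.\<close>

definition hilbert_poly :: "('a, 'b) ring_scheme \<Rightarrow> 'a set \<Rightarrow> real poly poly" where
  "hilbert_poly R I = (THE P. is_hilbert_poly R I P)"

text \<open>\<open>mult_seq R I i\<close> is \<open>c\<^sub>i(I; R)\<close>, for \<open>i \<le> d = dim R\<close>.\<close>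

definition mult_seq :: "('a, 'b) ring_scheme \<Rightarrow> 'a set \<Rightarrow> nat \<Rightarrow> real" where
  "mult_seq R I i = (let d = the_enat (krull_dim R) in
     fact (d - i) * fact i * Polynomial.coeff (Polynomial.coeff (hilbert_poly R I) i) (d - i))"


section \<open>The ring of power series in two variables\<close>

text \<open>\<open>k[[x,y]]\<close> is realised as \<open>k[[y]][[x]]\<close>: the outer variable is \<open>x\<close>.\<close>

abbreviation fps_ring_xy :: "('k::field) fps fps ring" where
  "fps_ring_xy \<equiv> ring_of_type_algebra"

abbreviation var_x :: "('k::field) fps fps" where
  "var_x \<equiv> fps_X"

end

theory Submission
  imports Defs
begin

text \<open>
  Take \<open>I\<^sub>n = x\<^sup>n\<^sup>+\<^sup>1(x, y\<^bsup>q(n)\<^esup>)\<close> for \<open>n \<ge> 1\<close>, where \<open>q(n) \<ge> 1\<close> is arbitrary. The product of two such ideals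
  lies in \<open>(x\<^sup>m\<^sup>+\<^sup>n\<^sup>+\<^sup>2)\<close>, hence in the ideal of index \<open>m + n\<close>, so that the filtration puts no constraint
  on \<open>q\<close>. The ideal \<open>x\<^sup>a(x, y\<^sup>q)\<close> and its powers are monomial, lengths count exponents, and
  this gives \<open>c\<^sub>0 = 0\<close>, \<open>c\<^sub>1 = a\<close> and \<open>c\<^sub>2 = q(a + 1)\<close>. Choosing \<open>q(n) / n\<close> to tend to \<open>A\<close> along the even
  and to \<open>B\<close> along the odd numbers prescribes the lower and upper limit of \<open>c\<^sub>2 / n\<^sup>2\<close>.

  For the dimension of \<open>k[[x, y]]\<close>, let \<open>P \<subset> Q\<close> be primes with \<open>P \<noteq> 0\<close>. If \<open>y \<notin> Q\<close>, then Weierstrass division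
  by an element of \<open>P\<close> makes every \<open>h \<in> Q - P\<close> algebraic over \<open>k[[y]]\<close> modulo \<open>P\<close>, and the constant term of a
  relation of minimal degree yields a power of \<open>y\<close> in \<open>Q\<close>, a contradiction. The fibre cone of \<open>x\<^sup>a(x, y\<^sup>q)\<close> is
  a polynomial ring in two variables.
\<close>

text \<open>The spare factor x is what frees q. With x^n(x, y^q(n)) instead, the product of x^m
  y^q(m) and x^n y^q(n) lies in the ideal of index m + n only if q(m + n) <= q(m) + q(n); then q(n)
  / n converges by Fekete's lemma, c_2 / n^2 converges with it, and only A = B < \<infinity> could
  be reached. With exponent n + 1 the order of a product in x exceeds the single order at which y
  matters, while c_1 = n + 1 and c_2 = q(n)(n + 2) keep the same leading growth.

  The invariants of I = x^a(x, y^q) come from one picture: the exponents of I^n fill the region to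
  the right of column a n and above the segment from (a n, q n) to ((a + 1) n, 0). Points between
  consecutive regions give the Hilbert function, and the lattice points on the segment give the
  fibre cone. Primes of the power series ring matter because the definition of c_i refers to the
  dimension of the ring.\<close>

lemma ring_of_type_algebra_simps [simp]:
  fixes x y :: "'a::comm_ring_1"
  shows "carrier (ring_of_type_algebra :: 'a ring) = UNIV"
    and "x \<otimes>\<^bsub>ring_of_type_algebra\<^esub> y = x * y"
    and "\<one>\<^bsub>ring_of_type_algebra\<^esub> = (1::'a)"
    and "\<zero>\<^bsub>ring_of_type_algebra\<^esub> = (0::'a)"
    and "x \<oplus>\<^bsub>ring_of_type_algebra\<^esub> y = x + y"
  by (auto simp: ring_of_type_algebra_def)

interpretation type_ring: cring "ring_of_type_algebra :: 'a::comm_ring_1 ring"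
  by (rule cring_from_type_algebra)

lemma ring_of_type_algebra_a_inv [simp]:
  "\<ominus>\<^bsub>ring_of_type_algebra\<^esub> x = - (x :: 'a::comm_ring_1)"
  by (rule type_ring.minus_equality) auto

lemma ring_of_type_algebra_nat_pow [simp]:
  "x [^]\<^bsub>ring_of_type_algebra\<^esub> (n::nat) = (x :: 'a::comm_ring_1) ^ n"
  by (induction n) (auto simp: mult.commute)

lemma ring_of_type_algebra_finsum [simp]:
  "finsum ring_of_type_algebra f A = (sum f A :: 'a::comm_ring_1)"
proof (cases "finite A")
  case True
  then show ?thesis by (induction A) auto
next
  case False
  then show ?thesis by simp
qed

section \<open>Ideals and primes of rings carried by a whole type\<close>

lemma ideal_ring_of_type_algebra_iff:
  fixes I :: "'a::comm_ring_1 set"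
  shows "ideal I ring_of_type_algebra \<longleftrightarrow>
    0 \<in> I \<and> (\<forall>a\<in>I. \<forall>b\<in>I. a + b \<in> I) \<and> (\<forall>r. \<forall>a\<in>I. r * a \<in> I)" (is "_ \<longleftrightarrow> ?rhs")
proof
  assume "ideal I ring_of_type_algebra"
  then interpret ideal I "ring_of_type_algebra :: 'a ring" .
  show ?rhs using zero_closed a_closed I_l_closed by auto
next
  assume r: ?rhs
  have "- a \<in> I" if "a \<in> I" for a
    using r that by (metis mult_minus1)
  then have "subgroup I (add_monoid (ring_of_type_algebra :: 'a ring))"
    using r by (intro type_ring.add.subgroupI) (auto simp flip: a_inv_def)
  moreover have "a * x \<in> I" if "a \<in> I" for a x
    using r that by (metis mult.commute)
  ultimately show "ideal I ring_of_type_algebra"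
    using r by (intro idealI type_ring.ring_axioms) auto
qed

lemma primeideal_ring_of_type_algebra_iff:
  fixes P :: "'a::comm_ring_1 set"
  shows "primeideal P ring_of_type_algebra \<longleftrightarrow>
    ideal P ring_of_type_algebra \<and> 1 \<notin> P \<and> (\<forall>a b. a * b \<in> P \<longrightarrow> a \<in> P \<or> b \<in> P)" (is "_ \<longleftrightarrow> ?rhs")
proof
  assume "primeideal P ring_of_type_algebra"
  then interpret primeideal P "ring_of_type_algebra :: 'a ring" .
  show ?rhs using I_notcarr one_imp_carrier I_prime is_ideal by auto
next
  assume ?rhs
  then show "primeideal P ring_of_type_algebra"
    by (intro primeidealI type_ring.cring_axioms) auto
qed

lemma ideal_prod_subset_iff:
  fixes I J K :: "'a::comm_ring_1 set"
  assumes "ideal K ring_of_type_algebra"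
  shows "ideal_prod ring_of_type_algebra I J \<subseteq> K \<longleftrightarrow> (\<forall>f\<in>I. \<forall>g\<in>J. f * g \<in> K)"
proof
  assume "ideal_prod ring_of_type_algebra I J \<subseteq> K"
  then show "\<forall>f\<in>I. \<forall>g\<in>J. f * g \<in> K"
    using ideal_prod.prod[of _ I _ J "ring_of_type_algebra :: 'a ring"] by auto
next
  assume *: "\<forall>f\<in>I. \<forall>g\<in>J. f * g \<in> K"
  show "ideal_prod ring_of_type_algebra I J \<subseteq> K"
  proof
    fix h assume "h \<in> ideal_prod ring_of_type_algebra I J"
    then show "h \<in> K"
      by induction (use assms * in \<open>auto simp: ideal_ring_of_type_algebra_iff\<close>)
  qed
qed

section \<open>Monomial ideals\<close>

text \<open>Membership is a condition on the support, not on generators, so it is tested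
  coefficientwise and makes sense for any \<open>E\<close>. Being an ideal requires
  \<open>up_closed E\<close>; being generated by monomials requires finitely many corners.\<close>

definition mon_ideal :: "(nat \<times> nat) set \<Rightarrow> 'k::field fps fps set" where
  "mon_ideal E = {f. \<forall>i j. (i, j) \<notin> E \<longrightarrow> f $ i $ j = 0}"

definition up_closed :: "(nat \<times> nat) set \<Rightarrow> bool" where
  "up_closed E \<longleftrightarrow> (\<forall>i j i' j'. (i, j) \<in> E \<longrightarrow> i \<le> i' \<longrightarrow> j \<le> j' \<longrightarrow> (i', j') \<in> E)"

definition up_set :: "(nat \<times> nat) set \<Rightarrow> (nat \<times> nat) set" where
  "up_set K = {(i, j). \<exists>(i0, j0)\<in>K. i0 \<le> i \<and> j0 \<le> j}"

definition exp_sum :: "(nat \<times> nat) set \<Rightarrow> (nat \<times> nat) set \<Rightarrow> (nat \<times> nat) set" where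
  "exp_sum E F = {(i + i', j + j') | i j i' j'. (i, j) \<in> E \<and> (i', j') \<in> F}"

definition xy_monom :: "nat \<Rightarrow> nat \<Rightarrow> 'k::field fps fps" where
  "xy_monom i j = fps_X ^ i * fps_const (fps_X ^ j)"

lemma fps_fps_mult_nth:
  fixes f g :: "'k::comm_ring_1 fps fps"
  shows "(f * g) $ n $ m = (\<Sum>i\<le>n. \<Sum>j\<le>m. f $ i $ j * g $ (n - i) $ (m - j))"
  by (simp add: fps_mult_nth fps_sum_nth atLeast0AtMost)

lemma xy_monom_mult_nth:
  "(xy_monom i j * f) $ n $ m = (if i \<le> n \<and> j \<le> m then f $ (n - i) $ (m - j) else 0)"
  by (auto simp: xy_monom_def mult.assoc fps_X_power_mult_nth)

lemma xy_monom_nth: "xy_monom i j $ n $ m = (if n = i \<and> m = j then 1 else 0)"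
  using xy_monom_mult_nth[of i j 1 n m] by (auto simp: le_less)

lemma xy_monom_mult: "xy_monom i j * xy_monom i' j' = xy_monom (i + i') (j + j')"
  by (simp add: xy_monom_def power_add fps_const_mult[symmetric] mult_ac del: fps_const_mult)

lemma fps_fps_eqI: "(\<And>i j. f $ i $ j = g $ i $ j) \<Longrightarrow> f = g"
  by (simp add: fps_ext)

lemma mon_ideal_mono: "E \<subseteq> F \<Longrightarrow> mon_ideal E \<subseteq> mon_ideal F"
  by (auto simp: mon_ideal_def)

lemma xy_monom_in_mon_ideal_iff: "xy_monom i j \<in> mon_ideal E \<longleftrightarrow> (i, j) \<in> E"
  by (auto simp: mon_ideal_def xy_monom_nth)

lemma mult_in_mon_ideal:
  assumes "f \<in> mon_ideal E" "g \<in> mon_ideal F"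
  shows "f * g \<in> mon_ideal (exp_sum E F)"
proof -
  have "f $ i $ j * g $ (n - i) $ (m - j) = 0"
    if nm: "(n, m) \<notin> exp_sum E F" and "i \<le> n" "j \<le> m" for n m i j
  proof -
    have "(i, j) \<notin> E \<or> (n - i, m - j) \<notin> F"
    proof (rule ccontr)
      assume "\<not> ?thesis"
      then have "(i + (n - i), j + (m - j)) \<in> exp_sum E F"
        unfolding exp_sum_def by blast
      with that show False by simp
    qed
    with assms show ?thesis by (auto simp: mon_ideal_def)
  qed
  then show ?thesis
    by (auto simp: mon_ideal_def fps_fps_mult_nth intro!: sum.neutral)
qed

lemma exp_sum_UNIV: "up_closed E \<Longrightarrow> exp_sum UNIV E \<subseteq> E"
  by (auto simp: exp_sum_def up_closed_def)

lemma ideal_mon_ideal: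
  assumes "up_closed E"
  shows "ideal (mon_ideal E) (fps_ring_xy :: 'k::field fps fps ring)"
proof -
  have "r * a \<in> mon_ideal E" if "a \<in> mon_ideal E" for r a :: "'k fps fps"
    using mult_in_mon_ideal[of r UNIV a E] that mon_ideal_mono[OF exp_sum_UNIV[OF assms]]
    by (auto simp: mon_ideal_def[of UNIV])
  then show ?thesis
    by (auto simp: ideal_ring_of_type_algebra_iff) (auto simp: mon_ideal_def)
qed

text \<open>Induction on the corners: the part of a series supported above one corner is a single
  multiple of that corner's monomial, and the rest is supported above the remaining corners.
  Finiteness of \<open>K\<close> matters because an ideal admits only finite sums, whereas supports
  are infinite.\<close>

lemma mon_ideal_up_set_subset:
  assumes "finite K" "ideal J (fps_ring_xy :: 'k::field fps fps ring)"
    and "\<And>i j. (i, j) \<in> K \<Longrightarrow> xy_monom i j \<in> J"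
  shows "mon_ideal (up_set K) \<subseteq> J"
  using assms(1,3)
proof (induction K)
  case empty
  have "f = 0" if "f \<in> mon_ideal (up_set {})" for f :: "'k fps fps"
    using that by (auto simp: mon_ideal_def up_set_def intro: fps_fps_eqI)
  then show ?case using assms(2) by (auto simp: ideal_ring_of_type_algebra_iff)
next
  case (insert k K)
  obtain a b where k: "k = (a, b)" by force
  show ?case
  proof
    fix f :: "'k fps fps" assume f: "f \<in> mon_ideal (up_set (insert k K))"
    define g where "g = Abs_fps (\<lambda>i. Abs_fps (\<lambda>j. f $ (i + a) $ (j + b)))"
    define h where "h = Abs_fps (\<lambda>i. Abs_fps (\<lambda>j. if a \<le> i \<and> b \<le> j then 0 else f $ i $ j))"
    have "f = xy_monom a b * g + h"
      by (rule fps_fps_eqI) (auto simp: xy_monom_mult_nth g_def h_def)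
    moreover have "h \<in> J"
    proof -
      have "h \<in> mon_ideal (up_set K)"
        using f by (auto simp: mon_ideal_def h_def up_set_def k)
      with insert show ?thesis by auto
    qed
    moreover have "xy_monom a b \<in> J" using insert.prems k by auto
    ultimately show "f \<in> J"
      using assms(2) by (auto simp: ideal_ring_of_type_algebra_iff mult.commute[of _ g])
  qed
qed

lemma up_closed_exp_sum:
  assumes "up_closed F"
  shows "up_closed (exp_sum E F)"
  unfolding up_closed_def
proof (intro allI impI)
  fix i j i' j' assume "(i, j) \<in> exp_sum E F" and le: "i \<le> i'" "j \<le> j'"
  then obtain i1 j1 i2 j2 where ij: "i = i1 + i2" "j = j1 + j2" "(i1, j1) \<in> E" "(i2, j2) \<in> F"
    by (auto simp: exp_sum_def)
  then have "(i2 + (i' - i), j2 + (j' - j)) \<in> F"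
    using assms unfolding up_closed_def by (meson le_add1)
  with ij(3) have "(i1 + (i2 + (i' - i)), j1 + (j2 + (j' - j))) \<in> exp_sum E F"
    unfolding exp_sum_def by blast
  with le show "(i', j') \<in> exp_sum E F" by (simp add: ij(1,2))
qed

text \<open>The product ideal consists of finite sums of products, so the inclusion from right to
  left needs a finite set \<open>K\<close> of monomials generating the right-hand side, each of them
  a product of monomials of the two factors.\<close>

lemma ideal_prod_mon_ideal:
  assumes "up_closed E" "up_closed F" "finite K" "K \<subseteq> exp_sum E F" "exp_sum E F \<subseteq> up_set K"
  shows "ideal_prod (fps_ring_xy :: 'k::field fps fps ring) (mon_ideal E) (mon_ideal F)
    = mon_ideal (exp_sum E F)" (is "?P = _")
proof
  show "?P \<subseteq> mon_ideal (exp_sum E F)"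
    by (subst ideal_prod_subset_iff[OF ideal_mon_ideal[OF up_closed_exp_sum[OF assms(2)]]]) (auto intro: mult_in_mon_ideal)
  have "xy_monom i j \<in> ?P" if "(i, j) \<in> K" for i j
  proof -
    from that assms obtain i1 j1 i2 j2
      where "i = i1 + i2" "j = j1 + j2" "(i1, j1) \<in> E" "(i2, j2) \<in> F"
      by (auto simp: exp_sum_def)
    then show ?thesis
      using ideal_prod.prod[of "xy_monom i1 j1" "mon_ideal E" "xy_monom i2 j2" "mon_ideal F"
          "fps_ring_xy :: 'k fps fps ring"]
      by (simp add: xy_monom_in_mon_ideal_iff xy_monom_mult)
  qed
  then have "mon_ideal (up_set K) \<subseteq> ?P"
    using assms by (intro mon_ideal_up_set_subset type_ring.ideal_prod_is_ideal ideal_mon_ideal) auto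
  then show "mon_ideal (exp_sum E F) \<subseteq> ?P"
    using mon_ideal_mono[OF assms(5)] by blast
qed

lemma set_add_mon_ideal:
  "mon_ideal E <+>\<^bsub>fps_ring_xy\<^esub> mon_ideal F = (mon_ideal (E \<union> F) :: 'k::field fps fps set)"
proof
  show "mon_ideal E <+>\<^bsub>fps_ring_xy\<^esub> mon_ideal F \<subseteq> (mon_ideal (E \<union> F) :: 'k fps fps set)"
    by (auto simp: set_add_def' mon_ideal_def)
  show "mon_ideal (E \<union> F) \<subseteq> mon_ideal E <+>\<^bsub>fps_ring_xy\<^esub> (mon_ideal F :: 'k fps fps set)"
  proof
    fix f :: "'k fps fps" assume f: "f \<in> mon_ideal (E \<union> F)"
    define g where "g = Abs_fps (\<lambda>i. Abs_fps (\<lambda>j. if (i, j) \<in> E then f $ i $ j else 0))"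
    define h where "h = Abs_fps (\<lambda>i. Abs_fps (\<lambda>j. if (i, j) \<in> E then 0 else f $ i $ j))"
    have "f = g + h"
      by (rule fps_fps_eqI) (auto simp: g_def h_def)
    moreover have "g \<in> mon_ideal E" "h \<in> mon_ideal F"
      using f by (auto simp: mon_ideal_def g_def h_def)
    ultimately show "f \<in> mon_ideal E <+>\<^bsub>fps_ring_xy\<^esub> mon_ideal F"
      unfolding set_add_def' by auto
  qed
qed

section \<open>Length of quotients of ideals\<close>

lemma Sup_enat_eqI:
  assumes "P c" "\<And>n. P n \<Longrightarrow> n \<le> c"
  shows "Sup {enat n |n. P n} = enat c"
  using assms by (intro antisym Sup_least Sup_upper) auto

context
  fixes I N :: "'a::comm_ring_1 set"
  assumes I: "ideal I ring_of_type_algebra" and N: "ideal N ring_of_type_algebra"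
begin

private abbreviation (input) "Q \<equiv> quot_module (ideal_module ring_of_type_algebra I) N"
private abbreviation (input) "coset a \<equiv> N +>\<^bsub>ideal_module ring_of_type_algebra I\<^esub> a"

lemma ideal_coset_def': "coset a = {h + a |h. h \<in> N}"
  by (auto simp: a_r_coset_def r_coset_def ideal_module_def)

private lemma N_closed: "0 \<in> N" "a \<in> N \<Longrightarrow> b \<in> N \<Longrightarrow> a + b \<in> N" "a \<in> N \<Longrightarrow> r * a \<in> N"
  "a \<in> N \<Longrightarrow> - a \<in> N" "a \<in> N \<Longrightarrow> b \<in> N \<Longrightarrow> a - b \<in> N"
proof -
  show *: "0 \<in> N" "a \<in> N \<Longrightarrow> b \<in> N \<Longrightarrow> a + b \<in> N" "a \<in> N \<Longrightarrow> r * a \<in> N" for a b r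
    using N by (auto simp: ideal_ring_of_type_algebra_iff)
  show "a \<in> N \<Longrightarrow> - a \<in> N" for a
    using *(3)[of a "- 1"] by simp
  then show "a \<in> N \<Longrightarrow> b \<in> N \<Longrightarrow> a - b \<in> N"
    using *(2)[of a "- b"] by simp
qed

lemma mem_ideal_coset_iff: "u \<in> coset a \<longleftrightarrow> u - a \<in> N"
proof
  assume "u - a \<in> N"
  then show "u \<in> coset a"
    unfolding ideal_coset_def' by (intro CollectI exI[of _ "u - a"]) simp
qed (auto simp: ideal_coset_def')

lemma ideal_coset_eq_iff: "coset a = coset b \<longleftrightarrow> a - b \<in> N"
proof
  assume "coset a = coset b"
  moreover have "a \<in> coset a" using N_closed by (simp add: mem_ideal_coset_iff)
  ultimately show "a - b \<in> N" by (simp add: mem_ideal_coset_iff)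
next
  assume ab: "a - b \<in> N"
  have "u - a \<in> N \<longleftrightarrow> u - b \<in> N" for u
    using N_closed(2)[of "u - a" "a - b"] N_closed(5)[of "u - b" "a - b"] ab by auto
  then show "coset a = coset b"
    by (auto simp: mem_ideal_coset_iff)
qed

lemma quot_ideal_module_simps:
  shows "carrier Q = {coset a |a. a \<in> I}" "coset a \<oplus>\<^bsub>Q\<^esub> coset b = coset (a + b)"
    "r \<odot>\<^bsub>Q\<^esub> coset a = coset (r * a)" "\<zero>\<^bsub>Q\<^esub> = coset 0"
proof -
  show "carrier Q = {coset a |a. a \<in> I}"
    by (auto simp: quot_module_def A_RCOSETS_def RCOSETS_def a_r_coset_def ideal_module_def)
  show "\<zero>\<^bsub>Q\<^esub> = coset 0"
    by (auto simp: quot_module_def ideal_coset_def')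
  show "coset a \<oplus>\<^bsub>Q\<^esub> coset b = coset (a + b)"
  proof -
    have "x \<oplus>\<^bsub>ideal_module ring_of_type_algebra I\<^esub> y = x + y" for x y
      by (simp add: ideal_module_def)
    then have "coset a \<oplus>\<^bsub>Q\<^esub> coset b = {u + v |u v. u \<in> coset a \<and> v \<in> coset b}"
      by (auto simp: quot_module_def set_add_def set_mult_def)
    also have "\<dots> = coset (a + b)"
    proof (intro Set.set_eqI iffI)
      fix w assume "w \<in> {u + v |u v. u \<in> coset a \<and> v \<in> coset b}"
      then obtain u v where "w = u + v" "u - a \<in> N" "v - b \<in> N"
        by (auto simp: mem_ideal_coset_iff)
      then show "w \<in> coset (a + b)"
        using N_closed(2)[of "u - a" "v - b"] by (simp add: mem_ideal_coset_iff algebra_simps)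
    next
      fix w assume "w \<in> coset (a + b)"
      then have "w - b \<in> coset a" "b \<in> coset b"
        using N_closed(1) by (simp_all add: mem_ideal_coset_iff algebra_simps)
      then show "w \<in> {u + v |u v. u \<in> coset a \<and> v \<in> coset b}"
        by (intro CollectI exI[of _ "w - b"] exI[of _ b]) simp
    qed
    finally show ?thesis .
  qed
  show "r \<odot>\<^bsub>Q\<^esub> coset a = coset (r * a)"
  proof -
    have "r \<odot>\<^bsub>Q\<^esub> coset a = (\<Union>c\<in>coset a. coset (r * c))"
      by (auto simp: quot_module_def ideal_module_def)
    also have "\<dots> = (\<Union>c\<in>coset a. coset (r * a))"
      by (intro SUP_cong refl, subst ideal_coset_eq_iff)
        (auto simp: mem_ideal_coset_iff simp flip: right_diff_distrib intro!: N_closed(3))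
    also have "\<dots> = coset (r * a)"
    proof -
      have "a \<in> coset a" using N_closed(1) by (simp add: mem_ideal_coset_iff)
      then show ?thesis by blast
    qed
    finally show ?thesis .
  qed
qed

lemma submodule_image_coset:
  assumes L: "ideal L ring_of_type_algebra" "N \<subseteq> L" "L \<subseteq> I"
  shows "submodule ((\<lambda>a. coset a) ` L) ring_of_type_algebra Q"
proof -
  note Lc = L(1)[unfolded ideal_ring_of_type_algebra_iff]
  have neg: "- a \<in> L" if "a \<in> L" for a
    using Lc that by (metis mult_minus1)
  \<comment> \<open>The quotient has not been established as a group, so the inverse, a definite
    description, is evaluated by hand.\<close>
  have inv: "inv\<^bsub>add_monoid Q\<^esub> (coset a) = coset (- a)" if "a \<in> L" for a
    unfolding m_inv_def
  proof (rule the_equality)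
    show "coset (- a) \<in> carrier (add_monoid Q) \<and>
      coset a \<otimes>\<^bsub>add_monoid Q\<^esub> coset (- a) = \<one>\<^bsub>add_monoid Q\<^esub> \<and>
      coset (- a) \<otimes>\<^bsub>add_monoid Q\<^esub> coset a = \<one>\<^bsub>add_monoid Q\<^esub>"
    proof (intro conjI)
      have "- a \<in> I" using neg[OF that] L by blast
      then show "coset (- a) \<in> carrier (add_monoid Q)"
        by (auto simp: quot_ideal_module_simps(1))
    qed (simp_all add: quot_ideal_module_simps(2,4))
    fix y assume y: "y \<in> carrier (add_monoid Q) \<and> coset a \<otimes>\<^bsub>add_monoid Q\<^esub> y = \<one>\<^bsub>add_monoid Q\<^esub> \<and>
      y \<otimes>\<^bsub>add_monoid Q\<^esub> coset a = \<one>\<^bsub>add_monoid Q\<^esub>"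
    then obtain b where b: "y = coset b" by (auto simp: quot_ideal_module_simps(1))
    with y have "coset (a + b) = coset 0" by (simp add: quot_ideal_module_simps(2,4))
    then show "y = coset (- a)"
      unfolding b ideal_coset_eq_iff by (simp add: add.commute)
  qed
  have "inv\<^bsub>add_monoid Q\<^esub> x \<in> (\<lambda>a. coset a) ` L" if "x \<in> (\<lambda>a. coset a) ` L" for x
  proof -
    from that obtain a where a: "a \<in> L" "x = coset a" by blast
    show ?thesis unfolding a(2) inv[OF a(1)] using neg[OF a(1)] by blast
  qed
  moreover have "(\<lambda>a. coset a) ` L \<subseteq> carrier (add_monoid Q)"
    using L by (auto simp: quot_ideal_module_simps)
  moreover have "x \<oplus>\<^bsub>Q\<^esub> y \<in> (\<lambda>a. coset a) ` L"
    if "x \<in> (\<lambda>a. coset a) ` L" "y \<in> (\<lambda>a. coset a) ` L" for x y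
    using that Lc by (auto simp: quot_ideal_module_simps)
  moreover have "r \<odot>\<^bsub>Q\<^esub> x \<in> (\<lambda>a. coset a) ` L" if "x \<in> (\<lambda>a. coset a) ` L" for r x
    using that Lc by (auto simp: quot_ideal_module_simps)
  moreover have "\<zero>\<^bsub>Q\<^esub> \<in> (\<lambda>a. coset a) ` L"
    using Lc by (auto simp: quot_ideal_module_simps)
  ultimately show ?thesis
    by (intro submodule.intro subgroup.intro submodule_axioms.intro) simp_all
qed

lemma submodule_vimage_coset:
  assumes S: "submodule S ring_of_type_algebra Q"
  defines "L \<equiv> {a\<in>I. coset a \<in> S}"
  shows "ideal L ring_of_type_algebra" "N \<subseteq> I \<Longrightarrow> N \<subseteq> L" "L \<subseteq> I" "S = (\<lambda>a. coset a) ` L"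
proof -
  interpret submodule S "ring_of_type_algebra :: 'a ring" Q by fact
  note Ic = I[unfolded ideal_ring_of_type_algebra_iff]
  have z: "coset 0 \<in> S"
    using one_closed by (simp add: quot_ideal_module_simps)
  moreover have "coset (a + b) \<in> S" if "coset a \<in> S" "coset b \<in> S" for a b
    using m_closed[OF that] by (simp add: quot_ideal_module_simps)
  moreover have "coset (r * a) \<in> S" if "coset a \<in> S" for a r
    using smult_closed[OF _ that, of r] by (simp add: quot_ideal_module_simps)
  ultimately show "ideal L ring_of_type_algebra"
    unfolding ideal_ring_of_type_algebra_iff L_def using Ic by auto
  have "coset a = coset 0" if "a \<in> N" for a
    using that by (subst ideal_coset_eq_iff) simp
  with z show "N \<subseteq> I \<Longrightarrow> N \<subseteq> L" by (auto simp: L_def)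
  show "L \<subseteq> I" by (auto simp: L_def)
  show "S = (\<lambda>a. coset a) ` L"
    using subset by (auto simp: L_def quot_ideal_module_simps)
qed

text \<open>The correspondence between submodules of I/N and ideals between N and I preserves strict
  inclusion in both directions. From here on lengths are read off chains of ideals and cosets
  disappear.\<close>

lemma module_length_quot_ideal:
  assumes "N \<subseteq> I"
  shows "module_length ring_of_type_algebra Q =
    Sup {enat n |n. \<exists>L. (\<forall>i\<le>n. ideal (L i) ring_of_type_algebra \<and> N \<subseteq> L i \<and> L i \<subseteq> I) \<and>
      (\<forall>i<n. L i \<subset> L (Suc i))}"
proof -
  have "(\<exists>S. (\<forall>i\<le>n. submodule (S i) ring_of_type_algebra Q) \<and> (\<forall>i<n. S i \<subset> S (Suc i))) \<longleftrightarrow>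
    (\<exists>L. (\<forall>i\<le>n. ideal (L i) ring_of_type_algebra \<and> N \<subseteq> L i \<and> L i \<subseteq> I) \<and>
      (\<forall>i<n. L i \<subset> L (Suc i)))" (is "?l = ?r") for n :: nat
  proof
    assume ?l
    then obtain S where S: "\<And>i. i \<le> n \<Longrightarrow> submodule (S i) ring_of_type_algebra Q"
      "\<And>i. i < n \<Longrightarrow> S i \<subset> S (Suc i)" by blast
    define L where "L i = {a\<in>I. coset a \<in> S i}" for i
    have "S i = (\<lambda>a. coset a) ` L i" if "i \<le> n" for i
      using submodule_vimage_coset(4)[OF S(1)[OF that]] by (simp add: L_def)
    then have "L i \<noteq> L (Suc i)" if "i < n" for i
      using S(2)[OF that] that by (metis Suc_leI less_imp_le psubset_eq)
    moreover have "L i \<subseteq> L (Suc i)" if "i < n" for i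
      using S(2)[OF that] by (auto simp: L_def)
    ultimately have "L i \<subset> L (Suc i)" if "i < n" for i
      using that by blast
    moreover have "ideal (L i) ring_of_type_algebra" "N \<subseteq> L i" "L i \<subseteq> I" if "i \<le> n" for i
      using submodule_vimage_coset[OF S(1)[OF that]] assms unfolding L_def[symmetric] by blast+
    ultimately show ?r
      by (intro exI[of _ L]) simp
  next
    assume ?r
    then obtain L where L: "\<And>i. i \<le> n \<Longrightarrow> ideal (L i) ring_of_type_algebra \<and> N \<subseteq> L i \<and> L i \<subseteq> I"
      "\<And>i. i < n \<Longrightarrow> L i \<subset> L (Suc i)" by blast
    define S where "S i = (\<lambda>a. coset a) ` L i" for i
    \<comment> \<open>Since \<open>L i\<close> contains \<open>N\<close>, it is a union of cosets;
      this is what keeps strict inclusions strict after passing to the quotient.\<close>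
    have mem: "coset a \<in> S i \<longleftrightarrow> a \<in> L i" if i: "i \<le> n" for a i
    proof
      assume "coset a \<in> S i"
      then obtain b where b: "b \<in> L i" "a - b \<in> N"
        unfolding S_def by (auto simp only: image_iff ideal_coset_eq_iff)
      then have "b + (a - b) \<in> L i"
        using L(1)[OF i] unfolding ideal_ring_of_type_algebra_iff by blast
      then show "a \<in> L i" by simp
    qed (auto simp: S_def)
    have "S i \<subset> S (Suc i)" if "i < n" for i
    proof -
      from L(2)[OF that] obtain a where a: "a \<in> L (Suc i)" "a \<notin> L i" by blast
      have "coset a \<in> S (Suc i)" "coset a \<notin> S i"
        using mem[of i a] mem[of "Suc i" a] that a by auto
      moreover have "S i \<subseteq> S (Suc i)"
        unfolding S_def using L(2)[OF that] by blast
      ultimately show ?thesis by blast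
    qed
    moreover have "submodule (S i) ring_of_type_algebra Q" if "i \<le> n" for i
      unfolding S_def using L(1)[OF that] by (intro submodule_image_coset) simp_all
    ultimately show ?l
      by (intro exI[of _ S]) simp
  qed
  then show ?thesis by (simp add: module_length_def)
qed

end

section \<open>Lengths of quotients of monomial ideals\<close>

lemma up_closed_flag:
  assumes "up_closed E" "up_closed F" "F \<subseteq> E" "finite (E - F)"
  shows "\<exists>G. (\<forall>i\<le>card (E - F). up_closed (G i) \<and> F \<subseteq> G i \<and> G i \<subseteq> E) \<and>
    (\<forall>i<card (E - F). G i \<subset> G (Suc i)) \<and> G 0 = F"
  using assms
proof (induction "card (E - F)" arbitrary: F)
  case 0
  then show ?case by (intro exI[of _ "\<lambda>_. F"]) auto
next
  case (Suc c)
  have ne: "E - F \<noteq> {}" using Suc.hyps(2) by (metis card.empty nat.distinct(1))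
  \<comment> \<open>A point of largest total degree is added first: whatever lies above it in
    \<open>E\<close> has larger degree, hence is already in \<open>F\<close>, and
    \<open>insert p F\<close> stays closed upwards.\<close>
  define m where "m = Max ((\<lambda>p. fst p + snd p) ` (E - F))"
  have "m \<in> (\<lambda>p. fst p + snd p) ` (E - F)"
    using Suc.prems(4) ne unfolding m_def by (intro Max_in) auto
  then obtain p where p: "p \<in> E - F" "m = fst p + snd p" by blast
  have p': "fst p' + snd p' \<le> fst p + snd p" if "p' \<in> E - F" for p'
  proof -
    have "fst p' + snd p' \<le> m"
      unfolding m_def using Suc.prems(4) imageI[OF that] by (intro Max_ge finite_imageI)
    then show ?thesis by (simp add: p)
  qed
  have up: "up_closed (insert p F)"
    unfolding up_closed_def
  proof (intro allI impI)
    fix i j i' j' assume *: "(i, j) \<in> insert p F" "i \<le> i'" "j \<le> j'"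
    show "(i', j') \<in> insert p F"
    proof (cases "(i', j') \<in> F")
      case False
      with * Suc.prems(2) have "p = (i, j)" unfolding up_closed_def by blast
      moreover from this have "(i', j') \<in> E - F"
        using p(1) * False Suc.prems(1) unfolding up_closed_def by blast
      ultimately show ?thesis using p'[of "(i', j')"] * by auto
    qed auto
  qed
  have "E - insert p F = (E - F) - {p}" by auto
  then have c: "card (E - insert p F) = c"
    using p Suc by (metis card_Diff_singleton diff_Suc_1)
  have "insert p F \<subseteq> E" "finite (E - insert p F)"
    using p Suc.prems(3,4) by (auto intro: finite_subset[of "E - insert p F" "E - F"])
  from Suc.hyps(1)[OF c[symmetric] Suc.prems(1) up this] obtain G where G:
    "\<And>i. i \<le> c \<Longrightarrow> up_closed (G i) \<and> insert p F \<subseteq> G i \<and> G i \<subseteq> E"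
    "\<And>i. i < c \<Longrightarrow> G i \<subset> G (Suc i)" "G 0 = insert p F"
    unfolding c by blast
  define H where "H i = (case i of 0 \<Rightarrow> F | Suc i \<Rightarrow> G i)" for i
  have "up_closed (H i) \<and> F \<subseteq> H i \<and> H i \<subseteq> E" if "i \<le> Suc c" for i
    using that G(1)[of "i - 1"] Suc.prems by (cases i) (auto simp: H_def)
  moreover have "H i \<subset> H (Suc i)" if "i < Suc c" for i
    using that G(2)[of "i - 1"] G(3) p(1) by (cases i) (auto simp: H_def)
  moreover have "H 0 = F" by (simp add: H_def)
  ultimately show ?case
    unfolding Suc.hyps(2)[symmetric] by blast
qed

lemma chain_card_bound:
  assumes "\<And>i. i < n \<Longrightarrow> T i \<subset> T (Suc i)" "\<And>i. i \<le> n \<Longrightarrow> T i \<subseteq> D" "finite D"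
  shows "n \<le> card D"
proof -
  have "i \<le> n \<Longrightarrow> i \<le> card (T i)" for i
  proof (induction i)
    case (Suc i)
    then have "card (T i) < card (T (Suc i))"
      by (intro psubset_card_mono finite_subset[OF assms(2) assms(3)] assms(1)) auto
    with Suc show ?case by auto
  qed auto
  from this[of n] show ?thesis
    using card_mono[OF assms(3) assms(2)[of n]] by simp
qed

text \<open>A flag of exponent sets gives a chain of length \<open>card (E - F)\<close>. Conversely,
  an ideal in between is measured by the set of positions in \<open>E - F\<close> at which its
  elements can have their first nonzero coefficient. Nested ideals with the same such set are equal,
  so along any strict chain these sets grow strictly inside a finite set.\<close>

lemma module_length_quot_mon_ideal:
  assumes E: "up_closed E" and F: "up_closed F" and FE: "F \<subseteq> E" and fin: "finite (E - F)"
  shows "module_length fps_ring_xy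
    (quot_module (ideal_module (fps_ring_xy :: 'k::field fps fps ring) (mon_ideal E)) (mon_ideal F))
    = enat (card (E - F))"
  unfolding module_length_quot_ideal[OF ideal_mon_ideal[OF E] ideal_mon_ideal[OF F] mon_ideal_mono[OF FE]]
proof (rule Sup_enat_eqI)
  from up_closed_flag[OF assms] obtain G where G:
    "\<And>i. i \<le> card (E - F) \<Longrightarrow> up_closed (G i) \<and> F \<subseteq> G i \<and> G i \<subseteq> E"
    "\<And>i. i < card (E - F) \<Longrightarrow> G i \<subset> G (Suc i)" by blast
  have "mon_ideal A \<subset> (mon_ideal B :: 'k fps fps set)" if "A \<subset> B" for A B
  proof -
    from that obtain i j where "(i, j) \<in> B" "(i, j) \<notin> A" by auto
    then have "xy_monom i j \<in> mon_ideal B" "xy_monom i j \<notin> (mon_ideal A :: 'k fps fps set)"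
      by (auto simp: xy_monom_in_mon_ideal_iff)
    with mon_ideal_mono[of A B] that show ?thesis by blast
  qed
  with G show "\<exists>L. (\<forall>i\<le>card (E - F). ideal (L i) (fps_ring_xy :: 'k fps fps ring) \<and>
      mon_ideal F \<subseteq> L i \<and> L i \<subseteq> mon_ideal E) \<and> (\<forall>i<card (E - F). L i \<subset> L (Suc i))"
    by (intro exI[of _ "\<lambda>i. mon_ideal (G i)"]) (simp add: ideal_mon_ideal mon_ideal_mono)
next
  fix n assume "\<exists>L. (\<forall>i\<le>n. ideal (L i) (fps_ring_xy :: 'k fps fps ring) \<and>
      mon_ideal F \<subseteq> L i \<and> L i \<subseteq> mon_ideal E) \<and> (\<forall>i<n. L i \<subset> L (Suc i))"
  then obtain L where L: "\<And>i. i \<le> n \<Longrightarrow> ideal (L i) (fps_ring_xy :: 'k fps fps ring)"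
      "\<And>i. i \<le> n \<Longrightarrow> mon_ideal F \<subseteq> L i" "\<And>i. i \<le> n \<Longrightarrow> L i \<subseteq> mon_ideal E"
      "\<And>i. i < n \<Longrightarrow> L i \<subset> L (Suc i)" by blast
  \<comment> \<open>Elimination only subtracts scalar multiples, so any total order on the positions
    will do; \<open>prod_encode\<close> supplies one inside the natural numbers.\<close>
  define D where "D = prod_encode ` (E - F)"
  define co where "co f d = f $ fst (prod_decode d) $ snd (prod_decode d)" for f :: "'k fps fps" and d
  define lead where "lead J = {d\<in>D. \<exists>f\<in>J. co f d \<noteq> 0 \<and> (\<forall>d'\<in>D. d' < d \<longrightarrow> co f d' = 0)}" for J
  have finD: "finite D" using fin by (simp add: D_def)
  then obtain B where B: "\<And>d. d \<in> D \<Longrightarrow> d < B"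
    by (auto simp: finite_nat_set_iff_bounded)
  have sub: "J' \<subseteq> J"
    if J: "ideal J (fps_ring_xy :: 'k fps fps ring)" "mon_ideal F \<subseteq> J"
      and J': "ideal J' (fps_ring_xy :: 'k fps fps ring)" "J' \<subseteq> mon_ideal E"
      and JJ': "J \<subseteq> J'" "lead J' \<subseteq> lead J" for J J'
  proof -
    note Jc = J(1)[unfolded ideal_ring_of_type_algebra_iff]
    note Jc' = J'(1)[unfolded ideal_ring_of_type_algebra_iff]
    \<comment> \<open>Downward induction on the position before which \<open>f\<close> vanishes. At
      \<open>B\<close> all coefficients in \<open>E - F\<close> are gone and \<open>f\<close> lies
      in \<open>mon_ideal F\<close>; in the step a scalar multiple of an element of \<open>J\<close>
      with the same leading position clears the coefficient at \<open>m\<close>.\<close>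
    have "\<forall>f\<in>J'. (\<forall>d\<in>D. d < m \<longrightarrow> co f d = 0) \<longrightarrow> f \<in> J" if "m \<le> B" for m
      using that
    proof (induction rule: inc_induct)
      case base
      have "f \<in> mon_ideal F" if "f \<in> J'" "\<forall>d\<in>D. d < B \<longrightarrow> co f d = 0" for f
      proof -
        have "f $ i $ j = 0" if "(i, j) \<notin> F" for i j
        proof (cases "(i, j) \<in> E")
          case True
          with that have "prod_encode (i, j) \<in> D" by (auto simp: D_def)
          with B \<open>\<forall>d\<in>D. d < B \<longrightarrow> co f d = 0\<close> have "co f (prod_encode (i, j)) = 0" by blast
          then show ?thesis by (simp add: co_def)
        next
          case False
          with J'(2) \<open>f \<in> J'\<close> show ?thesis by (auto simp: mon_ideal_def)
        qed
        then show ?thesis by (auto simp: mon_ideal_def)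
      qed
      with J(2) show ?case by blast
    next
      case (step m)
      show ?case
      proof (intro ballI impI)
        fix f assume f: "f \<in> J'" "\<forall>d\<in>D. d < m \<longrightarrow> co f d = 0"
        show "f \<in> J"
        proof (cases "m \<in> D \<and> co f m \<noteq> 0")
          case True
          with f have "m \<in> lead J'" by (auto simp: lead_def)
          with JJ' have "m \<in> lead J" by blast
          then obtain g where g: "g \<in> J" "co g m \<noteq> 0" "\<forall>d'\<in>D. d' < m \<longrightarrow> co g d' = 0"
            by (auto simp: lead_def)
          define c where "c = fps_const (fps_const (co f m / co g m))"
          have co: "co (f + (- c) * g) d = co f d - co f m / co g m * co g d" for d
            by (simp add: co_def c_def)
          have "f + (- c) * g \<in> J'" using f g JJ' Jc' by blast
          moreover have "\<forall>d\<in>D. d < Suc m \<longrightarrow> co (f + (- c) * g) d = 0"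
            unfolding co using f g by (auto simp: less_Suc_eq)
          ultimately have "f + (- c) * g \<in> J" using step by blast
          moreover have "c * g \<in> J" using g Jc by blast
          ultimately have "(f + (- c) * g) + c * g \<in> J" using Jc by blast
          then show ?thesis by simp
        next
          case False
          with f have "\<forall>d\<in>D. d < Suc m \<longrightarrow> co f d = 0" by (auto simp: less_Suc_eq)
          with step f show ?thesis by blast
        qed
      qed
    qed
    from this[of 0] show ?thesis by auto
  qed
  have "lead (L i) \<subset> lead (L (Suc i))" if "i < n" for i
  proof -
    have "lead (L i) \<subseteq> lead (L (Suc i))"
      using L(4)[OF that] unfolding lead_def by blast
    moreover have "\<not> lead (L (Suc i)) \<subseteq> lead (L i)"
      using sub[of "L i" "L (Suc i)"] L(1-3)[of i] L(1-3)[of "Suc i"] L(4)[OF that] that by auto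
    ultimately show ?thesis by blast
  qed
  then have "n \<le> card D"
    by (rule chain_card_bound) (auto simp: lead_def finD)
  also have "card D = card (E - F)"
    unfolding D_def by (rule card_image) (auto simp: inj_on_def)
  finally show "n \<le> card (E - F)" .
qed

section \<open>Prime ideals of the power series ring\<close>

text \<open>More unknowns than equations, over a domain. It serves twice: over k[[y]] to make an
  element algebraic modulo a prime, and over k to relate three bivariate polynomials by counting
  monomials.\<close>

lemma homogeneous_system_nontrivial_solution:
  fixes v :: "'i \<Rightarrow> 'j \<Rightarrow> 'a::idom"
  assumes "finite J" "finite I" "card J < card I"
  shows "\<exists>c. (\<exists>i\<in>I. c i \<noteq> 0) \<and> (\<forall>j\<in>J. (\<Sum>i\<in>I. c i * v i j) = 0)"
  using assms
proof (induction J arbitrary: I v)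
  case empty
  then have "I \<noteq> {}" by auto
  then show ?case by (intro exI[of _ "\<lambda>_. 1"]) auto
next
  case (insert j J)
  show ?case
  proof (cases "\<forall>i\<in>I. v i j = 0")
    case True
    from insert.IH[of I v] insert.prems insert.hyps obtain c where
      "\<exists>i\<in>I. c i \<noteq> 0" "\<forall>l\<in>J. (\<Sum>i\<in>I. c i * v i l) = 0" by auto
    with True show ?thesis by (intro exI[of _ c]) auto
  next
    case False
    then obtain i0 where i0: "i0 \<in> I" "v i0 j \<noteq> 0" by auto
    \<comment> \<open>Cross-multiplication with the pivot row \<open>i0\<close> replaces division,
      so that no fraction field is needed.\<close>
    define w where "w i l = v i0 j * v i l - v i j * v i0 l" for i l
    have "card J < card (I - {i0})" using insert i0 by auto
    from insert.IH[OF _ this, of w] insert.prems obtain c where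
      c: "\<exists>i\<in>I - {i0}. c i \<noteq> 0" "\<forall>l\<in>J. (\<Sum>i\<in>I - {i0}. c i * w i l) = 0" by auto
    define c' where "c' i = (if i = i0 then - (\<Sum>i\<in>I - {i0}. c i * v i j) else v i0 j * c i)" for i
    have "(\<Sum>i\<in>I. c' i * v i l) = (\<Sum>i\<in>I - {i0}. c i * w i l)" for l
    proof -
      have "(\<Sum>i\<in>I. c' i * v i l) = c' i0 * v i0 l + (\<Sum>i\<in>I - {i0}. c' i * v i l)"
        using i0 insert.prems by (intro sum.remove)
      also have "(\<Sum>i\<in>I - {i0}. c' i * v i l) = (\<Sum>i\<in>I - {i0}. v i0 j * c i * v i l)"
        by (intro sum.cong) (auto simp: c'_def)
      also have "c' i0 * v i0 l = - (\<Sum>i\<in>I - {i0}. c i * v i j * v i0 l)"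
        by (simp add: c'_def sum_distrib_right)
      also have "\<dots> + (\<Sum>i\<in>I - {i0}. v i0 j * c i * v i l) = (\<Sum>i\<in>I - {i0}. c i * w i l)"
        by (simp add: w_def right_diff_distrib sum_subtractf mult_ac)
      finally show ?thesis .
    qed
    moreover have "w i j = 0" for i by (simp add: w_def mult.commute)
    ultimately have "\<forall>l\<in>insert j J. (\<Sum>i\<in>I. c' i * v i l) = 0" using c(2) by auto
    moreover have "\<exists>i\<in>I. c' i \<noteq> 0" using c(1) i0 by (auto simp: c'_def)
    ultimately show ?thesis by blast
  qed
qed

section \<open>Divisibility by y and Weierstrass division\<close>

lemma xy_monom_0_1_dvdI:
  assumes "\<And>i. f $ i $ 0 = 0"
  obtains f' where "f = xy_monom 0 1 * f'"
proof
  show "f = xy_monom 0 1 * Abs_fps (\<lambda>i. Abs_fps (\<lambda>j. f $ i $ (j + 1)))"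
    using assms by (intro fps_fps_eqI) (auto simp: xy_monom_mult_nth Suc_le_eq)
qed

text \<open>Removing the largest power of y leaves a series that is nonzero modulo y, which is the
  condition on a divisor in Weierstrass division.\<close>

lemma fps_fps_factor_y:
  assumes "f \<noteq> 0"
  obtains k g i where "f = xy_monom 0 k * g" "g $ i $ 0 \<noteq> 0"
proof -
  have "\<exists>j i. f $ i $ j \<noteq> 0"
    using assms by (metis fps_fps_eqI fps_zero_nth)
  then obtain k where k: "\<exists>i. f $ i $ k \<noteq> 0" "\<And>j. j < k \<Longrightarrow> \<forall>i. f $ i $ j = 0"
    using exists_least_iff[of "\<lambda>j. \<exists>i. f $ i $ j \<noteq> 0"] by auto
  then obtain i where i: "f $ i $ k \<noteq> 0" by blast
  define g where "g = Abs_fps (\<lambda>i. Abs_fps (\<lambda>j. f $ i $ (j + k)))"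
  have "f = xy_monom 0 k * g"
    using k(2) by (intro fps_fps_eqI) (auto simp: xy_monom_mult_nth g_def)
  moreover have "g $ i $ 0 \<noteq> 0" using i by (simp add: g_def)
  ultimately show thesis by (rule that)
qed

text \<open>The reduction modulo y, with values in k[[x]].\<close>

definition y_residue :: "'k::field fps fps \<Rightarrow> 'k fps" where
  "y_residue f = Abs_fps (\<lambda>i. f $ i $ 0)"

text \<open>The inclusion of k[[x]], a section of \<open>y_residue\<close>; the nesting of the
  variables makes it a coefficientwise map and not \<open>fps_const\<close>.\<close>

definition y_const :: "'k::field fps \<Rightarrow> 'k fps fps" where
  "y_const s = Abs_fps (\<lambda>i. fps_const (s $ i))"

lemma y_residue_nth [simp]: "y_residue f $ i = f $ i $ 0"
  by (simp add: y_residue_def)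

lemma y_residue_simps [simp]:
  "y_residue (f - g) = y_residue f - y_residue g"
  "y_residue (f * g) = y_residue f * y_residue g"
  "y_residue (y_const s) = s"
  by (auto intro!: fps_ext simp: fps_fps_mult_nth y_const_def fps_mult_nth fps_sum_nth atLeast0AtMost)

text \<open>The series with terms y^n \<open>s n\<close>. Each coefficient is a finite sum, so no
  topology is involved.\<close>

definition y_sum :: "(nat \<Rightarrow> 'k::field fps fps) \<Rightarrow> 'k fps fps" where
  "y_sum s = Abs_fps (\<lambda>i. Abs_fps (\<lambda>j. \<Sum>n\<le>j. s n $ i $ (j - n)))"

lemma y_sum_Suc: "y_sum s = s 0 + xy_monom 0 1 * y_sum (\<lambda>n. s (Suc n))"
proof (rule fps_fps_eqI)
  fix i j
  show "y_sum s $ i $ j = (s 0 + xy_monom 0 1 * y_sum (\<lambda>n. s (Suc n))) $ i $ j"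
    by (cases j) (simp_all add: y_sum_def xy_monom_mult_nth sum.atMost_Suc_shift del: sum.atMost_Suc)
qed

text \<open>Weierstrass division: divide modulo \<open>y\<close>, then divide the quotient of the remainder by \<open>y\<close>,
  and sum up the \<open>y\<close>-adically convergent series.\<close>

lemma weierstrass_division:
  fixes F g :: "'k::field fps fps"
  assumes g: "\<And>i. i < d \<Longrightarrow> g $ i $ 0 = 0" "g $ d $ 0 \<noteq> 0"
  obtains r q where "F = r + g * q" "\<And>i. i \<ge> d \<Longrightarrow> r $ i = 0"
proof -
  define u where "u = fps_shift d (y_residue g)"
  have u: "y_residue g = fps_X ^ d * u" "u * inverse u = 1"
    using g by (auto intro!: fps_ext inverse_mult_eq_1' simp: u_def fps_X_power_mult_nth)
  have step: "\<exists>r q F'. F = r + g * q + xy_monom 0 1 * F' \<and> (\<forall>i\<ge>d. r $ i = 0)" for F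
  proof -
    define r where "r = Abs_fps (\<lambda>i. if i < d then fps_const (F $ i $ 0) else 0)"
    \<comment> \<open>Modulo y the divisor is x^d times the unit \<open>u\<close>, so the terms of
      x-degree at least \<open>d\<close> are a multiple of it.\<close>
    define q where "q = y_const (fps_shift d (y_residue F) * inverse u)"
    have "y_residue g * y_residue q = fps_X ^ d * fps_shift d (y_residue F) * (u * inverse u)"
      by (simp add: q_def u(1) mult_ac)
    then have "y_residue (F - r - g * q) = y_residue F - y_residue r - fps_X ^ d * fps_shift d (y_residue F)"
      by (simp add: u)
    also have "\<dots> = 0"
      by (auto intro!: fps_ext simp: r_def fps_X_power_mult_nth)
    finally have "(F - r - g * q) $ i $ 0 = 0" for i
      by (metis fps_zero_nth y_residue_nth)
    then obtain F' where "F - r - g * q = xy_monom 0 1 * F'"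
      by (rule xy_monom_0_1_dvdI)
    then have "F = r + g * q + xy_monom 0 1 * F'" by (simp add: algebra_simps)
    moreover have "\<forall>i\<ge>d. r $ i = 0" by (simp add: r_def)
    ultimately show ?thesis by blast
  qed
  then obtain r q N where step: "\<And>F. F = r F + g * q F + xy_monom 0 1 * N F" "\<And>F i. i \<ge> d \<Longrightarrow> r F $ i = 0"
    by metis
  define F' where "F' n = (N ^^ n) F" for n
  \<comment> \<open>The defect of the division of \<open>F' m\<close> by the two series. No limit is
    taken: each defect is y times the next one, so \<open>D 0\<close> is divisible by every power of
    y.\<close>
  define D where "D m = F' m - y_sum (\<lambda>n. r (F' (m + n))) - g * y_sum (\<lambda>n. q (F' (m + n)))" for m
  have D_Suc: "D m = xy_monom 0 1 * D (Suc m)" for m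
  proof -
    have "F' m = r (F' m) + g * q (F' m) + xy_monom 0 1 * F' (Suc m)"
      using step(1)[of "F' m"] by (simp add: F'_def)
    then show ?thesis
      unfolding D_def by (subst (1 2) y_sum_Suc) (simp add: algebra_simps)
  qed
  have D: "D 0 = xy_monom 0 m * D m" for m
  proof (induction m)
    case (Suc m)
    then show ?case
      by (simp add: D_Suc[of m] xy_monom_mult mult.assoc[symmetric])
  qed (simp add: xy_monom_def)
  have "D 0 = 0"
  proof (rule fps_fps_eqI)
    show "D 0 $ i $ j = 0 $ i $ j" for i j
      by (subst D[of "Suc j"]) (simp add: xy_monom_mult_nth)
  qed
  then have "F = y_sum (\<lambda>n. r (F' n)) + g * y_sum (\<lambda>n. q (F' n))"
    by (simp add: D_def F'_def algebra_simps)
  moreover have "y_sum (\<lambda>n. r (F' n)) $ i = 0" if "i \<ge> d" for i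
    using step(2)[OF that] by (auto intro!: fps_ext simp: y_sum_def)
  ultimately show thesis by (rule that)
qed

section \<open>Nested prime ideals of k[[x, y]]\<close>

lemma fps_fps_unit:
  fixes f :: "'k::field fps fps"
  assumes "f $ 0 $ 0 \<noteq> 0"
  obtains g where "f * g = 1"
proof -
  have "f $ 0 * inverse (f $ 0) = 1"
    using assms by (rule inverse_mult_eq_1')
  then show thesis
    using that fps_is_right_unit_iff_zeroth_is_right_unit[of f]
      fps_is_left_unit_iff_zeroth_is_left_unit[of f] by metis
qed

lemma proper_ideal_nth_0_0:
  fixes I :: "'k::field fps fps set"
  assumes "ideal I ring_of_type_algebra" "1 \<notin> I" "f \<in> I"
  shows "f $ 0 $ 0 = 0"
proof (rule ccontr)
  assume "f $ 0 $ 0 \<noteq> 0"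
  then obtain g where "f * g = 1" by (rule fps_fps_unit)
  then have "1 = g * f" by (simp add: mult.commute)
  with assms show False unfolding ideal_ring_of_type_algebra_iff by metis
qed

lemma primeideal_ring_of_type_algebraD:
  fixes P :: "'a::comm_ring_1 set"
  assumes "primeideal P ring_of_type_algebra"
  shows "0 \<in> P" "a \<in> P \<Longrightarrow> b \<in> P \<Longrightarrow> a + b \<in> P" "a \<in> P \<Longrightarrow> r * a \<in> P" "a \<in> P \<Longrightarrow> a * r \<in> P"
    "a \<in> P \<Longrightarrow> b \<in> P \<Longrightarrow> a - b \<in> P" "1 \<notin> P" "a * b \<in> P \<Longrightarrow> a \<in> P \<or> b \<in> P"
    "a ^ n \<in> P \<Longrightarrow> a \<in> P" "(\<And>x. x \<in> A \<Longrightarrow> h x \<in> P) \<Longrightarrow> sum h A \<in> P"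
proof -
  show *: "0 \<in> P" "a \<in> P \<Longrightarrow> b \<in> P \<Longrightarrow> a + b \<in> P" "a \<in> P \<Longrightarrow> r * a \<in> P" "1 \<notin> P"
    "a * b \<in> P \<Longrightarrow> a \<in> P \<or> b \<in> P" for a b r
    using assms by (auto simp: primeideal_ring_of_type_algebra_iff ideal_ring_of_type_algebra_iff)
  show "a \<in> P \<Longrightarrow> a * r \<in> P" using *(3)[of a r] by (simp add: mult.commute)
  show "a \<in> P \<Longrightarrow> b \<in> P \<Longrightarrow> a - b \<in> P"
    using *(2)[of a "- 1 * b"] *(3)[of b "- 1"] by simp
  show "a ^ n \<in> P \<Longrightarrow> a \<in> P" by (induction n) (use *(4,5) in \<open>fastforce+\<close>)
  show "(\<And>x. x \<in> A \<Longrightarrow> h x \<in> P) \<Longrightarrow> sum h A \<in> P"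
    by (induction A rule: infinite_finite_induct) (use * in auto)
qed

lemma xy_monom_power: "xy_monom i j ^ n = xy_monom (i * n) (j * n)"
  by (simp add: xy_monom_def power_mult_distrib power_mult[symmetric] fps_const_power)

lemma primeideal_monom_times_unit:
  fixes Q :: "'k::field fps fps set"
  assumes Q: "primeideal Q ring_of_type_algebra" and "xy_monom i j ^ k * u \<in> Q" "u $ 0 $ 0 \<noteq> 0"
  shows "xy_monom i j \<in> Q"
proof -
  from fps_fps_unit[OF assms(3)] obtain w where "u * w = 1" .
  then have "xy_monom i j ^ k = xy_monom i j ^ k * u * w" by (simp add: mult.assoc)
  also have "\<dots> \<in> Q" by (rule primeideal_ring_of_type_algebraD(4)[OF Q assms(2)])
  finally show ?thesis by (rule primeideal_ring_of_type_algebraD(8)[OF Q])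
qed

text \<open>Modulo y the ring is the discrete valuation ring k[[x]], where the nonzero residue of
  \<open>h\<close> is a power of x times a unit. Its lift by \<open>y_const\<close> differs from
  \<open>h\<close> by a multiple of y and so stays in \<open>Q\<close>.\<close>

lemma primeideal_contains_x:
  fixes Q :: "'k::field fps fps set"
  assumes Q: "primeideal Q ring_of_type_algebra" and y: "xy_monom 0 1 \<in> Q"
    and h: "h \<in> Q" "h $ i $ 0 \<noteq> 0"
  shows "xy_monom 1 0 \<in> Q"
proof -
  note Q' = primeideal_ring_of_type_algebraD[OF Q]
  let ?s = "y_residue h"
  have "(h - y_const ?s) $ i $ 0 = 0" for i by (simp add: y_const_def)
  then obtain h' where "h - y_const ?s = xy_monom 0 1 * h'" by (rule xy_monom_0_1_dvdI)
  then have "y_const ?s = h - xy_monom 0 1 * h'" by (simp add: algebra_simps)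
  also have "\<dots> \<in> Q" using Q' y h by simp
  finally have in_Q: "y_const ?s \<in> Q" .
  have "?s \<noteq> 0" using h(2) by (metis fps_zero_nth y_residue_nth)
  define k where "k = subdegree ?s"
  have "y_const (fps_X ^ k * t) = xy_monom 1 0 ^ k * y_const t" for t :: "'k fps"
    unfolding xy_monom_power
    by (rule fps_fps_eqI) (auto simp: xy_monom_mult_nth y_const_def fps_X_power_mult_nth not_le)
  from this[of "fps_shift k ?s"] have "y_const ?s = xy_monom 1 0 ^ k * y_const (fps_shift k ?s)"
    unfolding k_def by (simp only: subdegree_decompose[symmetric] mult.commute[of "fps_X ^ _"])
  moreover have "y_const (fps_shift k ?s) $ 0 $ 0 \<noteq> 0"
    using \<open>?s \<noteq> 0\<close> by (simp add: y_const_def k_def del: y_residue_nth)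
  ultimately show ?thesis
    using in_Q primeideal_monom_times_unit[OF Q] by metis
qed

lemma primeideal_contains_y_if_const:
  fixes Q :: "'k::field fps fps set"
  assumes Q: "primeideal Q ring_of_type_algebra" and "fps_const c \<in> Q" "c \<noteq> 0"
  shows "xy_monom 0 1 \<in> Q"
proof -
  have "c = fps_X ^ subdegree c * fps_shift (subdegree c) c"
    by (metis mult.commute subdegree_decompose)
  then have "fps_const c = xy_monom 0 1 ^ subdegree c * fps_const (fps_shift (subdegree c) c)"
    unfolding xy_monom_power by (simp add: xy_monom_def)
  moreover have "fps_const (fps_shift (subdegree c) c) $ 0 $ 0 \<noteq> 0"
    using \<open>c \<noteq> 0\<close> by simp
  ultimately show ?thesis
    using primeideal_monom_times_unit[OF Q] assms(2) by metis
qed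

text \<open>Induction on \<open>d\<close> in place of a minimal relation. If \<open>c 0 = 0\<close>,
  a factor \<open>h\<close> is cancelled, as \<open>h\<close> is outside the prime \<open>P\<close>.
  Otherwise \<open>h \<in> Q\<close> puts the constant term itself into \<open>Q\<close>, and a
  nonzero element of k[[y]] is a power of y times a unit.\<close>

lemma primeideal_contains_y_if_algebraic:
  fixes P Q :: "'k::field fps fps set"
  assumes P: "primeideal P ring_of_type_algebra" and Q: "primeideal Q ring_of_type_algebra"
    and PQ: "P \<subseteq> Q" and h: "h \<in> Q" "h \<notin> P"
    and c: "(\<Sum>n\<le>d. fps_const (c n) * h ^ n) \<in> P" "\<exists>n\<le>d. c n \<noteq> 0"
  shows "xy_monom 0 1 \<in> Q"
  using c
proof (induction d arbitrary: c)
  case 0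
  then have "fps_const (c 0) \<in> Q" "c 0 \<noteq> 0" using PQ by auto
  then show ?case by (rule primeideal_contains_y_if_const[OF Q])
next
  case (Suc d)
  note P' = primeideal_ring_of_type_algebraD[OF P]
  note Q' = primeideal_ring_of_type_algebraD[OF Q]
  have eq: "(\<Sum>n\<le>Suc d. fps_const (c n) * h ^ n) =
      fps_const (c 0) + h * (\<Sum>n\<le>d. fps_const (c (Suc n)) * h ^ n)"
    by (simp add: sum.atMost_Suc_shift sum_distrib_left mult_ac del: sum.atMost_Suc)
  show ?case
  proof (cases "c 0 = 0")
    case True
    then have "(\<Sum>n\<le>d. fps_const (c (Suc n)) * h ^ n) \<in> P"
      using Suc.prems(1) P'(7) h unfolding eq by auto
    moreover have "\<exists>n\<le>d. c (Suc n) \<noteq> 0"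
      using Suc.prems(2) True by (metis Suc_le_mono not0_implies_Suc)
    ultimately show ?thesis by (rule Suc.IH[of "\<lambda>n. c (Suc n)"])
  next
    case False
    have "(fps_const (c 0) + h * (\<Sum>n\<le>d. fps_const (c (Suc n)) * h ^ n)) -
      h * (\<Sum>n\<le>d. fps_const (c (Suc n)) * h ^ n) \<in> Q"
      using Suc.prems(1) PQ h unfolding eq by (intro Q'(4,5)) auto
    then have "fps_const (c 0) \<in> Q" by simp
    then show ?thesis using False by (rule primeideal_contains_y_if_const[OF Q])
  qed
qed

text \<open>Any proper inclusion above a nonzero prime ends at the maximal ideal. This one fact
  bounds both the dimension of the ring and the height of (x).\<close>

lemma primeideal_eq_maximal:
  fixes P Q :: "'k::field fps fps set"
  assumes P: "primeideal P ring_of_type_algebra" and Q: "primeideal Q ring_of_type_algebra"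
    and PQ: "P \<subset> Q" and P0: "P \<noteq> {0}"
  shows "Q = {f. f $ 0 $ 0 = 0}"
proof -
  note P' = primeideal_ring_of_type_algebraD[OF P]
  note Q' = primeideal_ring_of_type_algebraD[OF Q]
  from PQ obtain h where h: "h \<in> Q" "h \<notin> P" by blast
  from P0 P'(1) obtain f where f: "f \<in> P" "f \<noteq> 0" by blast
  obtain k g i0 where g: "f = xy_monom 0 k * g" "g $ i0 $ 0 \<noteq> 0"
    using fps_fps_factor_y[OF f(2)] .
  have gP: "g \<in> P" if "xy_monom 0 1 \<notin> P"
  proof -
    have "xy_monom 0 k \<notin> P"
      using that P'(8)[of "xy_monom 0 1" k] by (auto simp: xy_monom_power)
    with f g P'(7) show ?thesis by auto
  qed
  have y: "xy_monom 0 1 \<in> Q"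
  proof (rule ccontr)
    assume "xy_monom 0 1 \<notin> Q"
    with PQ have "g \<in> P" using gP by blast
    obtain d where d: "g $ d $ 0 \<noteq> 0" "\<And>i. i < d \<Longrightarrow> g $ i $ 0 = 0"
      using g(2) exists_least_iff[of "\<lambda>i. g $ i $ 0 \<noteq> 0"] by auto
    have "\<exists>r q. h ^ n = r + g * q \<and> (\<forall>i\<ge>d. r $ i = 0)" for n
      using weierstrass_division[of d g "h ^ n"] d by metis
    then obtain r q where rq: "\<And>n. h ^ n = r n + g * q n" "\<And>n i. i \<ge> d \<Longrightarrow> r n $ i = 0"
      by metis
    \<comment> \<open>The \<open>d + 1\<close> remainders of the powers of \<open>h\<close> have
      only \<open>d\<close> coefficients each, all in k[[y]], so they are linearly dependent
      there.\<close>
    obtain c where c: "\<exists>n\<le>d. c n \<noteq> 0" "\<forall>i<d. (\<Sum>n\<le>d. c n * r n $ i) = 0"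
      using homogeneous_system_nontrivial_solution[of "{..<d}" "{..d}" "\<lambda>n i. r n $ i"] by auto
    have "(\<Sum>n\<le>d. fps_const (c n) * r n) = 0"
    proof (rule fps_ext)
      show "(\<Sum>n\<le>d. fps_const (c n) * r n) $ i = 0 $ i" for i
        using c(2) rq(2) by (cases "i < d") (auto simp: fps_sum_nth)
    qed
    then have "(\<Sum>n\<le>d. fps_const (c n) * h ^ n) = g * (\<Sum>n\<le>d. fps_const (c n) * q n)"
      by (simp add: rq(1) ring_distribs sum.distrib sum_distrib_left mult_ac)
    also have "\<dots> \<in> P" using \<open>g \<in> P\<close> by (rule P'(4))
    finally have "xy_monom 0 1 \<in> Q"
      using primeideal_contains_y_if_algebraic[OF P Q _ h _ c(1)] PQ by blast
    with \<open>xy_monom 0 1 \<notin> Q\<close> show False ..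
  qed
  \<comment> \<open>To obtain x, an element of \<open>Q\<close> outside (y) is required. If y is in
    \<open>P\<close>, any element of \<open>Q\<close> outside \<open>P\<close> qualifies; otherwise
    \<open>g\<close> is in \<open>P\<close>, since the power of y can be cancelled from
    \<open>f\<close>.\<close>
  have "\<exists>h\<in>Q. \<exists>i. h $ i $ 0 \<noteq> 0"
  proof (cases "xy_monom 0 1 \<in> P")
    case True
    have "\<exists>i. h $ i $ 0 \<noteq> 0"
    proof (rule ccontr)
      assume "\<nexists>i. h $ i $ 0 \<noteq> 0"
      then obtain h' where "h = xy_monom 0 1 * h'" by (metis xy_monom_0_1_dvdI)
      with True P'(4) h show False by blast
    qed
    with h show ?thesis by blast
  next
    case False
    with gP g PQ show ?thesis by blast
  qed
  then have x: "xy_monom 1 0 \<in> Q"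
    using primeideal_contains_x[OF Q y] by blast
  show ?thesis
  proof
    show "Q \<subseteq> {f. f $ 0 $ 0 = 0}"
      using proper_ideal_nth_0_0[of Q] Q by (auto simp: primeideal_ring_of_type_algebra_iff)
    show "{f. f $ 0 $ 0 = 0} \<subseteq> Q"
    proof
      fix f :: "'k fps fps" assume "f \<in> {f. f $ 0 $ 0 = 0}"
      then have "f = xy_monom 1 0 * fps_shift 1 f + xy_monom 0 1 * fps_const (fps_shift 1 (f $ 0))"
        by (intro fps_fps_eqI) (auto simp: xy_monom_mult_nth fps_const_def Suc_le_eq)
      with x y show "f \<in> Q" using Q'(2,4) by metis
    qed
  qed
qed

section \<open>Maximal ideal, dimension and height\<close>

lemma primeideal_maximal:
  "primeideal {f. f $ 0 $ 0 = 0} (fps_ring_xy :: 'k::field fps fps ring)"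
  by (auto simp: primeideal_ring_of_type_algebra_iff ideal_ring_of_type_algebra_iff)

lemma primeideal_x:
  "primeideal {f. f $ 0 = 0} (fps_ring_xy :: 'k::field fps fps ring)"
  by (auto simp: primeideal_ring_of_type_algebra_iff ideal_ring_of_type_algebra_iff)

lemma primeideal_zero:
  "primeideal {0} (ring_of_type_algebra :: 'a::idom ring)"
  by (auto simp: primeideal_ring_of_type_algebra_iff ideal_ring_of_type_algebra_iff)

lemma max_ideal_fps_ring_xy:
  "max_ideal (fps_ring_xy :: 'k::field fps fps ring) = {f. f $ 0 $ 0 = 0}"
  unfolding max_ideal_def
proof (rule the_equality)
  let ?m = "{f :: 'k fps fps. f $ 0 $ 0 = 0}"
  have id: "ideal ?m fps_ring_xy"
    using primeideal_maximal primeideal.axioms(1) by blast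
  have ne: "1 \<notin> ?m" by simp
  have sub: "J \<subseteq> ?m" if "ideal J fps_ring_xy" "1 \<notin> J" for J
    using proper_ideal_nth_0_0[OF that] by auto
  have one: "J = UNIV" if "ideal J fps_ring_xy" "1 \<in> J" for J :: "'k fps fps set"
  proof -
    have "r * 1 \<in> J" for r using that unfolding ideal_ring_of_type_algebra_iff by blast
    then show ?thesis by auto
  qed
  show "maximalideal ?m fps_ring_xy"
  proof (rule maximalidealI[OF id])
    show "carrier fps_ring_xy \<noteq> ?m" using ne by (metis UNIV_I ring_of_type_algebra_simps(1))
    show "J = ?m \<or> J = carrier fps_ring_xy" if "ideal J fps_ring_xy" "?m \<subseteq> J" for J
      using sub[OF that(1)] one[OF that(1)] that(2) by auto
  qed
  fix M assume M: "maximalideal M (fps_ring_xy :: 'k fps fps ring)"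
  then interpret maximalideal M "fps_ring_xy :: 'k fps fps ring" .
  have "1 \<notin> M" using I_notcarr one[OF is_ideal] by auto
  with sub[OF is_ideal] I_maximal[OF id] have "?m = M \<or> ?m = UNIV" by simp
  moreover have "?m \<noteq> UNIV" using ne by blast
  ultimately show "M = ?m" by simp
qed

lemma prime_chain_mono:
  assumes "prime_chain R n P" "i < j" "j \<le> n"
  shows "P i \<subset> P j"
  using assms(2,3)
proof (induction j)
  case (Suc j)
  have "P j \<subset> P (Suc j)" using assms(1) Suc.prems by (auto simp: prime_chain_def)
  with Suc show ?case by (cases "i = j") auto
qed auto

lemma krull_dim_fps_ring_xy: "krull_dim (fps_ring_xy :: 'k::field fps fps ring) = 2"
proof -
  have "krull_dim (fps_ring_xy :: 'k fps fps ring) = enat 2"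
    unfolding krull_dim_def
  proof (rule Sup_enat_eqI)
    define P :: "nat \<Rightarrow> 'k fps fps set" where
      "P i = (if i = 0 then {0} else if i = 1 then {f. f $ 0 = 0} else {f. f $ 0 $ 0 = 0})" for i
    have "fps_X \<in> P 1" "fps_X \<notin> P 0" "fps_const fps_X \<in> P 2" "fps_const fps_X \<notin> P 1"
      by (auto simp: P_def)
    moreover have "P 0 \<subseteq> P 1" "P 1 \<subseteq> P 2" by (auto simp: P_def)
    ultimately have "P 0 \<subset> P 1" "P 1 \<subset> P 2" by blast+
    then have "prime_chain fps_ring_xy 2 P"
      using primeideal_zero[where 'a="'k fps fps"] primeideal_x primeideal_maximal
      by (auto simp: prime_chain_def less_Suc_eq numeral_2_eq_2 P_def)
    then show "\<exists>P. prime_chain (fps_ring_xy :: 'k fps fps ring) 2 P" by blast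
  next
    fix n assume "\<exists>P. prime_chain (fps_ring_xy :: 'k fps fps ring) n P"
    then obtain P where P: "prime_chain (fps_ring_xy :: 'k fps fps ring) n P" ..
    show "n \<le> 2"
    proof (rule ccontr)
      assume "\<not> n \<le> 2"
      then have n: "n \<ge> 3" by simp
      have pr: "primeideal (P i) (fps_ring_xy :: 'k fps fps ring)" if "i \<le> 3" for i
        using P n that by (auto simp: prime_chain_def)
      have s: "P 0 \<subset> P 1" "P 1 \<subset> P 2" "P 2 \<subset> P 3"
        using n by (auto intro!: prime_chain_mono[OF P])
      have "P 1 \<noteq> {0}"
        using s(1) primeideal_ring_of_type_algebraD(1)[OF pr[of 0]] by auto
      then have "P 2 = {f. f $ 0 $ 0 = 0}"
        using primeideal_eq_maximal[OF pr[of 1] pr[of 2] s(2)] by auto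
      moreover have "P 3 \<subseteq> {f. f $ 0 $ 0 = 0}"
        using proper_ideal_nth_0_0[of "P 3"] pr[of 3] by (auto simp: primeideal_ring_of_type_algebra_iff)
      ultimately show False using s(3) by auto
    qed
  qed
  then show ?thesis by (simp add: numeral_eq_enat)
qed

lemma PIdl_var_x: "PIdl\<^bsub>fps_ring_xy\<^esub> var_x = {f :: 'k::field fps fps. f $ 0 = 0}"
proof
  show "PIdl\<^bsub>fps_ring_xy\<^esub> var_x \<subseteq> {f :: 'k fps fps. f $ 0 = 0}"
    by (auto simp: cgenideal_def)
  show "{f :: 'k fps fps. f $ 0 = 0} \<subseteq> PIdl\<^bsub>fps_ring_xy\<^esub> var_x"
  proof
    fix f :: "'k fps fps" assume "f \<in> {f. f $ 0 = 0}"
    then have "f = fps_shift 1 f * fps_X"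
      by (auto intro!: fps_ext simp: Suc_le_eq)
    then show "f \<in> PIdl\<^bsub>fps_ring_xy\<^esub> var_x" unfolding cgenideal_def by auto
  qed
qed

lemma prime_height_x: "prime_height fps_ring_xy {f :: 'k::field fps fps. f $ 0 = 0} = 1"
proof -
  let ?x = "{f :: 'k fps fps. f $ 0 = 0}"
  have "prime_height fps_ring_xy ?x = enat 1"
    unfolding prime_height_def
  proof (rule Sup_enat_eqI)
    have "(fps_X :: 'k fps fps) \<noteq> 0" by (rule fps_X_neq_zero)
    then have "fps_X \<in> ?x" "fps_X \<notin> {0 :: 'k fps fps}" "0 \<in> ?x" by simp_all
    then have "{0} \<subset> ?x" by blast
    then have "prime_chain fps_ring_xy 1 (\<lambda>i. if i = 0 then {0} else ?x)"
      using primeideal_zero[where 'a="'k fps fps"] primeideal_x by (auto simp: prime_chain_def)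
    then show "\<exists>P. prime_chain fps_ring_xy 1 P \<and> P 1 = ?x"
      by (intro exI[of _ "\<lambda>i. if i = 0 then {0} else ?x"]) auto
  next
    fix n assume "\<exists>P. prime_chain fps_ring_xy n P \<and> P n = ?x"
    then obtain P where P: "prime_chain fps_ring_xy n P" "P n = ?x" by blast
    show "n \<le> 1"
    proof (rule ccontr)
      assume n: "\<not> n \<le> 1"
      have pr: "primeideal (P i) (fps_ring_xy :: 'k fps fps ring)" if "i \<le> n" for i
        using P that by (auto simp: prime_chain_def)
      have "P 0 \<subset> P 1" "P 1 \<subset> ?x"
        using prime_chain_mono[OF P(1)] n unfolding P(2)[symmetric] by auto
      then have "P 1 \<noteq> {0}"
        using primeideal_ring_of_type_algebraD(1)[OF pr[of 0]] by auto
      then have "?x = {f. f $ 0 $ 0 = 0}"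
        using primeideal_eq_maximal[OF pr[of 1] primeideal_x \<open>P 1 \<subset> ?x\<close>] n by auto
      moreover have "fps_const fps_X \<in> {f :: 'k fps fps. f $ 0 $ 0 = 0}" by simp
      moreover have "fps_const fps_X \<notin> ?x" by simp
      ultimately show False by blast
    qed
  qed
  then show ?thesis by (simp add: one_enat_def)
qed

lemma ideal_height_eq_1:
  fixes I :: "'k::field fps fps set"
  assumes "I \<subseteq> {f. f $ 0 = 0}" "f \<in> I" "f \<noteq> 0"
  shows "ideal_height fps_ring_xy I = 1"
  unfolding ideal_height_def
proof (rule antisym)
  show "Inf {prime_height fps_ring_xy Q |Q. primeideal Q fps_ring_xy \<and> I \<subseteq> Q} \<le> 1"
    using assms(1) primeideal_x prime_height_x[where 'k='k]
    by (intro Inf_lower CollectI exI[of _ "{f. f $ 0 = 0}"]) simp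
  show "1 \<le> Inf {prime_height fps_ring_xy Q |Q. primeideal Q fps_ring_xy \<and> I \<subseteq> Q}"
  proof (rule Inf_greatest, clarify)
    fix Q :: "'k fps fps set" assume Q: "primeideal Q fps_ring_xy" "I \<subseteq> Q"
    have "{0} \<subset> Q" using assms Q primeideal_ring_of_type_algebraD(1)[OF Q(1)] by blast
    then have "prime_chain fps_ring_xy 1 (\<lambda>i. if i = 0 then {0} else Q)"
      using primeideal_zero[where 'a="'k fps fps"] Q by (auto simp: prime_chain_def)
    then have "enat 1 \<le> prime_height fps_ring_xy Q"
      unfolding prime_height_def
      by (intro Sup_upper CollectI exI[of _ 1] conjI refl exI[of _ "\<lambda>i. if i = 0 then {0} else Q"]) auto
    then show "1 \<le> prime_height fps_ring_xy Q" by (simp add: one_enat_def)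
  qed
qed

section \<open>Powers and Hilbert function of the ideals \<open>x\<^sup>a(x, y\<^sup>q)\<close>\<close>

text \<open>The finiteness required for products of monomial ideals, in a form inherited by
  \<open>exp_sum\<close> and hence by all powers.\<close>

definition fin_gen :: "(nat \<times> nat) set \<Rightarrow> bool" where
  "fin_gen E \<longleftrightarrow> (\<exists>K. finite K \<and> K \<subseteq> E \<and> E \<subseteq> up_set K)"

lemma finite_exp_sum: "finite K \<Longrightarrow> finite L \<Longrightarrow> finite (exp_sum K L)"
  by (rule finite_subset[of _ "(\<lambda>((i, j), (i', j')). (i + i', j + j')) ` (K \<times> L)"])
    (force simp: exp_sum_def)+

lemma exp_sum_mono: "K \<subseteq> E \<Longrightarrow> L \<subseteq> F \<Longrightarrow> exp_sum K L \<subseteq> exp_sum E F"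
  unfolding exp_sum_def by blast

lemma exp_sum_up_set: "exp_sum (up_set K) (up_set L) \<subseteq> up_set (exp_sum K L)"
proof
  fix p assume "p \<in> exp_sum (up_set K) (up_set L)"
  then obtain i j i' j' a b a' b' where p: "p = (i + i', j + j')" "(a, b) \<in> K" "a \<le> i" "b \<le> j"
    "(a', b') \<in> L" "a' \<le> i'" "b' \<le> j'"
    by (auto simp: exp_sum_def up_set_def)
  then have "(a + a', b + b') \<in> exp_sum K L" by (auto simp: exp_sum_def)
  moreover have "a + a' \<le> i + i'" "b + b' \<le> j + j'" using p by auto
  ultimately show "p \<in> up_set (exp_sum K L)" unfolding up_set_def p(1) by blast
qed

lemma fin_gen_exp_sum_generators:
  assumes "fin_gen E" "fin_gen F"
  shows "\<exists>K. finite K \<and> K \<subseteq> exp_sum E F \<and> exp_sum E F \<subseteq> up_set K"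
proof -
  from assms obtain K L where "finite K" "K \<subseteq> E" "E \<subseteq> up_set K" "finite L" "L \<subseteq> F" "F \<subseteq> up_set L"
    unfolding fin_gen_def by metis
  then show ?thesis
    using order.trans[OF exp_sum_mono[of E "up_set K" F "up_set L"] exp_sum_up_set]
    by (intro exI[of _ "exp_sum K L"] conjI finite_exp_sum exp_sum_mono)
qed

lemma fin_gen_exp_sum: "fin_gen E \<Longrightarrow> fin_gen F \<Longrightarrow> fin_gen (exp_sum E F)"
  using fin_gen_exp_sum_generators unfolding fin_gen_def[of "exp_sum E F"] .

lemma ideal_prod_mon_ideal_fin_gen:
  assumes "up_closed E" "up_closed F" "fin_gen E" "fin_gen F"
  shows "ideal_prod (fps_ring_xy :: 'k::field fps fps ring) (mon_ideal E) (mon_ideal F)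
    = mon_ideal (exp_sum E F)"
  using fin_gen_exp_sum_generators[OF assms(3,4)] ideal_prod_mon_ideal[OF assms(1,2)] by blast

lemma fin_gen_UNIV: "fin_gen UNIV"
  unfolding fin_gen_def by (intro exI[of _ "{(0, 0)}"]) (auto simp: up_set_def)

text \<open>A closed form for the exponents of all powers only has to satisfy the recursion. It is
  applied to the maximal ideal and to x^a(x, y^q).\<close>

lemma ideal_power_mon_ideal:
  assumes "E 0 = UNIV" "\<And>n. exp_sum (E n) (E 1) = E (Suc n)" "up_closed (E 1)" "fin_gen (E 1)"
  shows "ideal_power (fps_ring_xy :: 'k::field fps fps ring) (mon_ideal (E 1)) n = mon_ideal (E n)"
    and "up_closed (E n)" and "fin_gen (E n)"
proof -
  have *: "up_closed (E n) \<and> fin_gen (E n)" for n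
  proof (induction n)
    case 0
    then show ?case using assms(1) fin_gen_UNIV by (simp add: up_closed_def)
  next
    case (Suc n)
    then show ?case
      unfolding assms(2)[symmetric] using up_closed_exp_sum fin_gen_exp_sum assms by blast
  qed
  then show "up_closed (E n)" "fin_gen (E n)" by auto
  show "ideal_power (fps_ring_xy :: 'k::field fps fps ring) (mon_ideal (E 1)) n = mon_ideal (E n)"
  proof (induction n)
    case 0
    then show ?case by (simp add: ideals_set_def nat_pow_def assms(1) mon_ideal_def)
  next
    case (Suc n)
    have "ideal_power (fps_ring_xy :: 'k::field fps fps ring) (mon_ideal (E 1)) (Suc n) =
      ideal_prod fps_ring_xy (ideal_power fps_ring_xy (mon_ideal (E 1)) n) (mon_ideal (E 1))"
      by (simp add: ideals_set_def nat_pow_def)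
    also have "\<dots> = mon_ideal (E (Suc n))"
      unfolding Suc assms(2)[symmetric] using * by (intro ideal_prod_mon_ideal_fin_gen) auto
    finally show ?case .
  qed
qed

section \<open>Exponents of powers of the maximal ideal and of x^a(x, y^q)\<close>

definition deg_exp :: "nat \<Rightarrow> (nat \<times> nat) set" where
  "deg_exp n = {(i, j). i + j \<ge> n}"

text \<open>The exponents of x^(a n) (x, y^q)^n: the second inequality is the line through (a n, q
  n) and ((a + 1) n, 0). Both inequalities are homogeneous and linear in i, j and n jointly, so the
  sets for m and n add into the set for m + n.\<close>

definition pow_exp :: "nat \<Rightarrow> nat \<Rightarrow> nat \<Rightarrow> (nat \<times> nat) set" where
  "pow_exp a q n = {(i, j). a * n \<le> i \<and> q * (a + 1) * n \<le> q * i + j}"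

lemma deg_exp_facts: "deg_exp 0 = UNIV" "exp_sum (deg_exp n) (deg_exp 1) = deg_exp (Suc n)"
  "up_closed (deg_exp 1)" "fin_gen (deg_exp 1)"
proof -
  show "deg_exp 0 = UNIV" "up_closed (deg_exp 1)" by (auto simp: deg_exp_def up_closed_def)
  have "(i, j) \<in> exp_sum (deg_exp n) (deg_exp 1)" if "(i, j) \<in> deg_exp (Suc n)" for i j
  proof (cases i)
    case 0
    with that have "(i, j - 1) \<in> deg_exp n" "(0, 1) \<in> deg_exp 1" "(i, j) = (i + 0, (j - 1) + 1)"
      by (auto simp: deg_exp_def)
    then show ?thesis unfolding exp_sum_def by blast
  next
    case (Suc i')
    with that have "(i', j) \<in> deg_exp n" "(1, 0) \<in> deg_exp 1" "(i, j) = (i' + 1, j + 0)"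
      by (auto simp: deg_exp_def)
    then show ?thesis unfolding exp_sum_def by blast
  qed
  then show "exp_sum (deg_exp n) (deg_exp 1) = deg_exp (Suc n)"
    by (auto simp: exp_sum_def deg_exp_def)
  show "fin_gen (deg_exp 1)"
    unfolding fin_gen_def by (intro exI[of _ "{(1, 0), (0, 1)}"]) (auto simp: up_set_def deg_exp_def)
qed

text \<open>The coordinate \<open>u\<close> counts columns from the left edge. Truncated subtraction
  covers the columns \<open>u \<ge> n\<close>, where the power of x alone suffices and
  \<open>j\<close> is unrestricted.\<close>

lemma pow_exp_iff:
  "(i, j) \<in> pow_exp a q n \<longleftrightarrow> (\<exists>u. i = a * n + u \<and> q * (n - u) \<le> j)"
proof -
  have "q * (a + 1) * n \<le> q * (a * n + u) + j \<longleftrightarrow> q * (n - u) \<le> j" for u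
  proof (cases "u \<le> n")
    case True
    then obtain t where "n = u + t" by (auto simp: le_iff_add)
    then show ?thesis by (simp add: algebra_simps)
  next
    case False
    then have "q * n \<le> q * u + j" by (simp add: trans_le_add1)
    then show ?thesis using False by (simp add: algebra_simps)
  qed
  moreover have "a * n \<le> i \<longleftrightarrow> (\<exists>u. i = a * n + u)" by (rule le_iff_add)
  ultimately show ?thesis
    by (simp only: pow_exp_def mem_Collect_eq prod.case) metis
qed

lemma pow_exp_shift_iff: "(a * n + u, j) \<in> pow_exp a q n \<longleftrightarrow> q * (n - u) \<le> j"
  by (auto simp: pow_exp_iff)

lemma pow_exp_facts: "pow_exp a q 0 = UNIV" "exp_sum (pow_exp a q n) (pow_exp a q 1) = pow_exp a q (Suc n)"
  "up_closed (pow_exp a q 1)" "fin_gen (pow_exp a q 1)"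
proof -
  show "pow_exp a q 0 = UNIV" by (auto simp: pow_exp_def)
  show "up_closed (pow_exp a q 1)"
    unfolding up_closed_def
  proof (intro allI impI)
    fix i j i' j' assume *: "(i, j) \<in> pow_exp a q 1" "i \<le> i'" "j \<le> j'"
    then have "q * i + j \<le> q * i' + j'" by (intro add_mono mult_le_mono) auto
    with * show "(i', j') \<in> pow_exp a q 1" unfolding pow_exp_def by simp
  qed
  have "(i, j) \<in> exp_sum (pow_exp a q n) (pow_exp a q 1)" if "(i, j) \<in> pow_exp a q (Suc n)" for i j
  proof -
    from that obtain u where u: "i = a * Suc n + u" "q * (Suc n - u) \<le> j"
      by (auto simp: pow_exp_iff)
    show ?thesis
    \<comment> \<open>In the columns with \<open>u \<le> n\<close> one has \<open>j \<ge> q\<close>,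
      and the generator x^a y^q can be split off; further right it is x^(a+1).\<close>
    proof (cases "u \<le> n")
      case True
      then have "q * (Suc n - u) = q + q * (n - u)" by (simp add: Suc_diff_le)
      with u have "(i, j) = ((a * n + u) + (a * 1 + 0), (j - q) + q)" "q * (n - u) \<le> j - q" by auto
      moreover have "(a * n + u, j - q) \<in> pow_exp a q n" "(a * 1 + 0, q) \<in> pow_exp a q 1"
        using \<open>q * (n - u) \<le> j - q\<close> unfolding pow_exp_shift_iff by auto
      ultimately show ?thesis unfolding exp_sum_def by blast
    next
      case False
      with u have "(i, j) = ((a * n + (u - 1)) + (a * 1 + 1), j + 0)" by auto
      moreover have "(a * n + (u - 1), j) \<in> pow_exp a q n" "(a * 1 + 1, 0) \<in> pow_exp a q 1"
        using False unfolding pow_exp_shift_iff by auto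
      ultimately show ?thesis unfolding exp_sum_def by blast
    qed
  qed
  moreover have "exp_sum (pow_exp a q n) (pow_exp a q 1) \<subseteq> pow_exp a q (Suc n)"
    by (auto simp: exp_sum_def pow_exp_def algebra_simps)
  ultimately show "exp_sum (pow_exp a q n) (pow_exp a q 1) = pow_exp a q (Suc n)" by auto
  have "pow_exp a q 1 \<subseteq> up_set {(a + 1, 0), (a, q)}"
  proof (clarify)
    fix i j assume "(i, j) \<in> pow_exp a q 1"
    then obtain u where "i = a * 1 + u" "q * (1 - u) \<le> j" by (auto simp: pow_exp_iff)
    then show "(i, j) \<in> up_set {(a + 1, 0), (a, q)}" by (cases u) (auto simp: up_set_def)
  qed
  then show "fin_gen (pow_exp a q 1)"
    unfolding fin_gen_def by (intro exI[of _ "{(a + 1, 0), (a, q)}"]) (auto simp: pow_exp_def)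
qed

lemmas deg_exp_power = ideal_power_mon_ideal[of deg_exp, OF deg_exp_facts]
lemmas pow_exp_power = ideal_power_mon_ideal[of "pow_exp a q" for a q, OF pow_exp_facts]

lemma max_ideal_eq_mon_ideal:
  "max_ideal (fps_ring_xy :: 'k::field fps fps ring) = mon_ideal (deg_exp 1)"
  by (auto simp: max_ideal_fps_ring_xy mon_ideal_def deg_exp_def Suc_le_eq)

text \<open>A point is in the n-th power of the maximal ideal times I^v iff some generator of I^v
  lies below it at distance at least \<open>n\<close>. Moving to the next generator costs one step
  in x and gains \<open>q \<ge> 1\<close> in y, so the best generator is in column
  \<open>min u v\<close>.\<close>

lemma exp_sum_deg_pow_iff:
  assumes "q \<ge> 1"
  shows "(a * v + u, w) \<in> exp_sum (deg_exp n) (pow_exp a q v) \<longleftrightarrow> n + q * (v - u) \<le> (u - v) + w"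
proof
  assume "(a * v + u, w) \<in> exp_sum (deg_exp n) (pow_exp a q v)"
  then obtain i j i' j' where *: "a * v + u = i + i'" "w = j + j'" "n \<le> i + j" "(i', j') \<in> pow_exp a q v"
    by (auto simp: exp_sum_def deg_exp_def)
  then obtain u' where u': "i' = a * v + u'" "q * (v - u') \<le> j'" by (auto simp: pow_exp_iff)
  with * have u: "u = i + u'" by simp
  have "q * (v - u) + (i - (u - v)) \<le> q * (v - u) + q * (i - (u - v))"
    using assms by simp
  also have "\<dots> = q * (v - u + (i - (u - v)))" by (simp add: algebra_simps)
  also have "\<dots> \<le> q * (v - u')" using u by (intro mult_le_mono) auto
  finally show "n + q * (v - u) \<le> (u - v) + w" using * u' by linarith
next
  assume le: "n + q * (v - u) \<le> (u - v) + w"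
  show "(a * v + u, w) \<in> exp_sum (deg_exp n) (pow_exp a q v)"
  proof (cases "u \<le> v")
    case True
    with le have "(0, w - q * (v - u)) \<in> deg_exp n" "q * (v - u) \<le> w" by (auto simp: deg_exp_def)
    moreover have "(a * v + u, q * (v - u)) \<in> pow_exp a q v" by (simp add: pow_exp_shift_iff)
    moreover have "(a * v + u, w) = (0 + (a * v + u), (w - q * (v - u)) + q * (v - u))"
      using \<open>q * (v - u) \<le> w\<close> by simp
    ultimately show ?thesis unfolding exp_sum_def by blast
  next
    case False
    with le have "(u - v, w) \<in> deg_exp n" by (auto simp: deg_exp_def)
    moreover have "(a * v + v, 0) \<in> pow_exp a q v" by (simp add: pow_exp_shift_iff)
    moreover have "(a * v + u, w) = ((u - v) + (a * v + v), w + 0)"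
      using False by simp
    ultimately show ?thesis unfolding exp_sum_def by blast
  qed
qed

section \<open>Lattice points in the layers of the Hilbert function\<close>

lemma exp_sum_subset: "up_closed E \<Longrightarrow> exp_sum F E \<subseteq> E"
  using exp_sum_UNIV exp_sum_mono[of F UNIV E E] by blast

lemma pow_exp_Suc_subset: "pow_exp a q (Suc n) \<subseteq> pow_exp a q n"
  by (auto simp: pow_exp_def)

text \<open>The monomial basis of the v-th quotient in \<open>hilbert_sum\<close>.\<close>

definition layer :: "nat \<Rightarrow> nat \<Rightarrow> nat \<Rightarrow> nat \<Rightarrow> (nat \<times> nat) set" where
  "layer a q r v = pow_exp a q v - (exp_sum (deg_exp (r + 1)) (pow_exp a q v) \<union> pow_exp a q (v + 1))"

text \<open>For large \<open>r\<close>, column \<open>a v + u\<close> of the layer is cut off by the power of the maximal ideal if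
  \<open>u < a\<close> and by the next power of \<open>I\<close> otherwise.\<close>

definition column :: "nat \<Rightarrow> nat \<Rightarrow> nat \<Rightarrow> nat \<Rightarrow> nat \<Rightarrow> nat" where
  "column a q r v u = (if u < a then r + 1 - (u - v) else q * (v + 1 + a - u) - q * (v - u))"

text \<open>In the columns with \<open>a \<le> u \<le> v + a\<close>, the next power of I leaves
  height at most \<open>q * (a + 1)\<close>, and \<open>u - v \<le> a\<close>. Hence for
  \<open>r \<ge> q * (a + 1) + a\<close> the power of the maximal ideal cuts away nothing more
  there. Beyond column \<open>v + a\<close> the next power of I contains everything.\<close>

lemma layer_eq:
  assumes q: "q \<ge> 1" and r: "r \<ge> q * (a + 1) + a"
  shows "layer a q r v = (\<lambda>(u, w). (a * v + u, w)) `
    (SIGMA u:{..<v + a + 1}. {q * (v - u) ..< q * (v - u) + column a q r v u})" (is "_ = ?R")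
proof -
  have Suc: "(a * v + u, w) \<in> pow_exp a q (v + 1) \<longleftrightarrow> a \<le> u \<and> q * (v + 1 + a - u) \<le> w" for u w
  proof (cases "a \<le> u")
    case True
    then have "a * v + u = a * (v + 1) + (u - a)" by simp
    then show ?thesis using pow_exp_shift_iff[of a "v + 1" "u - a" w q] True by simp
  next
    case False
    then show ?thesis by (auto simp: pow_exp_def)
  qed
  have mem: "(a * v + u, w) \<in> layer a q r v \<longleftrightarrow> u < v + a + 1 \<and> q * (v - u) \<le> w \<and>
    w < q * (v - u) + column a q r v u" for u w
  proof -
    have "(a * v + u, w) \<in> layer a q r v \<longleftrightarrow>
      q * (v - u) \<le> w \<and> (u - v) + w < r + 1 + q * (v - u) \<and> (u < a \<or> w < q * (v + 1 + a - u))"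
      unfolding layer_def using Suc[of u w] pow_exp_shift_iff[of a v u w q]
        exp_sum_deg_pow_iff[OF q, of a v u w "r + 1"] by auto
    also have "\<dots> \<longleftrightarrow> u < v + a + 1 \<and> q * (v - u) \<le> w \<and> w < q * (v - u) + column a q r v u"
    proof (cases "u < a")
      case True
      have "q * 1 \<le> q * (a + 1)" by (intro mult_le_mono) auto
      then have "u - v \<le> r" using True r by linarith
      with True show ?thesis by (auto simp: column_def)
    next
      case False
      show ?thesis
      proof (cases "u < v + a + 1")
        case True
        have "q * (v + 1 + a - u) \<le> q * ((v - u) + (a + 1))" by (intro mult_le_mono) auto
        also have "\<dots> = q * (v - u) + q * (a + 1)" by (simp add: algebra_simps)
        finally have *: "q * (v + 1 + a - u) \<le> q * (v - u) + q * (a + 1)" .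
        have "q * (v - u) \<le> q * (v + 1 + a - u)" by (intro mult_le_mono) auto
        moreover have "u - v \<le> a" using True by simp
        ultimately show ?thesis using * r False True by (auto simp: column_def)
      next
        case False
        then have "v + 1 + a - u = 0" "\<not> u < a" by auto
        with False show ?thesis by auto
      qed
    qed
    finally show ?thesis .
  qed
  show ?thesis
  proof (rule Set.set_eqI)
    fix p :: "nat \<times> nat"
    obtain i w where p: "p = (i, w)" by force
    show "p \<in> layer a q r v \<longleftrightarrow> p \<in> ?R"
    proof (cases "a * v \<le> i")
      case True
      then obtain u where "i = a * v + u" by (auto simp: le_iff_add)
      then show ?thesis using mem[of u w] p by auto
    next
      case False
      then show ?thesis by (auto simp: p layer_def pow_exp_def)
    qed
  qed
qed

text \<open>The part of the size of a layer that does not depend on \<open>r\<close>. The first sum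
  corrects the columns \<open>u < a\<close> of the early layers and vanishes for
  \<open>a \<le> v\<close>; in the second the columns are renumbered by
  \<open>w = u - a\<close>.\<close>

definition layer_const :: "nat \<Rightarrow> nat \<Rightarrow> nat \<Rightarrow> real" where
  "layer_const a q v = - (\<Sum>u<a. real (u - v)) + (\<Sum>w\<le>v. real (q * (v + 1 - w)) - real (q * (v - a - w)))"

lemma card_layer:
  assumes q: "q \<ge> 1" and r: "r \<ge> q * (a + 1) + a"
  shows "finite (layer a q r v)" "real (card (layer a q r v)) = real a * (real r + 1) + layer_const a q v"
proof -
  have inj: "inj_on (\<lambda>(u, w). (a * v + u, w :: nat)) A" for A
    by (auto simp: inj_on_def)
  show "finite (layer a q r v)"
    unfolding layer_eq[OF assms] by auto
  have "card (layer a q r v) = (\<Sum>u<v + a + 1. column a q r v u)"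
    unfolding layer_eq[OF assms] card_image[OF inj] by (simp del: lessThan_Suc sum.lessThan_Suc)
  also have "{..<v + a + 1} = {..<a} \<union> (\<lambda>w. a + w) ` {..v}"
  proof (rule Set.set_eqI)
    fix u show "u \<in> {..<v + a + 1} \<longleftrightarrow> u \<in> {..<a} \<union> (\<lambda>w. a + w) ` {..v}"
      by (cases "u < a") (auto intro!: image_eqI[of _ _ "u - a"])
  qed
  also have "(\<Sum>u\<in>\<dots>. column a q r v u) = (\<Sum>u<a. column a q r v u) + (\<Sum>u\<in>(\<lambda>w. a + w) ` {..v}. column a q r v u)"
    by (intro sum.union_disjoint) auto
  also have "(\<Sum>u\<in>(\<lambda>w. a + w) ` {..v}. column a q r v u) = (\<Sum>w\<le>v. column a q r v (a + w))"
    by (subst sum.reindex) (auto simp: o_def)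
  finally have "real (card (layer a q r v)) =
    (\<Sum>u<a. real (column a q r v u)) + (\<Sum>w\<le>v. real (column a q r v (a + w)))" by simp
  also have "(\<Sum>u<a. real (column a q r v u)) = (\<Sum>u<a. (real r + 1) - real (u - v))"
  proof (intro sum.cong refl)
    fix u assume "u \<in> {..<a}"
    then have "u - v \<le> a" by simp
    then have "u - v \<le> r + 1" using r by linarith
    with \<open>u \<in> {..<a}\<close> show "real (column a q r v u) = real r + 1 - real (u - v)"
      by (simp add: column_def of_nat_diff)
  qed
  also have "\<dots> = real a * (real r + 1) - (\<Sum>u<a. real (u - v))"
    by (simp add: sum_subtractf)
  also have "(\<Sum>w\<le>v. real (column a q r v (a + w))) =
    (\<Sum>w\<le>v. real (q * (v + 1 - w)) - real (q * (v - a - w)))"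
  proof (intro sum.cong refl)
    fix w assume "w \<in> {..v}"
    have "q * (v - a - w) \<le> q * (v + 1 - w)" by (intro mult_le_mono) auto
    then show "real (column a q r v (a + w)) = real (q * (v + 1 - w)) - real (q * (v - a - w))"
      by (simp add: column_def of_nat_diff del: of_nat_mult)
  qed
  finally show "real (card (layer a q r v)) = real a * (real r + 1) + layer_const a q v"
    by (simp add: layer_const_def)
qed

lemma sum_truncated_diff: "(\<Sum>w\<le>v + b. real (v - w)) = real v * (real v + 1) / 2"
proof -
  have "(\<Sum>w\<le>v + b. real (v - w)) = (\<Sum>w\<le>v. real (v - w))"
    by (intro sum.mono_neutral_right) auto
  also have "\<dots> = (\<Sum>w\<le>v. real w)"
    by (rule sum.reindex_bij_witness[of _ "\<lambda>w. v - w" "\<lambda>w. v - w"]) auto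
  also have "\<dots> = real v * (real v + 1) / 2"
    by (induction v) (auto simp: field_simps)
  finally show ?thesis .
qed

text \<open>For \<open>a \<le> v\<close> the count is \<open>q\<close> times the difference of the
  triangular numbers of index \<open>v + 1\<close> and \<open>v - a\<close>, a sum of
  \<open>a + 1\<close> consecutive integers. Hence it is affine in \<open>v\<close>, and its slope
  \<open>q * (a + 1)\<close> becomes c_2.\<close>

lemma layer_const_eq:
  assumes "a \<le> v"
  shows "layer_const a q v = real (q * (a + 1)) * real v + real q * (real a + 1) * (2 - real a) / 2"
proof -
  have "(\<Sum>w\<le>v. real (v - a - w)) = real (v - a) * (real (v - a) + 1) / 2"
    using sum_truncated_diff[of "v - a" a] assms by simp
  moreover have "(\<Sum>w\<le>v. real (v + 1 - w)) = real (v + 1) * (real (v + 1) + 1) / 2"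
    using sum_truncated_diff[of "v + 1" 0] by simp
  moreover have "(\<Sum>u<a. real (u - v)) = 0" using assms by (intro sum.neutral) auto
  moreover have "layer_const a q v = - (\<Sum>u<a. real (u - v)) +
    real q * ((\<Sum>w\<le>v. real (v + 1 - w)) - (\<Sum>w\<le>v. real (v - a - w)))"
    by (simp add: layer_const_def sum_subtractf sum_distrib_left right_diff_distrib)
  ultimately have "layer_const a q v = real q * (real (v + 1) * (real (v + 1) + 1) / 2
     - real (v - a) * (real (v - a) + 1) / 2)" by simp
  with assms show ?thesis by (simp add: of_nat_diff field_simps)
qed

lemma sum_eventually_affine:
  fixes f :: "nat \<Rightarrow> real"
  assumes "\<And>v. v \<ge> a \<Longrightarrow> f v = 2 * c * real v + d"
  shows "\<exists>\<alpha> \<beta>. \<forall>s\<ge>a. (\<Sum>v\<le>s. f v) = c * real s ^ 2 + \<alpha> * real s + \<beta>"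
proof -
  \<comment> \<open>The sum of \<open>2 * c * v + d\<close> grows like c s (s + 1) + d s; the
    irregular terms at the beginning only affect \<open>\<beta>\<close>.\<close>
  define \<alpha> where "\<alpha> = c + d"
  define \<beta> where "\<beta> = (\<Sum>v\<le>a. f v) - c * real a ^ 2 - \<alpha> * real a"
  have "(\<Sum>v\<le>s. f v) = c * real s ^ 2 + \<alpha> * real s + \<beta>" if "s \<ge> a" for s
    using that
  proof (induction rule: dec_induct)
    case (step s)
    then have "f (Suc s) = 2 * c * (real s + 1) + d" using assms[of "Suc s"] by (simp add: add.commute)
    with step.IH show ?case
      by (simp add: \<alpha>_def power2_eq_square algebra_simps)
  qed (simp add: \<beta>_def)
  then show ?thesis by blast
qed

lemma hilbert_sum_pow_exp:
  assumes "q \<ge> 1" "r \<ge> q * (a + 1) + a"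
  shows "hilbert_sum (fps_ring_xy :: 'k::field fps fps ring) (mon_ideal (pow_exp a q 1)) r s =
    enat (\<Sum>v\<le>s. card (layer a q r v))"
proof -
  have "module_length (fps_ring_xy :: 'k fps fps ring)
      (quot_module (ideal_module fps_ring_xy (ideal_power fps_ring_xy (mon_ideal (pow_exp a q 1)) v))
        (ideal_prod fps_ring_xy (ideal_power fps_ring_xy (max_ideal fps_ring_xy) (r + 1))
          (ideal_power fps_ring_xy (mon_ideal (pow_exp a q 1)) v)
          <+>\<^bsub>fps_ring_xy\<^esub> ideal_power fps_ring_xy (mon_ideal (pow_exp a q 1)) (v + 1))) =
    enat (card (layer a q r v))" for v
  proof -
    let ?F = "exp_sum (deg_exp (r + 1)) (pow_exp a q v) \<union> pow_exp a q (v + 1)"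
    have "up_closed ?F"
      using up_closed_exp_sum[OF pow_exp_power(2)[of a q v], of "deg_exp (r + 1)"]
        pow_exp_power(2)[of a q "v + 1"] unfolding up_closed_def by blast
    moreover have "?F \<subseteq> pow_exp a q v"
      using exp_sum_subset[OF pow_exp_power(2)] pow_exp_Suc_subset[of a q v] by auto
    moreover have "finite (pow_exp a q v - ?F)"
      using card_layer(1)[OF assms] by (simp add: layer_def)
    ultimately show ?thesis
      unfolding max_ideal_eq_mon_ideal deg_exp_power(1) pow_exp_power(1) layer_def
        ideal_prod_mon_ideal_fin_gen[OF deg_exp_power(2) pow_exp_power(2) deg_exp_power(3) pow_exp_power(3)]
        set_add_mon_ideal
      by (intro module_length_quot_mon_ideal pow_exp_power)
  qed
  moreover have "(\<Sum>v\<in>A. enat (f v)) = enat (\<Sum>v\<in>A. f v)" for f and A :: "nat set"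
    by (induction A rule: infinite_finite_induct) (auto simp: zero_enat_def)
  ultimately show ?thesis
    unfolding hilbert_sum_def by (simp add: atLeast0AtMost)
qed

text \<open>Finiteness of roots is used twice: over the reals for the polynomial in r at each fixed
  s, then over the domain of polynomials in r, where the constants \<open>[:real s:]\<close> are
  infinitely many roots.\<close>

lemma poly_poly_eqI:
  fixes P Q :: "real poly poly"
  assumes "\<And>r s. r \<ge> N \<Longrightarrow> s \<ge> N \<Longrightarrow> poly (poly P [:real s:]) (real r) = poly (poly Q [:real s:]) (real r)"
  shows "P = Q"
proof -
  have zero: "p = 0" if "\<And>n. n \<ge> N \<Longrightarrow> poly p (f n) = 0" "inj f"
    for p :: "'a::idom poly" and f :: "nat \<Rightarrow> 'a"
  proof (rule ccontr)
    assume "p \<noteq> 0"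
    then have "finite {x. poly p x = 0}" by (rule poly_roots_finite)
    then have "finite (f ` {N..})" by (rule rev_finite_subset) (use that in auto)
    then have "finite {N..}" by (rule finite_imageD) (use that(2) in \<open>auto intro: inj_on_subset\<close>)
    then show False by (simp add: infinite_Ici)
  qed
  have "poly P [:real s:] - poly Q [:real s:] = 0" if "s \<ge> N" for s
    by (rule zero[of _ real]) (use assms that in auto)
  then have "P - Q = 0"
    by (intro zero[of _ "\<lambda>s. [:real s:]"]) (auto simp: inj_on_def)
  then show ?thesis by simp
qed

section \<open>The Hilbert polynomial and the multiplicity sequence\<close>

lemma hilbert_poly_pow_exp:
  assumes "q \<ge> 1"
  obtains \<alpha> \<beta> where "hilbert_poly (fps_ring_xy :: 'k::field fps fps ring) (mon_ideal (pow_exp a q 1)) =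
    [:[:\<beta>, real a:], [:\<alpha>, real a:], [:real (q * (a + 1)) / 2:]:]"
proof -
  have "layer_const a q v = 2 * (real (q * (a + 1)) / 2) * real v + real q * (real a + 1) * (2 - real a) / 2"
    if "v \<ge> a" for v using layer_const_eq[OF that, of q] by simp
  from sum_eventually_affine[of a "layer_const a q", OF this]
  obtain \<alpha> \<beta> where ab: "\<And>s. s \<ge> a \<Longrightarrow> (\<Sum>v\<le>s. layer_const a q v) =
    real (q * (a + 1)) / 2 * real s ^ 2 + \<alpha> * real s + \<beta>" by blast
  define N where "N = q * (a + 1) + a"
  \<comment> \<open>The term \<open>a * (r + 1)\<close>, summed over \<open>s + 1\<close> layers,
    contributes a r s + a r + a s + a. There is no r^2, the coefficient of r s is a, and s^2 comes
    from \<open>layer_const\<close> alone; these give c_0, c_1 and c_2.\<close>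
  define P where "P = [:[:\<beta> + real a, real a:], [:\<alpha> + real a, real a:], [:real (q * (a + 1)) / 2:]:]"
  have eq: "ereal_of_enat (hilbert_sum (fps_ring_xy :: 'k fps fps ring) (mon_ideal (pow_exp a q 1)) r s) =
    ereal (poly (poly P [:real s:]) (real r))" if "r \<ge> N" "s \<ge> N" for r s
  proof -
    have "real (\<Sum>v\<le>s. card (layer a q r v)) = (\<Sum>v\<le>s. real a * (real r + 1) + layer_const a q v)"
      using card_layer(2)[OF assms that(1)[unfolded N_def]] by simp
    also have "\<dots> = poly (poly P [:real s:]) (real r)"
      using that by (simp add: sum.distrib ab N_def P_def power2_eq_square algebra_simps)
    finally show ?thesis
      using hilbert_sum_pow_exp[OF assms that(1)[unfolded N_def], where 'k='k] by simp
  qed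
  have "hilbert_poly (fps_ring_xy :: 'k fps fps ring) (mon_ideal (pow_exp a q 1)) = P"
    unfolding hilbert_poly_def
  proof (rule the_equality)
    show "is_hilbert_poly (fps_ring_xy :: 'k fps fps ring) (mon_ideal (pow_exp a q 1)) P"
      unfolding is_hilbert_poly_def using eq by blast
    fix Q assume "is_hilbert_poly (fps_ring_xy :: 'k fps fps ring) (mon_ideal (pow_exp a q 1)) Q"
    then obtain N' where "\<And>r s. r \<ge> N' \<Longrightarrow> s \<ge> N' \<Longrightarrow>
      ereal_of_enat (hilbert_sum (fps_ring_xy :: 'k fps fps ring) (mon_ideal (pow_exp a q 1)) r s) =
      ereal (poly (poly Q [:real s:]) (real r))"
      unfolding is_hilbert_poly_def by blast
    with eq show "Q = P" by (intro poly_poly_eqI[of "max N N'"]) (metis ereal.inject max.bounded_iff)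
  qed
  then show thesis using that by (simp add: P_def)
qed

lemma mult_seq_pow_exp:
  assumes "q \<ge> 1"
  shows "mult_seq (fps_ring_xy :: 'k::field fps fps ring) (mon_ideal (pow_exp a q 1)) 0 = 0"
    "mult_seq (fps_ring_xy :: 'k::field fps fps ring) (mon_ideal (pow_exp a q 1)) 1 = real a"
    "mult_seq (fps_ring_xy :: 'k::field fps fps ring) (mon_ideal (pow_exp a q 1)) 2 = real (q * (a + 1))"
proof -
  obtain \<alpha> \<beta> where P: "hilbert_poly (fps_ring_xy :: 'k::field fps fps ring) (mon_ideal (pow_exp a q 1)) =
    [:[:\<beta>, real a:], [:\<alpha>, real a:], [:real (q * (a + 1)) / 2:]:]"
    by (rule hilbert_poly_pow_exp[OF assms, where 'k='k and a=a])
  have "the_enat (krull_dim (fps_ring_xy :: 'k fps fps ring)) = 2"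
    by (simp add: krull_dim_fps_ring_xy numeral_eq_enat)
  then show "mult_seq (fps_ring_xy :: 'k::field fps fps ring) (mon_ideal (pow_exp a q 1)) 0 = 0"
    "mult_seq (fps_ring_xy :: 'k::field fps fps ring) (mon_ideal (pow_exp a q 1)) 1 = real a"
    "mult_seq (fps_ring_xy :: 'k::field fps fps ring) (mon_ideal (pow_exp a q 1)) 2 = real (q * (a + 1))"
    unfolding mult_seq_def P by (simp_all add: numeral_2_eq_2)
qed

section \<open>The ideals \<open>x\<^sup>a(x, y\<^sup>q)\<close>\<close>

text \<open>If z had order e < c, then z^n would have order e n, while the i-th remaining term has
  order at least c i + e (n - i) > e n, so the lowest term could not cancel.\<close>

lemma integral_equation_order:
  fixes z :: "'a::idom fps"
  assumes "z ^ n + (\<Sum>i\<in>{1..n}. a i * z ^ (n - i)) = 0"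
    and a: "\<And>i j. i \<in> {1..n} \<Longrightarrow> j < c * i \<Longrightarrow> a i $ j = 0" and "j < c"
  shows "z $ j = 0"
proof (rule ccontr)
  assume zj: "z $ j \<noteq> 0"
  define e where "e = subdegree z"
  have "z \<noteq> 0" using zj by auto
  have "e \<le> j" unfolding e_def using zj by (rule subdegree_leI)
  with \<open>j < c\<close> have "e < c" by simp
  have "(a i * z ^ (n - i)) $ (e * n) = 0" if i: "i \<in> {1..n}" for i
    unfolding fps_mult_nth
  proof (intro sum.neutral ballI)
    fix l assume "l \<in> {0..e * n}"
    show "a i $ l * z ^ (n - i) $ (e * n - l) = 0"
    proof (cases "l < c * i")
      case True
      with a[OF i] show ?thesis by simp
    next
      case False
      have "e * i < c * i" using i \<open>e < c\<close> by simp
      with False have "e * i < l" by linarith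
      moreover have "e * i \<le> e * n" using i by simp
      ultimately have "e * n - l < e * n - e * i" using \<open>l \<in> {0..e * n}\<close> by auto
      also have "\<dots> = subdegree (z ^ (n - i))"
        by (simp add: e_def diff_mult_distrib2 mult.commute)
      finally show ?thesis by (simp add: nth_less_subdegree_zero)
    qed
  qed
  then have "(z ^ n + (\<Sum>i\<in>{1..n}. a i * z ^ (n - i))) $ (e * n) = z ^ n $ (e * n)"
    by (simp add: fps_sum_nth)
  also have "e * n = subdegree (z ^ n)" by (simp add: e_def mult.commute)
  also have "z ^ n $ subdegree (z ^ n) \<noteq> 0" using \<open>z \<noteq> 0\<close> by (intro nth_subdegree_nonzero) simp
  finally show False unfolding assms(1) by simp
qed

lemma fps_mult_nth_lowest:
  fixes f g :: "'a::comm_ring_1 fps"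
  assumes "\<And>i. i < m \<Longrightarrow> f $ i = 0" "\<And>i. i < n \<Longrightarrow> g $ i = 0"
  shows "(f * g) $ (m + n) = f $ m * g $ n" and "l < m + n \<Longrightarrow> (f * g) $ l = 0"
proof -
  have zero: "f $ i * g $ (l - i) = 0" if "i \<le> l" "l \<le> m + n" "i \<noteq> m \<or> l < m + n" for i l
    using that assms by (cases "i < m"; cases "l - i < n") auto
  have "(f * g) $ (m + n) = (\<Sum>i\<in>{m}. f $ i * g $ (m + n - i))"
    unfolding fps_mult_nth by (rule sum.mono_neutral_right) (use zero in auto)
  then show "(f * g) $ (m + n) = f $ m * g $ n" by simp
  show "(f * g) $ l = 0" if "l < m + n" for l
    unfolding fps_mult_nth by (rule sum.neutral) (use zero that in auto)
qed

lemma fps_power_nth_lowest: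
  fixes f :: "'a::comm_ring_1 fps"
  assumes "\<And>i. i < m \<Longrightarrow> f $ i = 0"
  shows "(f ^ n) $ (m * n) = (f $ m) ^ n" and "l < m * n \<Longrightarrow> (f ^ n) $ l = 0"
proof -
  have "(f ^ n) $ (m * n) = (f $ m) ^ n \<and> (\<forall>l<m * n. (f ^ n) $ l = 0)"
  proof (induction n)
    case (Suc n)
    with fps_mult_nth_lowest[of m f "m * n" "f ^ n"] assms show ?case by (simp add: add.commute)
  qed simp
  then show "(f ^ n) $ (m * n) = (f $ m) ^ n" and "l < m * n \<Longrightarrow> (f ^ n) $ l = 0" by auto
qed

lemma mon_ideal_pow_expD:
  assumes "f \<in> mon_ideal (pow_exp a q n)"
  shows "i < a * n \<Longrightarrow> f $ i = 0" "j < q * n \<Longrightarrow> f $ (a * n) $ j = 0"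
proof -
  show "f $ i = 0" if "i < a * n"
    using that assms by (intro fps_ext) (auto simp: mon_ideal_def pow_exp_def)
  show "f $ (a * n) $ j = 0" if "j < q * n"
    using that assms pow_exp_shift_iff[of a n 0 j q] by (auto simp: mon_ideal_def)
qed

lemma mem_mon_ideal_pow_exp_1_iff:
  "f \<in> mon_ideal (pow_exp a q 1) \<longleftrightarrow> (\<forall>i<a. f $ i = 0) \<and> (\<forall>j<q. f $ a $ j = 0)"
proof
  assume "f \<in> mon_ideal (pow_exp a q 1)"
  from mon_ideal_pow_expD[OF this] show "(\<forall>i<a. f $ i = 0) \<and> (\<forall>j<q. f $ a $ j = 0)" by auto
next
  assume *: "(\<forall>i<a. f $ i = 0) \<and> (\<forall>j<q. f $ a $ j = 0)"
  have "f $ i $ j = 0" if "(i, j) \<notin> pow_exp a q 1" for i j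
  proof (cases "i < a")
    case False
    then obtain u where u: "i = a * 1 + u" by (auto simp: le_iff_add not_less)
    with that have "j < q * (1 - u)" using pow_exp_shift_iff[of a 1 u j q] by simp
    with u * show ?thesis by (cases u) auto
  qed (use * in simp)
  then show "f \<in> mon_ideal (pow_exp a q 1)" by (simp add: mon_ideal_def)
qed

lemmas mem_mon_ideal_pow_exp_iff =
  mem_mon_ideal_pow_exp_1_iff mem_mon_ideal_pow_exp_1_iff[unfolded One_nat_def]

text \<open>Two orders in succession. The order in x shows that z is divisible by x^a. The
  coefficient of x^(a n) in the integral equation is then an integral equation for
  \<open>z $ a\<close> over k[[y]], whose i-th coefficient has y-order at least q i, and the same
  argument applies to y.\<close>

lemma integrally_closed_pow_exp:
  "integrally_closed (fps_ring_xy :: 'k::field fps fps ring) (mon_ideal (pow_exp a q 1))"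
  unfolding integrally_closed_def
proof
  let ?I = "mon_ideal (pow_exp a q 1) :: 'k fps fps set"
  show "?I \<subseteq> integral_closure fps_ring_xy ?I"
  proof
    fix z assume z: "z \<in> ?I"
    have "- z \<in> ?I" using z by (simp add: mon_ideal_def)
    then have "- z \<in> ideal_power fps_ring_xy ?I 1" by (simp only: pow_exp_power(1))
    then show "z \<in> integral_closure fps_ring_xy ?I"
      unfolding integral_closure_def
      by (intro CollectI conjI exI[of _ "1::nat"] exI[of _ "\<lambda>_. - z"]) auto
  qed
  show "integral_closure fps_ring_xy ?I \<subseteq> ?I"
  proof
    fix z assume "z \<in> integral_closure fps_ring_xy ?I"
    then obtain n :: nat and b where n: "n \<ge> 1"
      and b: "\<And>i. i \<in> {1..n} \<Longrightarrow> b i \<in> mon_ideal (pow_exp a q i)"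
      and eq: "z ^ n + (\<Sum>i\<in>{1..n}. b i * z ^ (n - i)) = 0"
      unfolding integral_closure_def pow_exp_power(1)
      by (simp only: mem_Collect_eq ring_of_type_algebra_simps ring_of_type_algebra_nat_pow
          ring_of_type_algebra_finsum) blast
    have z: "z $ j = 0" if "j < a" for j
      by (rule integral_equation_order[OF eq _ that]) (auto intro: mon_ideal_pow_expD[OF b])
    have "(b i * z ^ (n - i)) $ (a * n) = b i $ (a * i) * (z $ a) ^ (n - i)" if "i \<in> {1..n}" for i
    proof -
      have "a * i + a * (n - i) = a * n" using that by (simp flip: distrib_left)
      then show ?thesis
        using fps_mult_nth_lowest(1)[of "a * i" "b i" "a * (n - i)" "z ^ (n - i)"]
          fps_power_nth_lowest(1)[of a z "n - i"] fps_power_nth_lowest(2)[of a z _ "n - i"] z mon_ideal_pow_expD(1)[OF b[OF that]] by simp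
    qed
    then have "(z $ a) ^ n + (\<Sum>i\<in>{1..n}. b i $ (a * i) * (z $ a) ^ (n - i)) =
      (z ^ n + (\<Sum>i\<in>{1..n}. b i * z ^ (n - i))) $ (a * n)"
      using fps_power_nth_lowest(1)[of a z n] z by (simp add: fps_sum_nth)
    with eq have eq': "(z $ a) ^ n + (\<Sum>i\<in>{1..n}. b i $ (a * i) * (z $ a) ^ (n - i)) = 0" by simp
    have "z $ a $ j = 0" if "j < q" for j
      by (rule integral_equation_order[OF eq' _ that]) (auto intro: mon_ideal_pow_expD[OF b])
    with z show "z \<in> ?I" by (simp add: mem_mon_ideal_pow_exp_iff)
  qed
qed

lemma ideal_radical_pow_exp:
  assumes "a \<ge> 1"
  shows "ideal_radical (fps_ring_xy :: 'k::field fps fps ring) (mon_ideal (pow_exp a q 1)) =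
    PIdl\<^bsub>fps_ring_xy\<^esub> var_x"
  unfolding PIdl_var_x
proof
  show "ideal_radical fps_ring_xy (mon_ideal (pow_exp a q 1)) \<subseteq> {f :: 'k fps fps. f $ 0 = 0}"
  proof
    fix f :: "'k fps fps" assume "f \<in> ideal_radical fps_ring_xy (mon_ideal (pow_exp a q 1))"
    then obtain n :: nat where "f ^ n \<in> mon_ideal (pow_exp a q 1)"
      by (auto simp: ideal_radical_def)
    then have "(f ^ n) $ 0 = 0" using assms by (auto simp: mem_mon_ideal_pow_exp_iff)
    then show "f \<in> {f. f $ 0 = 0}" by (simp add: fps_nth_power_0 power_eq_0_iff split: if_splits)
  qed
  show "{f :: 'k fps fps. f $ 0 = 0} \<subseteq> ideal_radical fps_ring_xy (mon_ideal (pow_exp a q 1))"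
  proof
    fix f :: "'k fps fps" assume "f \<in> {f. f $ 0 = 0}"
    \<comment> \<open>One power more than \<open>a\<close> makes the condition on y in column
      \<open>a\<close> vacuous.\<close>
    then have "f ^ (a + 1) \<in> mon_ideal (pow_exp a q 1)"
      using fps_power_nth_lowest(2)[of 1 f _ "a + 1"] by (simp add: mem_mon_ideal_pow_exp_iff del: power_Suc)
    then show "f \<in> ideal_radical fps_ring_xy (mon_ideal (pow_exp a q 1))"
      unfolding ideal_radical_def by (intro CollectI conjI exI[of _ "a + 1"])
        (simp_all only: ring_of_type_algebra_simps(1) ring_of_type_algebra_nat_pow UNIV_I le_add2)
  qed
qed

lemma ideal_height_pow_exp:
  assumes "a \<ge> 1"
  shows "ideal_height (fps_ring_xy :: 'k::field fps fps ring) (mon_ideal (pow_exp a q 1)) = 1"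
proof (rule ideal_height_eq_1)
  show "mon_ideal (pow_exp a q 1) \<subseteq> {f :: 'k fps fps. f $ 0 = 0}"
    using assms by (auto simp: mem_mon_ideal_pow_exp_iff)
  show "fps_X ^ (a + 1) \<in> (mon_ideal (pow_exp a q 1) :: 'k fps fps set)"
    by (auto simp: mem_mon_ideal_pow_exp_iff simp del: power_Suc)
  show "fps_X ^ (a + 1) \<noteq> (0 :: 'k fps fps)" by simp
qed

lemma graded_filtration_pow_exp:
  assumes "\<And>n. q n \<ge> 1"
  shows "graded_filtration (fps_ring_xy :: 'k::field fps fps ring)
    (\<lambda>n. if n = 0 then UNIV else mon_ideal (pow_exp (n + 1) (q n) 1))" (is "graded_filtration _ ?I")
  unfolding graded_filtration_def
proof (intro conjI allI impI)
  show id: "ideal (?I n) (fps_ring_xy :: 'k fps fps ring)" for n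
    using ideal_mon_ideal[OF pow_exp_facts(3)] type_ring.oneideal[where 'a="'k fps fps"] by auto
  show "?I 0 = carrier (fps_ring_xy :: 'k fps fps ring)" by simp
  show "ideal_prod (fps_ring_xy :: 'k fps fps ring) (?I m) (?I n) \<subseteq> ?I (m + n)" for m n
  proof (subst ideal_prod_subset_iff[OF id], intro ballI)
    fix f g :: "'k fps fps" assume f: "f \<in> ?I m" and g: "g \<in> ?I n"
    show "f * g \<in> ?I (m + n)"
    proof (cases "m = 0 \<or> n = 0")
      case True
      then show ?thesis
        using f g id[of m] id[of n] mult.commute[of f g] unfolding ideal_ring_of_type_algebra_iff
        by (metis add_0 add.right_neutral)
    next
      case False
      with f g have "\<And>i. i < m + 1 \<Longrightarrow> f $ i = 0" "\<And>i. i < n + 1 \<Longrightarrow> g $ i = 0"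
        by (auto simp: mem_mon_ideal_pow_exp_iff split: if_splits)
      from fps_mult_nth_lowest(2)[OF this] have "\<And>l. l < (m + 1) + (n + 1) \<Longrightarrow> (f * g) $ l = 0"
        by blast
      with False show ?thesis by (simp add: mem_mon_ideal_pow_exp_iff)
    qed
  qed
  fix n :: nat assume n: "n \<ge> 1"
  have "1 \<notin> ?I n" using n by (auto simp: mem_mon_ideal_pow_exp_iff)
  then show "?I n \<subset> carrier (fps_ring_xy :: 'k fps fps ring)" using n by auto
  show "?I (Suc n) \<subseteq> (?I n :: 'k fps fps set)"
    using n by (auto simp: mem_mon_ideal_pow_exp_iff)
qed

section \<open>Prescribing the growth of \<open>c\<^sub>2\<close>\<close>

lemma liminf_limsup_interleave:
  fixes f g :: "nat \<Rightarrow> ereal"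
  assumes f: "f \<longlonglongrightarrow> A" and g: "g \<longlonglongrightarrow> B" and "A \<le> B"
  shows "liminf (\<lambda>n. if even n then f n else g n) = A"
    and "limsup (\<lambda>n. if even n then f n else g n) = B"
proof -
  define h where "h n = (if even n then f n else g n)" for n
  have mono: "strict_mono (\<lambda>n::nat. 2 * n)" "strict_mono (\<lambda>n::nat. 2 * n + 1)"
    by (auto simp: strict_mono_def)
  have "(f \<circ> (\<lambda>n. 2 * n)) \<longlonglongrightarrow> A" "(g \<circ> (\<lambda>n. 2 * n + 1)) \<longlonglongrightarrow> B"
    using LIMSEQ_subseq_LIMSEQ[OF f mono(1)] LIMSEQ_subseq_LIMSEQ[OF g mono(2)] .
  moreover have "f \<circ> (\<lambda>n. 2 * n) = h \<circ> (\<lambda>n. 2 * n)" "g \<circ> (\<lambda>n. 2 * n + 1) = h \<circ> (\<lambda>n. 2 * n + 1)"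
    by (auto simp: h_def)
  ultimately have lim: "liminf (h \<circ> (\<lambda>n. 2 * n)) = A" "limsup (h \<circ> (\<lambda>n. 2 * n + 1)) = B"
    by (simp_all add: lim_imp_Liminf lim_imp_Limsup)
  have "liminf h \<le> A" "B \<le> limsup h"
    using liminf_subseq_mono[OF mono(1), of h] limsup_subseq_mono[OF mono(2), of h] lim by auto
  \<comment> \<open>Here \<open>A \<le> B\<close> enters: a number below \<open>A\<close> is also
    below \<open>B\<close>, hence eventually below both sequences.\<close>
  moreover have "A \<le> liminf h"
    unfolding le_Liminf_iff
  proof (intro allI impI)
    fix y assume "y < A"
    with \<open>A \<le> B\<close> have "eventually (\<lambda>n. y < f n) sequentially" "eventually (\<lambda>n. y < g n) sequentially"
      using order_tendstoD(1)[OF f] order_tendstoD(1)[OF g] by auto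
    then show "eventually (\<lambda>n. y < h n) sequentially"
      by eventually_elim (simp add: h_def)
  qed
  moreover have "limsup h \<le> B"
    unfolding Limsup_le_iff
  proof (intro allI impI)
    fix y assume "y > B"
    with \<open>A \<le> B\<close> have "eventually (\<lambda>n. f n < y) sequentially" "eventually (\<lambda>n. g n < y) sequentially"
      using order_tendstoD(2)[OF f] order_tendstoD(2)[OF g] by auto
    then show "eventually (\<lambda>n. h n < y) sequentially"
      by eventually_elim (simp add: h_def)
  qed
  ultimately show "liminf (\<lambda>n. if even n then f n else g n) = A"
    and "limsup (\<lambda>n. if even n then f n else g n) = B"
    unfolding h_def[symmetric] by auto
qed

text \<open>As c_2 = q (n + 2) is to grow like T n^2, q has to grow like T n; for T = \<infinity>
  any superlinear choice serves. The added 1 keeps the exponent positive even for T = 0 and is of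
  lower order.\<close>

definition growth_exp :: "ereal \<Rightarrow> nat \<Rightarrow> nat" where
  "growth_exp T n = (if T = \<infinity> then n * n else nat \<lceil>real n * real_of_ereal T\<rceil>) + 1"

lemma growth_exp_tendsto:
  assumes "0 \<le> T"
  shows "(\<lambda>n. ereal (real (growth_exp T n * (n + 2)) / real n ^ 2)) \<longlonglongrightarrow> T"
proof (cases "T = \<infinity>")
  case True
  have "filterlim (\<lambda>n. real (growth_exp T n * (n + 2)) / real n ^ 2) at_top sequentially"
  proof (rule filterlim_at_top_mono[OF filterlim_real_sequentially])
    show "eventually (\<lambda>n. real n \<le> real (growth_exp T n * (n + 2)) / real n ^ 2) sequentially"
      using eventually_gt_at_top[of 0]
    proof eventually_elim
      case (elim n)
      have "real n * real n ^ 2 = real (n * n * n)" by (simp add: power2_eq_square)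
      also have "\<dots> \<le> real (growth_exp T n * (n + 2))"
        unfolding of_nat_le_iff using True by (intro mult_le_mono) (auto simp: growth_exp_def)
      finally show ?case using elim by (simp add: pos_le_divide_eq)
    qed
  qed
  then show ?thesis
    unfolding True by (intro tendsto_PInfty_eq_at_top[THEN iffD2])
next
  case False
  with assms obtain t where t: "T = ereal t" "t \<ge> 0" by (cases T) auto
  have "(\<lambda>n. real (growth_exp T n * (n + 2)) / real n ^ 2) \<longlonglongrightarrow> t"
  proof (rule tendsto_sandwich)
    show "(\<lambda>n. t) \<longlonglongrightarrow> t" by simp
    have "(\<lambda>n. (t + 2 / real n) * (1 + 2 / real n)) \<longlonglongrightarrow> (t + 0) * (1 + 0)"
      by (intro tendsto_intros lim_const_over_n)
    then show "(\<lambda>n. (t + 2 / real n) * (1 + 2 / real n)) \<longlonglongrightarrow> t" by simp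
    \<comment> \<open>The 2 is one unit of rounding and the added 1.\<close>
    have bounds: "real n * t \<le> real (growth_exp T n)" "real (growth_exp T n) \<le> real n * t + 2" for n
    proof -
      have "real (growth_exp T n) = of_int \<lceil>real n * t\<rceil> + 1"
        using t by (simp add: growth_exp_def)
      then show "real n * t \<le> real (growth_exp T n)" "real (growth_exp T n) \<le> real n * t + 2"
        by linarith+
    qed
    show "eventually (\<lambda>n. t \<le> real (growth_exp T n * (n + 2)) / real n ^ 2) sequentially"
      using eventually_gt_at_top[of 0]
    proof eventually_elim
      case (elim n)
      have "t * real n ^ 2 = (real n * t) * real n" by (simp add: power2_eq_square)
      also have "\<dots> \<le> real (growth_exp T n) * real (n + 2)"
        using bounds t by (intro mult_mono) auto
      also have "\<dots> = real (growth_exp T n * (n + 2))" by (simp add: algebra_simps)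
      finally show ?case using elim by (simp only: pos_le_divide_eq zero_less_power of_nat_0_less_iff)
    qed
    show "eventually (\<lambda>n. real (growth_exp T n * (n + 2)) / real n ^ 2 \<le>
        (t + 2 / real n) * (1 + 2 / real n)) sequentially"
      using eventually_gt_at_top[of 0]
    proof eventually_elim
      case (elim n)
      have "real (growth_exp T n) * real (n + 2) \<le> (real n * t + 2) * real (n + 2)"
        using bounds by (intro mult_right_mono) auto
      also have "\<dots> = ((t + 2 / real n) * real n) * ((1 + 2 / real n) * real n)"
        using elim by (simp add: distrib_right)
      also have "\<dots> = (t + 2 / real n) * (1 + 2 / real n) * real n ^ 2"
        by (simp only: power2_eq_square mult_ac)
      finally show ?case using elim
        by (simp only: pos_divide_le_eq zero_less_power of_nat_0_less_iff of_nat_mult)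
    qed
  qed
  then have "(\<lambda>n. ereal (real (growth_exp T n * (n + 2)) / real n ^ 2)) \<longlonglongrightarrow> ereal t"
    by (simp only: lim_ereal)
  then show ?thesis by (simp only: t(1)[symmetric])
qed

section \<open>Krull dimension of polynomial rings in two variables\<close>

abbreviation coeff2 :: "'a::zero poly poly \<Rightarrow> nat \<Rightarrow> nat \<Rightarrow> 'a" where
  "coeff2 p u w \<equiv> Polynomial.coeff (Polynomial.coeff p u) w"

lemma poly_poly_eqI2: "(\<And>u w. coeff2 p u w = coeff2 r u w) \<Longrightarrow> p = r"
  by (simp add: poly_eq_iff)

lemma coeff2_mult:
  "coeff2 (p * r) u w = (\<Sum>i\<le>u. \<Sum>j\<le>w. coeff2 p i j * coeff2 r (u - i) (w - j))"
  by (simp add: coeff_mult coeff_sum)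

definition deg_bound :: "nat \<Rightarrow> 'a::zero poly poly \<Rightarrow> bool" where
  "deg_bound D p \<longleftrightarrow> (\<forall>u w. D < u \<or> D < w \<longrightarrow> coeff2 p u w = 0)"

lemma ex_deg_bound: "\<exists>D. deg_bound D p"
proof -
  define D where "D = Polynomial.degree p + (\<Sum>i\<le>Polynomial.degree p. Polynomial.degree (Polynomial.coeff p i))"
  have "coeff2 p u w = 0" if "D < u \<or> D < w" for u w
  proof (cases "u \<le> Polynomial.degree p")
    case True
    then have "Polynomial.degree (Polynomial.coeff p u) \<le>
        (\<Sum>i\<le>Polynomial.degree p. Polynomial.degree (Polynomial.coeff p i))"
      by (intro member_le_sum) auto
    with True that show ?thesis by (intro coeff_eq_0) (auto simp: D_def)
  qed (simp add: coeff_eq_0)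
  then show ?thesis by (auto simp: deg_bound_def)
qed

lemma deg_bound_mono: "deg_bound D p \<Longrightarrow> D \<le> E \<Longrightarrow> deg_bound E p"
  by (auto simp: deg_bound_def)

lemma deg_bound_mult:
  fixes p r :: "'a::comm_ring_1 poly poly"
  assumes "deg_bound D p" "deg_bound E r"
  shows "deg_bound (D + E) (p * r)"
  unfolding deg_bound_def coeff2_mult
proof (intro allI impI sum.neutral ballI)
  fix u w i j assume "D + E < u \<or> D + E < w" "i \<in> {..u}" "j \<in> {..w}"
  then have "(D < i \<or> D < j) \<or> (E < u - i \<or> E < w - j)" by auto
  with assms show "coeff2 p i j * coeff2 r (u - i) (w - j) = 0"
    unfolding deg_bound_def by (metis mult_zero_left mult_zero_right)
qed

lemma deg_bound_power:
  fixes p :: "'a::comm_ring_1 poly poly"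
  assumes "deg_bound D p"
  shows "deg_bound (n * D) (p ^ n)"
proof (induction n)
  case 0
  show ?case by (auto simp: deg_bound_def)
next
  case (Suc n)
  then show ?case using deg_bound_mult[OF assms Suc] by simp
qed

text \<open>The relation is written as a polynomial in \<open>a\<close> whose coefficients are
  polynomials in \<open>b\<close>, with coefficients in turn polynomials in \<open>c\<close>, so
  that a chain of primes can peel off one variable at each inclusion.\<close>

lemma algebraic_relation_three:
  fixes a b c :: "'k::field poly poly"
  shows "\<exists>N f. (\<exists>i<N. \<exists>j<N. \<exists>l<N. f i j l \<noteq> 0) \<and>
    (\<Sum>i<N. (\<Sum>j<N. (\<Sum>l<N. [:[:f i j l:]:] * c ^ l) * b ^ j) * a ^ i) = 0"
proof -
  obtain Da Db Dc where "deg_bound Da a" "deg_bound Db b" "deg_bound Dc c"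
    using ex_deg_bound by metis
  define D where "D = Da + Db + Dc"
  have D: "deg_bound D a" "deg_bound D b" "deg_bound D c"
    by (rule deg_bound_mono, fact, simp add: D_def)+
  \<comment> \<open>Exponents below N give N^3 monomials in a space of dimension (3 D N + 1)^2 <= (3
    D + 1)^2 N^2, so any N above (3 D + 1)^2 forces a dependence.\<close>
  define N where "N = (3 * D + 1) ^ 2 + 1"
  define I where "I = {..<N} \<times> {..<N} \<times> {..<N}"
  define J where "J = {..3 * D * N} \<times> {..3 * D * N}"
  define m where "m = (\<lambda>(i, j, l). c ^ l * b ^ j * a ^ i)"
  have m: "deg_bound (3 * D * N) (m t)" if t_I: "t \<in> I" for t
  proof -
    obtain i j l where t: "t = (i, j, l)" "i < N" "j < N" "l < N" using t_I unfolding I_def by (cases t) auto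
    have "deg_bound (l * D + j * D + i * D) (m t)"
      unfolding t m_def prod.case by (intro deg_bound_mult deg_bound_power D)
    moreover have "l * D + j * D + i * D \<le> N * D + N * D + N * D"
      using t by (intro add_mono mult_le_mono) auto
    ultimately show ?thesis by (rule deg_bound_mono[OF _ order.trans]) simp
  qed
  have "card J = (3 * D * N + 1) ^ 2" by (simp add: J_def power2_eq_square)
  also have "\<dots> \<le> ((3 * D + 1) * N) ^ 2" by (intro power_mono) (auto simp: N_def)
  also have "\<dots> = (3 * D + 1) ^ 2 * N ^ 2" by (rule power_mult_distrib)
  also have "\<dots> < N * N ^ 2" by (intro mult_strict_right_mono) (auto simp: N_def)
  also have "\<dots> = card I" by (simp add: I_def power2_eq_square)
  finally have "card J < card I" .
  then obtain f where f: "\<exists>t\<in>I. f t \<noteq> 0" "\<forall>p\<in>J. (\<Sum>t\<in>I. f t * coeff2 (m t) (fst p) (snd p)) = 0"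
    using homogeneous_system_nontrivial_solution[of J I "\<lambda>t p. coeff2 (m t) (fst p) (snd p)"]
    by (auto simp: I_def J_def)
  have "(\<Sum>t\<in>I. [:[:f t:]:] * m t) = 0"
  proof (rule poly_poly_eqI2)
    fix u w
    have "coeff2 (\<Sum>t\<in>I. [:[:f t:]:] * m t) u w = (\<Sum>t\<in>I. f t * coeff2 (m t) u w)"
      by (simp add: coeff_sum)
    also have "\<dots> = 0"
    proof (cases "(u, w) \<in> J")
      case True
      with f(2) show ?thesis by fastforce
    next
      case False
      then show ?thesis
        using m by (intro sum.neutral) (auto simp: J_def deg_bound_def not_le)
    qed
    finally show "coeff2 (\<Sum>t\<in>I. [:[:f t:]:] * m t) u w = coeff2 0 u w" by simp
  qed
  also have "(\<Sum>t\<in>I. [:[:f t:]:] * m t) =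
      (\<Sum>i<N. (\<Sum>j<N. (\<Sum>l<N. [:[:f (i, j, l):]:] * c ^ l) * b ^ j) * a ^ i)"
    by (simp add: I_def m_def sum.cartesian_product' sum_distrib_right mult.assoc)
  finally show ?thesis
    using f(1) by (intro exI[of _ N] exI[of _ "\<lambda>i j l. f (i, j, l)"]) (auto simp: I_def)
qed

text \<open>The factor \<open>a ^ m\<close> is cancelled modulo \<open>P\<close> because
  \<open>a\<close> is outside \<open>P\<close>; the other terms are then multiples of
  \<open>a \<in> Q\<close>. Thus the lowest coefficient of a relation moves one prime up the
  chain.\<close>

lemma primeideal_relation_lowest_coeff:
  fixes P Q :: "'a::comm_ring_1 set"
  assumes P: "primeideal P ring_of_type_algebra" and Q: "primeideal Q ring_of_type_algebra"
    and "P \<subseteq> Q" "a \<in> Q" "a \<notin> P"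
    and "(\<Sum>i<N. f i * a ^ i) \<in> P" "m < N" "\<And>i. i < m \<Longrightarrow> f i = 0"
  shows "f m \<in> Q"
proof -
  note P' = primeideal_ring_of_type_algebraD[OF P]
  note Q' = primeideal_ring_of_type_algebraD[OF Q]
  obtain K where K: "N = m + Suc K" using \<open>m < N\<close> by (metis less_natE add_Suc_right)
  have "(\<Sum>i<N. f i * a ^ i) = (\<Sum>i\<in>(\<lambda>i. m + i) ` {..<Suc K}. f i * a ^ i)"
  proof (intro sum.mono_neutral_right ballI)
    fix i assume "i \<in> {..<N} - (\<lambda>i. m + i) ` {..<Suc K}"
    then have "i < m" by (cases "i < m") (auto simp: K image_iff dest!: bspec[of _ _ "i - m"])
    then show "f i * a ^ i = 0" using assms(8) by simp
  qed (auto simp: K)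
  also have "\<dots> = (\<Sum>i<Suc K. f (m + i) * a ^ (m + i))"
    by (subst sum.reindex) auto
  also have "\<dots> = a ^ m * (f m + a * (\<Sum>i<K. f (m + Suc i) * a ^ i))"
    by (subst sum.lessThan_Suc_shift)
      (simp add: sum_distrib_left distrib_left power_add mult_ac)
  finally have "f m + a * (\<Sum>i<K. f (m + Suc i) * a ^ i) \<in> P"
    using assms(5,6) P'(7,8) by auto
  then have "(f m + a * (\<Sum>i<K. f (m + Suc i) * a ^ i)) - a * (\<Sum>i<K. f (m + Suc i) * a ^ i) \<in> Q"
    using assms(3,4) by (intro Q'(4,5)) auto
  then show ?thesis by simp
qed

lemma ex_least_less:
  assumes "\<exists>i<N. R (i::nat)"
  obtains m where "m < N" "R m" "\<And>i. i < m \<Longrightarrow> \<not> R i"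
  using assms exists_least_iff[of "\<lambda>i. i < N \<and> R i"] that by (metis less_trans)

text \<open>Elements \<open>a\<^sub>i\<close> of the successive differences of a chain of primes are algebraically
  independent, which is impossible for three bivariate polynomials by counting monomials.\<close>

lemma no_prime_chain_3_poly_poly:
  assumes "prime_chain (ring_of_type_algebra :: 'k::field poly poly ring) n P"
  shows "n \<le> 2"
proof (rule ccontr)
  assume "\<not> n \<le> 2"
  then have n: "n \<ge> 3" by simp
  have pr: "primeideal (P i) (ring_of_type_algebra :: 'k poly poly ring)" if "i \<le> 3" for i
    using assms n that by (auto simp: prime_chain_def)
  have s: "P 0 \<subset> P 1" "P 1 \<subset> P 2" "P 2 \<subset> P 3"
    using n by (auto intro!: prime_chain_mono[OF assms])
  then obtain a b c where abc: "a \<in> P 1" "a \<notin> P 0" "b \<in> P 2" "b \<notin> P 1" "c \<in> P 3" "c \<notin> P 2"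
    by blast
  from algebraic_relation_three[of c b a] obtain N f where
    f: "\<exists>i<N. \<exists>j<N. \<exists>l<N. f i j l \<noteq> (0 :: 'k)"
    "(\<Sum>i<N. (\<Sum>j<N. (\<Sum>l<N. [:[:f i j l:]:] * c ^ l) * b ^ j) * a ^ i) = 0" by blast
  \<comment> \<open>The lexicographically first nonzero coefficient is selected; it survives three
    passages to a lowest coefficient and lands in \<open>P 3\<close> as a nonzero scalar, a
    unit.\<close>
  from ex_least_less[OF f(1)] obtain i where
    i: "i < N" "\<exists>j<N. \<exists>l<N. f i j l \<noteq> 0" "\<And>i'. i' < i \<Longrightarrow> \<not> (\<exists>j<N. \<exists>l<N. f i' j l \<noteq> 0)" by blast
  from ex_least_less[OF i(2)] obtain j where
    j: "j < N" "\<exists>l<N. f i j l \<noteq> 0" "\<And>j'. j' < j \<Longrightarrow> \<not> (\<exists>l<N. f i j' l \<noteq> 0)" by blast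
  from ex_least_less[OF j(2)] obtain l where
    l: "l < N" "f i j l \<noteq> 0" "\<And>l'. l' < l \<Longrightarrow> \<not> f i j l' \<noteq> 0" by blast
  have "(\<Sum>i<N. (\<Sum>j<N. (\<Sum>l<N. [:[:f i j l:]:] * c ^ l) * b ^ j) * a ^ i) \<in> P 0"
    unfolding f(2) by (rule primeideal_ring_of_type_algebraD(1)[OF pr]) simp
  then have "(\<Sum>j<N. (\<Sum>l<N. [:[:f i j l:]:] * c ^ l) * b ^ j) \<in> P 1"
    using s(1) abc(1,2) i(1,3)
    by (intro primeideal_relation_lowest_coeff[OF pr[of 0] pr[of 1], where a=a and N=N and m=i and f="\<lambda>i. \<Sum>j<N. (\<Sum>l<N. [:[:f i j l:]:] * c ^ l) * b ^ j"])
      auto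
  then have "(\<Sum>l<N. [:[:f i j l:]:] * c ^ l) \<in> P 2"
    using s(2) abc(3,4) j(1,3)
    by (intro primeideal_relation_lowest_coeff[OF pr[of 1] pr[of 2], where a=b and N=N and m=j and f="\<lambda>j. \<Sum>l<N. [:[:f i j l:]:] * c ^ l"]) auto
  then have "[:[:f i j l:]:] \<in> P 3"
    using s(3) abc(5,6) l(1,3)
    by (intro primeideal_relation_lowest_coeff[OF pr[of 2] pr[of 3], where a=c and N=N and m=l and f="\<lambda>l. [:[:f i j l:]:]"]) auto
  then have "[:[:inverse (f i j l):]:] * [:[:f i j l:]:] \<in> P 3"
    by (rule primeideal_ring_of_type_algebraD(3)[OF pr, rotated]) simp
  also have "[:[:inverse (f i j l):]:] * [:[:f i j l:]:] = 1"
    using l(2) by (simp add: one_pCons)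
  finally show False using primeideal_ring_of_type_algebraD(6)[OF pr[of 3]] by simp
qed

section \<open>Dimension two and invariance under isomorphism\<close>

lemma krull_dim_poly_poly: "krull_dim (ring_of_type_algebra :: 'k::field poly poly ring) = 2"
proof -
  have "krull_dim (ring_of_type_algebra :: 'k poly poly ring) = enat 2"
    unfolding krull_dim_def
  proof (rule Sup_enat_eqI)
    define P :: "nat \<Rightarrow> 'k poly poly set" where
      "P i = (if i = 0 then {0} else if i = 1 then {p. Polynomial.coeff p 0 = 0} else {p. coeff2 p 0 0 = 0})" for i
    have "primeideal (P i) ring_of_type_algebra" for i
      by (auto simp: P_def primeideal_ring_of_type_algebra_iff ideal_ring_of_type_algebra_iff
          coeff_mult_0)
    moreover have "P 0 \<subset> P 1" "P 1 \<subset> P 2"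
    proof -
      have "[:0, 1:] \<in> P 1" "[:0, 1:] \<notin> P 0" "[:[:0, 1:]:] \<in> P 2" "[:[:0, 1:]:] \<notin> P 1"
        by (auto simp: P_def)
      moreover have "P 0 \<subseteq> P 1" "P 1 \<subseteq> P 2" by (auto simp: P_def)
      ultimately show "P 0 \<subset> P 1" "P 1 \<subset> P 2" by blast+
    qed
    ultimately have "prime_chain ring_of_type_algebra 2 P"
      by (auto simp: prime_chain_def less_Suc_eq numeral_2_eq_2)
    then show "\<exists>P. prime_chain (ring_of_type_algebra :: 'k poly poly ring) 2 P" by blast
  qed (use no_prime_chain_3_poly_poly in blast)
  then show ?thesis by (simp add: numeral_eq_enat)
qed

text \<open>Chains are pulled back along \<open>h\<close>; surjectivity keeps the inclusions
  strict.\<close>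

lemma krull_dim_surj_le:
  assumes "ring_hom_ring A B h" "cring A" "h ` carrier A = carrier B"
  shows "krull_dim B \<le> krull_dim A"
proof -
  interpret ring_hom_ring A B h by fact
  have "\<exists>P. prime_chain A n P" if Q: "prime_chain B n Q" for n Q
  proof -
    define P where "P i = {r \<in> carrier A. h r \<in> Q i}" for i
    have "P i \<subset> P (Suc i)" if "i < n" for i
    proof -
      have "Q i \<subset> Q (Suc i)" using Q that by (auto simp: prime_chain_def)
      then obtain y where y: "y \<in> Q (Suc i)" "y \<notin> Q i" by blast
      have "primeideal (Q (Suc i)) B" using Q that by (auto simp: prime_chain_def)
      then have "y \<in> carrier B" using y(1) ideal.Icarr primeideal.axioms(1) by metis
      then obtain x where "x \<in> carrier A" "h x = y" using assms(3) by (metis imageE)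
      with y \<open>Q i \<subset> Q (Suc i)\<close> show ?thesis by (auto simp: P_def)
    qed
    moreover have "primeideal (P i) A" if "i \<le> n" for i
      unfolding P_def using Q that by (intro primeideal_vimage assms) (auto simp: prime_chain_def)
    ultimately show ?thesis by (intro exI[of _ P]) (auto simp: prime_chain_def)
  qed
  then show ?thesis
    unfolding krull_dim_def by (intro Sup_subset_mono) blast
qed

lemma krull_dim_quot_kernel:
  assumes "ring_hom_ring A B h" "cring A" "cring B" "h ` carrier A = carrier B"
  shows "krull_dim (A Quot (a_kernel A B h)) = krull_dim B"
proof -
  interpret ring_hom_ring A B h by fact
  let ?Q = "A Quot (a_kernel A B h)"
  have Q: "cring ?Q"
    using kernel_is_ideal assms(2) by (rule ideal.quotient_is_cring)
  have iso: "(\<lambda>Y. the_elem (h ` Y)) \<in> ring_iso ?Q B"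
    using FactRing_iso_set[OF assms(4)] .
  have iso': "inv_into (carrier ?Q) (\<lambda>Y. the_elem (h ` Y)) \<in> ring_iso B ?Q"
    by (rule ring_iso_set_sym[OF cring.axioms(1)[OF Q] iso])
  have le: "krull_dim D \<le> krull_dim C" if "g \<in> ring_iso C D" "cring C" "cring D" for C D g
    using that by (intro krull_dim_surj_le[of C D g] ring_hom_ringI2)
      (auto simp: ring_iso_def bij_betw_def cring.axioms(1))
  show ?thesis
    using le[OF iso Q assms(3)] le[OF iso' assms(3) Q] by simp
qed

section \<open>The fibre cone\<close>

context
  fixes a q :: nat and S :: "('k::field fps fps, nat \<Rightarrow> 'k fps fps) up_ring"
  assumes q: "q \<ge> 1"
    and S_def: "S = rees_algebra fps_ring_xy (mon_ideal (pow_exp a q 1))"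
begin

lemma rees_simps:
  "carrier S = {p. (\<exists>N. \<forall>n>N. p n = 0) \<and> (\<forall>n. p n \<in> mon_ideal (pow_exp a q n))}"
  "p \<in> carrier S \<Longrightarrow> r \<in> carrier S \<Longrightarrow> p \<oplus>\<^bsub>S\<^esub> r = (\<lambda>n. p n + r n)"
  "p \<in> carrier S \<Longrightarrow> r \<in> carrier S \<Longrightarrow> p \<otimes>\<^bsub>S\<^esub> r = (\<lambda>n. \<Sum>i\<le>n. p i * r (n - i))"
  "\<one>\<^bsub>S\<^esub> = (\<lambda>n. if n = 0 then 1 else 0)" "\<zero>\<^bsub>S\<^esub> = (\<lambda>n. 0)"
  "up_ring.monom (UP (fps_ring_xy :: 'k fps fps ring)) f n = (\<lambda>i. if i = n then f else 0)"
proof -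
  have up: "p \<in> up (fps_ring_xy :: 'k fps fps ring) \<longleftrightarrow> (\<exists>N. \<forall>n>N. p n = 0)" for p
    by (auto simp: up_def bound_def)
  show car: "carrier S = {p. (\<exists>N. \<forall>n>N. p n = 0) \<and> (\<forall>n. p n \<in> mon_ideal (pow_exp a q n))}"
    unfolding S_def rees_algebra_def pow_exp_power(1) by (auto simp: UP_def up)
  show "\<one>\<^bsub>S\<^esub> = (\<lambda>n. if n = 0 then 1 else 0)" "\<zero>\<^bsub>S\<^esub> = (\<lambda>n. 0)"
    "up_ring.monom (UP (fps_ring_xy :: 'k fps fps ring)) f n = (\<lambda>i. if i = n then f else 0)"
    by (auto simp: S_def rees_algebra_def UP_def fun_eq_iff)
  assume "p \<in> carrier S" "r \<in> carrier S"
  then have "p \<in> up fps_ring_xy" "r \<in> up fps_ring_xy" unfolding car up by blast+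
  then show "p \<oplus>\<^bsub>S\<^esub> r = (\<lambda>n. p n + r n)" "p \<otimes>\<^bsub>S\<^esub> r = (\<lambda>n. \<Sum>i\<le>n. p i * r (n - i))"
    by (simp_all add: S_def rees_algebra_def UP_def)
qed

lemma mon_ideal_pow_exp_closed:
  fixes f g :: "'k fps fps"
  shows "f \<in> mon_ideal (pow_exp a q n) \<Longrightarrow> g \<in> mon_ideal (pow_exp a q n) \<Longrightarrow> f + g \<in> mon_ideal (pow_exp a q n)"
    "f \<in> mon_ideal (pow_exp a q n) \<Longrightarrow> - f \<in> mon_ideal (pow_exp a q n)"
    "f \<in> mon_ideal (pow_exp a q m) \<Longrightarrow> g \<in> mon_ideal (pow_exp a q n) \<Longrightarrow> f * g \<in> mon_ideal (pow_exp a q (m + n))"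
    "(\<And>x. x \<in> A \<Longrightarrow> h x \<in> mon_ideal (pow_exp a q n)) \<Longrightarrow> sum h A \<in> (mon_ideal (pow_exp a q n) :: 'k fps fps set)"
proof -
  show "f \<in> mon_ideal (pow_exp a q n) \<Longrightarrow> g \<in> mon_ideal (pow_exp a q n) \<Longrightarrow> f + g \<in> mon_ideal (pow_exp a q n)"
    "f \<in> mon_ideal (pow_exp a q n) \<Longrightarrow> - f \<in> mon_ideal (pow_exp a q n)"
    by (auto simp: mon_ideal_def)
  have "exp_sum (pow_exp a q m) (pow_exp a q n) \<subseteq> pow_exp a q (m + n)"
    by (auto simp: exp_sum_def pow_exp_def algebra_simps)
  then show "f \<in> mon_ideal (pow_exp a q m) \<Longrightarrow> g \<in> mon_ideal (pow_exp a q n) \<Longrightarrow>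
      f * g \<in> mon_ideal (pow_exp a q (m + n))"
    using mult_in_mon_ideal mon_ideal_mono by blast
  show "(\<And>x. x \<in> A \<Longrightarrow> h x \<in> mon_ideal (pow_exp a q n)) \<Longrightarrow>
      sum h A \<in> (mon_ideal (pow_exp a q n) :: 'k fps fps set)"
    by (auto simp: mon_ideal_def fps_sum_nth intro!: sum.neutral)
qed

text \<open>The operations are those of the polynomial ring, so only closure of the carrier is at
  stake; for products it rests on the additivity of the exponent sets.\<close>

lemma cring_rees: "cring S"
proof -
  let ?U = "UP (fps_ring_xy :: 'k fps fps ring)"
  interpret U: UP_cring "fps_ring_xy :: 'k fps fps ring" ?U
    by (intro UP_cring.intro type_ring.cring_axioms) 
  have S: "S = ?U\<lparr>carrier := carrier S\<rparr>"
    by (simp add: S_def rees_algebra_def)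
  have ops: "p \<oplus>\<^bsub>?U\<^esub> r = p \<oplus>\<^bsub>S\<^esub> r" "p \<otimes>\<^bsub>?U\<^esub> r = p \<otimes>\<^bsub>S\<^esub> r" "\<one>\<^bsub>?U\<^esub> = \<one>\<^bsub>S\<^esub>" "\<zero>\<^bsub>?U\<^esub> = \<zero>\<^bsub>S\<^esub>" for p r
    by (simp_all add: S_def rees_algebra_def)
  have sub: "carrier S \<subseteq> carrier ?U"
    by (auto simp: S_def rees_algebra_def)
  have uminus: "\<ominus>\<^bsub>?U\<^esub> p = (\<lambda>n. - p n) \<and> (\<lambda>n. - p n) \<in> carrier S" if "p \<in> carrier S" for p
  proof -
    have n: "(\<lambda>n. - p n) \<in> carrier S"
      using that unfolding rees_simps(1) by (auto intro: mon_ideal_pow_exp_closed(2))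
    have "(\<lambda>n. - p n) \<oplus>\<^bsub>?U\<^esub> p = \<zero>\<^bsub>?U\<^esub>"
      unfolding ops using that n by (simp add: rees_simps(2,5))
    moreover have "p \<in> carrier ?U" "(\<lambda>n. - p n) \<in> carrier ?U" using n that sub by blast+
    ultimately have "\<ominus>\<^bsub>?U\<^esub> p = (\<lambda>n. - p n)" by (intro U.P.minus_equality)
    with n show ?thesis by simp
  qed
  have "subring (carrier S) ?U"
  proof (rule U.P.subringI[OF sub])
    show "\<one>\<^bsub>?U\<^esub> \<in> carrier S"
      unfolding ops rees_simps(1,4) by (auto simp: mon_ideal_def pow_exp_def)
    show "\<ominus>\<^bsub>?U\<^esub> p \<in> carrier S" if "p \<in> carrier S" for p using uminus[OF that] by simp
    fix p r assume pr: "p \<in> carrier S" "r \<in> carrier S"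
    then obtain N M where NM: "\<And>n. n > N \<Longrightarrow> p n = 0" "\<And>n. n > M \<Longrightarrow> r n = 0"
      unfolding rees_simps(1) by blast
    have mem: "p n \<in> mon_ideal (pow_exp a q n)" "r n \<in> mon_ideal (pow_exp a q n)" for n
      using pr unfolding rees_simps(1) by auto
    have "p n + r n \<in> mon_ideal (pow_exp a q n)" for n
      using mem by (intro mon_ideal_pow_exp_closed)
    moreover have "\<forall>n>max N M. p n + r n = 0" using NM by simp
    ultimately show "p \<oplus>\<^bsub>?U\<^esub> r \<in> carrier S"
      unfolding ops rees_simps(2)[OF pr] unfolding rees_simps(1) by blast
    have "(\<Sum>i\<le>n. p i * r (n - i)) \<in> mon_ideal (pow_exp a q n)" for n
      using mon_ideal_pow_exp_closed(3)[OF mem(1) mem(2)]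
      by (intro mon_ideal_pow_exp_closed(4)) (metis atMost_iff le_add_diff_inverse)
    moreover have "(\<Sum>i\<le>n. p i * r (n - i)) = 0" if "n > N + M" for n
    proof (intro sum.neutral ballI)
      fix i show "p i * r (n - i) = 0" using that NM(1)[of i] NM(2)[of "n - i"] by (cases "i > N") auto
    qed
    ultimately show "p \<otimes>\<^bsub>?U\<^esub> r \<in> carrier S"
      unfolding ops rees_simps(3)[OF pr] unfolding rees_simps(1) by blast
  qed
  then have "subcring (carrier S) ?U" by (rule U.P.subcringI')
  then show ?thesis using U.P.subcring_iff[OF sub] S by simp
qed

text \<open>The coefficients of an element of degree \<open>n\<close> at the minimal generators of \<open>I\<^sup>n\<close>.\<close>

definition lead_coeff2 :: "(nat \<Rightarrow> 'k fps fps) \<Rightarrow> nat \<Rightarrow> nat \<Rightarrow> 'k" where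
  "lead_coeff2 p i l = p (i + l) $ (a * (i + l) + i) $ (q * l)"

text \<open>The candidate for the projection to the fibre cone: x^(a+1) t goes to the outer variable
  and x^a y^q t to the inner one.\<close>

definition lead_poly :: "(nat \<Rightarrow> 'k fps fps) \<Rightarrow> 'k poly poly" where
  "lead_poly p = Abs_poly (\<lambda>i. Abs_poly (lead_coeff2 p i))"

lemma coeff2_lead_poly:
  assumes "p \<in> carrier S"
  shows "coeff2 (lead_poly p) i l = lead_coeff2 p i l"
proof -
  from assms obtain N where N: "\<And>n. n > N \<Longrightarrow> p n = 0" unfolding rees_simps(1) by blast
  have *: "Polynomial.coeff (Abs_poly (lead_coeff2 p i)) = lead_coeff2 p i" for i
    by (rule coeff_Abs_poly[of N]) (simp add: lead_coeff2_def N)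
  have "Polynomial.coeff (lead_poly p) = (\<lambda>i. Abs_poly (lead_coeff2 p i))"
    unfolding lead_poly_def
  proof (rule coeff_Abs_poly[of N])
    fix i assume "i > N"
    then have "lead_coeff2 p i = (\<lambda>_. 0)" by (simp add: lead_coeff2_def N fun_eq_iff)
    then show "Abs_poly (lead_coeff2 p i) = 0" by (simp add: zero_poly_def)
  qed
  then show ?thesis by (simp add: *)
qed

text \<open>The minimal generators of the powers lie on the bounding segments. Two points of the
  regions for m and n - m can add up to a point on the segment for n only if both lie on their own
  segments, so the coefficient of a product there involves only such coefficients of the
  factors.\<close>

lemma lead_coeff2_mult:
  assumes p: "p \<in> carrier S" and r: "r \<in> carrier S"
  shows "lead_coeff2 (\<lambda>n. \<Sum>i\<le>n. p i * r (n - i)) i l =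
    (\<Sum>i'\<le>i. \<Sum>l'\<le>l. lead_coeff2 p i' l' * lead_coeff2 r (i - i') (l - l'))"
proof -
  define n where "n = i + l"
  define G where "G = (\<lambda>(m, u, w). p m $ u $ w * r (n - m) $ (a * n + i - u) $ (q * l - w))"
  define e where "e = (\<lambda>(i', l'). (i' + l', a * (i' + l') + i', q * l'))"
  define A where "A = {..n} \<times> {..a * n + i} \<times> {..q * l}"
  have "lead_coeff2 (\<lambda>n. \<Sum>i\<le>n. p i * r (n - i)) i l = (\<Sum>t\<in>A. G t)"
    by (simp add: lead_coeff2_def n_def[symmetric] fps_sum_nth fps_fps_mult_nth A_def G_def
        sum.cartesian_product')
  also have "\<dots> = (\<Sum>t\<in>e ` ({..i} \<times> {..l}). G t)"
  proof (rule sum.mono_neutral_right)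
    show "finite A" by (simp add: A_def)
    show "e ` ({..i} \<times> {..l}) \<subseteq> A"
      by (auto simp: e_def A_def n_def intro!: add_mono mult_le_mono)
    show "\<forall>t\<in>A - e ` ({..i} \<times> {..l}). G t = 0"
    proof (intro ballI, rule ccontr)
      fix t assume t: "t \<in> A - e ` ({..i} \<times> {..l})" and "G t \<noteq> 0"
      obtain m u w where muw: "t = (m, u, w)" by (cases t) auto
      with t have le: "m \<le> n" "u \<le> a * n + i" "w \<le> q * l" by (auto simp: A_def)
      have "p m $ u $ w \<noteq> 0" "r (n - m) $ (a * n + i - u) $ (q * l - w) \<noteq> 0"
        using \<open>G t \<noteq> 0\<close> by (auto simp: G_def muw)
      then have "(u, w) \<in> pow_exp a q m" "(a * n + i - u, q * l - w) \<in> pow_exp a q (n - m)"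
        using p r unfolding rees_simps(1) mon_ideal_def by blast+
      then obtain i1 i2 where i1: "u = a * m + i1" "q * (m - i1) \<le> w"
        and i2: "a * n + i - u = a * (n - m) + i2" "q * (n - m - i2) \<le> q * l - w"
        by (auto simp: pow_exp_iff)
      have "a * m + a * (n - m) = a * n" using le by (simp flip: distrib_left)
      with i1 i2 le have i: "i = i1 + i2" by linarith
      have "q * (m - i1) + q * (n - m - i2) \<le> q * l" using i1 i2 le by linarith
      then have "q * ((m - i1) + (n - m - i2)) \<le> q * l" by (simp add: distrib_left)
      then have "(m - i1) + (n - m - i2) \<le> l" using q by simp
      \<comment> \<open>Since \<open>i = i1 + i2\<close> and \<open>l = n - i\<close>, the truncated
        differences sum to at least \<open>l\<close>. Equality therefore excludes truncation, which
        gives \<open>i1 \<le> m\<close>.\<close>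
      then have eq: "(m - i1) + (n - m - i2) = l" "i1 \<le> m" using le i n_def by linarith+
      have "q * (m - i1) + q * (n - m - i2) = q * l" unfolding eq(1)[symmetric] by (rule distrib_left[symmetric])
      then have "w = q * (m - i1)" using i1 i2 le by linarith
      then have "t = e (i1, m - i1)" using eq i1 by (simp add: e_def muw)
      moreover have "i1 \<le> i" "m - i1 \<le> l" using i eq by auto
      ultimately show False using t by blast
    qed
  qed
  also have "\<dots> = (\<Sum>t\<in>{..i} \<times> {..l}. G (e t))"
  proof (subst sum.reindex)
    have "e t = e t' \<Longrightarrow> t = t'" for t t'
      by (cases t; cases t') (auto simp: e_def)
    then show "inj_on e ({..i} \<times> {..l})" by (auto intro: inj_onI)
  qed simp
  also have "\<dots> = (\<Sum>(i', l')\<in>{..i} \<times> {..l}. lead_coeff2 p i' l' * lead_coeff2 r (i - i') (l - l'))"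
  proof (rule sum.cong[OF refl])
    fix t assume "t \<in> {..i} \<times> {..l}"
    then obtain i' l' where t: "t = (i', l')" "i' \<le> i" "l' \<le> l" by (cases t) auto
    then obtain i2 l2 where il: "i = i' + i2" "l = l' + l2" by (auto simp: le_iff_add)
    have "n - (i' + l') = i2 + l2" by (simp add: n_def il)
    moreover have "a * n + i - (a * (i' + l') + i') = a * (i2 + l2) + i2"
      by (simp add: n_def il algebra_simps)
    moreover have "q * l - q * l' = q * l2" by (simp add: il algebra_simps)
    ultimately show "G (e t) = (case t of (i', l') \<Rightarrow> lead_coeff2 p i' l' * lead_coeff2 r (i - i') (l - l'))"
      by (simp add: G_def e_def lead_coeff2_def il t(1))
  qed
  also have "\<dots> = (\<Sum>i'\<le>i. \<Sum>l'\<le>l. lead_coeff2 p i' l' * lead_coeff2 r (i - i') (l - l'))"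
    by (rule sum.cartesian_product[symmetric])
  finally show ?thesis .
qed

lemma ring_hom_lead_poly: "ring_hom_ring S ring_of_type_algebra lead_poly"
proof (rule ring_hom_ringI2)
  interpret S: cring S by (rule cring_rees)
  show "ring S" by (rule S.ring_axioms)
  show "ring (ring_of_type_algebra :: 'k poly poly ring)" by (rule type_ring.ring_axioms)
  show "lead_poly \<in> ring_hom S ring_of_type_algebra"
  proof (rule ring_hom_memI)
    fix p r assume pr: "p \<in> carrier S" "r \<in> carrier S"
    have "lead_poly (p \<otimes>\<^bsub>S\<^esub> r) = lead_poly p * lead_poly r"
    proof (rule poly_poly_eqI2)
      show "coeff2 (lead_poly (p \<otimes>\<^bsub>S\<^esub> r)) i l = coeff2 (lead_poly p * lead_poly r) i l" for i l
        by (simp add: coeff2_lead_poly S.m_closed pr coeff2_mult)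
          (simp add: rees_simps(3) pr lead_coeff2_mult)
    qed
    then show "lead_poly (p \<otimes>\<^bsub>S\<^esub> r) = lead_poly p \<otimes>\<^bsub>ring_of_type_algebra\<^esub> lead_poly r" by simp
    have "lead_poly (p \<oplus>\<^bsub>S\<^esub> r) = lead_poly p + lead_poly r"
    proof (rule poly_poly_eqI2)
      show "coeff2 (lead_poly (p \<oplus>\<^bsub>S\<^esub> r)) i l = coeff2 (lead_poly p + lead_poly r) i l" for i l
        by (simp add: coeff2_lead_poly S.a_closed pr)
          (simp add: rees_simps(2) pr lead_coeff2_def)
    qed
    then show "lead_poly (p \<oplus>\<^bsub>S\<^esub> r) = lead_poly p \<oplus>\<^bsub>ring_of_type_algebra\<^esub> lead_poly r" by simp
  next
    have "lead_poly \<one>\<^bsub>S\<^esub> = 1"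
    proof (rule poly_poly_eqI2)
      show "coeff2 (lead_poly \<one>\<^bsub>S\<^esub>) i l = coeff2 1 i l" for i l
        by (simp add: coeff2_lead_poly S.one_closed)
          (auto simp: rees_simps(4) lead_coeff2_def)
    qed
    then show "lead_poly \<one>\<^bsub>S\<^esub> = \<one>\<^bsub>ring_of_type_algebra\<^esub>" by simp
  qed simp
qed

lemma lead_poly_surj: "lead_poly ` carrier S = UNIV"
proof -
  have "\<exists>p\<in>carrier S. lead_poly p = P" for P
  proof -
    obtain D where D: "deg_bound D P" using ex_deg_bound by blast
    \<comment> \<open>Each coefficient of \<open>P\<close> is placed at the matching generator of
      I^n, where n is the sum of its two indices; hence nothing remains for
      \<open>n > 2 * D\<close>.\<close>
    define p :: "nat \<Rightarrow> 'k fps fps" where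
      "p n = Abs_fps (\<lambda>u. Abs_fps (\<lambda>w.
        if a * n \<le> u \<and> u - a * n \<le> n \<and> w = q * (n - (u - a * n))
        then coeff2 P (u - a * n) (n - (u - a * n)) else 0))" for n
    have "p n \<in> mon_ideal (pow_exp a q n)" for n
      unfolding mon_ideal_def mem_Collect_eq
    proof (intro allI impI)
      fix u w assume "(u, w) \<notin> pow_exp a q n"
      then have "\<not> (a * n \<le> u \<and> q * (n - (u - a * n)) \<le> w)"
        unfolding pow_exp_iff by (metis le_add_diff_inverse)
      then show "p n $ u $ w = 0" by (auto simp: p_def)
    qed
    moreover have "p n = 0" if "n > 2 * D" for n
    proof (rule fps_fps_eqI)
      fix u w
      have "coeff2 P i (n - i) = 0" for i
        using that D unfolding deg_bound_def by (cases "D < i") auto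
      then show "p n $ u $ w = 0 $ u $ w" by (simp only: p_def fps_nth_Abs_fps fps_zero_nth if_cancel)
    qed
    ultimately have p: "p \<in> carrier S" unfolding rees_simps(1) by blast
    have "lead_poly p = P"
      by (rule poly_poly_eqI2) (simp add: coeff2_lead_poly[OF p] lead_coeff2_def p_def)
    with p show ?thesis by blast
  qed
  then have "P \<in> lead_poly ` carrier S" for P by (metis imageI)
  then show ?thesis by auto
qed

text \<open>By the case of degree one in \<open>exp_sum_deg_pow_iff\<close>, the exponents of I^n
  missing from the maximal ideal times I^n are exactly the minimal generators, and there the
  coefficients of \<open>p\<close> vanish.\<close>

lemma mem_exp_sum_deg_1:
  assumes p: "p \<in> carrier S" and "lead_poly p = 0"
  shows "p n \<in> mon_ideal (exp_sum (deg_exp 1) (pow_exp a q n))"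
  unfolding mon_ideal_def mem_Collect_eq
proof (intro allI impI, rule ccontr)
  fix u w assume nin: "(u, w) \<notin> exp_sum (deg_exp 1) (pow_exp a q n)" and nz: "p n $ u $ w \<noteq> 0"
  have "(u, w) \<in> pow_exp a q n"
    using p nz unfolding rees_simps(1) mon_ideal_def by blast
  then obtain i where i: "u = a * n + i" "q * (n - i) \<le> w" by (auto simp: pow_exp_iff)
  have "\<not> 1 + q * (n - i) \<le> (i - n) + w"
    using nin exp_sum_deg_pow_iff[OF q] unfolding i(1) by blast
  then have *: "i \<le> n" "w = q * (n - i)" using i(2) by linarith+
  have "lead_coeff2 p i (n - i) = 0"
    using coeff2_lead_poly[OF p] assms(2) by (metis coeff_0)
  then show False using nz * by (simp add: lead_coeff2_def i(1))
qed

text \<open>A kernel element has each homogeneous component \<open>p n\<close> in the maximal ideal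
  times I^n. A product f g with f in the maximal ideal and g in I^n gives f g t^n = f (g t^n), a
  multiple of a generator of the extended ideal.\<close>

lemma kernel_lead_poly:
  "a_kernel S ring_of_type_algebra lead_poly =
    Idl\<^bsub>S\<^esub> ((\<lambda>f. up_ring.monom (UP fps_ring_xy) f 0) ` max_ideal fps_ring_xy)" (is "?K = Idl\<^bsub>S\<^esub> ?M")
proof
  interpret S: cring S by (rule cring_rees)
  have M: "?M \<subseteq> carrier S"
    unfolding rees_simps(1) rees_simps(6) by (auto simp: mon_ideal_def pow_exp_def)
  have id: "ideal (Idl\<^bsub>S\<^esub> ?M) S" by (rule S.genideal_ideal[OF M])
  have "?M \<subseteq> ?K"
  proof
    fix p assume "p \<in> ?M"
    then obtain f where f: "f $ 0 $ 0 = 0" "p = (\<lambda>i. if i = 0 then f else 0)"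
      by (auto simp: rees_simps(6) max_ideal_fps_ring_xy)
    have "p \<in> carrier S" using \<open>p \<in> ?M\<close> M by blast
    moreover from this have "lead_poly p = 0"
      by (intro poly_poly_eqI2) (simp add: coeff2_lead_poly lead_coeff2_def f)
    ultimately show "p \<in> ?K" by (simp add: a_kernel_def')
  qed
  with ring_hom_ring.kernel_is_ideal[OF ring_hom_lead_poly]
  show "Idl\<^bsub>S\<^esub> ?M \<subseteq> ?K" by (rule S.genideal_minimal)
  have single: "(\<lambda>i. if i = n then f else 0) \<in> Idl\<^bsub>S\<^esub> ?M"
    if "f \<in> ideal_prod fps_ring_xy (max_ideal fps_ring_xy) (mon_ideal (pow_exp a q n))" for f n
    using that
  proof induction
    case (prod f g)
    define F G where "F = (\<lambda>i::nat. if i = 0 then f else 0)" and "G = (\<lambda>i. if i = n then g else 0)"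
    have "F \<in> ?M" unfolding rees_simps(6) F_def using prod(1) by blast
    then have "F \<in> Idl\<^bsub>S\<^esub> ?M" using S.genideal_self[OF M] by blast
    moreover have G: "G \<in> carrier S"
      unfolding rees_simps(1) G_def using prod(2) by (auto simp: mon_ideal_def)
    ultimately have "F \<otimes>\<^bsub>S\<^esub> G \<in> Idl\<^bsub>S\<^esub> ?M" by (rule ideal.I_r_closed[OF id])
    also have "F \<otimes>\<^bsub>S\<^esub> G = (\<lambda>k. \<Sum>i\<le>k. F i * G (k - i))"
      using \<open>F \<in> ?M\<close> M G by (intro rees_simps(3)) auto
    also have "\<dots> = (\<lambda>i. if i = n then f * g else 0)"
    proof
      fix k
      have "(\<Sum>i\<le>k. F i * G (k - i)) = (\<Sum>i\<in>{0}. F i * G (k - i))"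
        by (rule sum.mono_neutral_right) (auto simp: F_def)
      then show "(\<Sum>i\<le>k. F i * G (k - i)) = (if k = n then f * g else 0)"
        by (simp add: F_def G_def)
    qed
    finally show ?case unfolding ring_of_type_algebra_simps .
  next
    case (sum f g)
    have "(\<lambda>i. if i = n then f else 0) \<oplus>\<^bsub>S\<^esub> (\<lambda>i. if i = n then g else 0) \<in> Idl\<^bsub>S\<^esub> ?M"
      using sum.IH id by (intro additive_subgroup.a_closed ideal.axioms(1))
    also have "(\<lambda>i. if i = n then f else 0) \<oplus>\<^bsub>S\<^esub> (\<lambda>i. if i = n then g else 0) =
      (\<lambda>i. if i = n then f + g else 0)"
      by (subst rees_simps(2)) (use sum.IH ideal.Icarr[OF id] in \<open>auto simp: fun_eq_iff\<close>)
    finally show ?case unfolding ring_of_type_algebra_simps .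
  qed
  show "?K \<subseteq> Idl\<^bsub>S\<^esub> ?M"
  proof
    fix p assume "p \<in> ?K"
    then have p: "p \<in> carrier S" "lead_poly p = 0" by (auto simp: a_kernel_def')
    have pn: "p n \<in> ideal_prod fps_ring_xy (max_ideal fps_ring_xy) (mon_ideal (pow_exp a q n))" for n
      unfolding max_ideal_eq_mon_ideal
        ideal_prod_mon_ideal_fin_gen[OF deg_exp_power(2) pow_exp_power(2) deg_exp_power(3) pow_exp_power(3)]
      by (rule mem_exp_sum_deg_1[OF p])
    \<comment> \<open>Adding components one degree at a time recovers \<open>p\<close>, which has
      only finitely many.\<close>
    have truncated: "(\<lambda>i. if i < N then p i else 0) \<in> Idl\<^bsub>S\<^esub> ?M" for N
    proof (induction N)
      case 0
      show ?case
        using additive_subgroup.zero_closed[OF ideal.axioms(1)[OF id]] by (simp add: rees_simps(5))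
    next
      case (Suc N)
      have "(\<lambda>i. if i < N then p i else 0) \<oplus>\<^bsub>S\<^esub> (\<lambda>i. if i = N then p N else 0) \<in> Idl\<^bsub>S\<^esub> ?M"
        using Suc single[OF pn[of N]] id by (intro additive_subgroup.a_closed ideal.axioms(1))
      also have "(\<lambda>i. if i < N then p i else 0) \<oplus>\<^bsub>S\<^esub> (\<lambda>i. if i = N then p N else 0) =
        (\<lambda>i. if i < Suc N then p i else 0)"
        by (subst rees_simps(2))
          (use Suc single[OF pn[of N]] ideal.Icarr[OF id] in \<open>auto simp: fun_eq_iff less_Suc_eq\<close>)
      finally show ?case .
    qed
    obtain N where "\<And>n. n > N \<Longrightarrow> p n = 0" using p(1) unfolding rees_simps(1) by blast
    then have "(\<lambda>i. if i < Suc N then p i else 0) = p" by (auto simp: fun_eq_iff)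
    with truncated[of "Suc N"] show "p \<in> Idl\<^bsub>S\<^esub> ?M" by (simp only:)
  qed
qed

end

lemma analytic_spread_pow_exp:
  assumes "q \<ge> 1"
  shows "analytic_spread (fps_ring_xy :: 'k::field fps fps ring) (mon_ideal (pow_exp a q 1)) = 2"
  unfolding analytic_spread_def kernel_lead_poly[OF assms refl, symmetric]
    krull_dim_poly_poly[where 'k='k, symmetric]
  by (intro krull_dim_quot_kernel ring_hom_lead_poly cring_rees assms refl)
    (use assms in \<open>simp_all add: lead_poly_surj[OF assms refl] type_ring.cring_axioms del: One_nat_def\<close>)

section \<open>The filtration with prescribed lower and upper limit\<close>

theorem corollary3p13:
  fixes A B :: ereal
  assumes "infinite (UNIV :: 'k::field set)"
    and "0 \<le> A" and "A \<le> B"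
  shows "\<exists>I :: nat \<Rightarrow> 'k fps fps set.
    graded_filtration fps_ring_xy I \<and>
    (\<forall>n\<ge>1. I n \<noteq> {0} \<and> I n \<noteq> carrier fps_ring_xy \<and>
       integrally_closed fps_ring_xy (I n) \<and>
       ideal_radical fps_ring_xy (I n) = PIdl\<^bsub>fps_ring_xy\<^esub> var_x \<and>
       ideal_height fps_ring_xy (I n) = 1 \<and>
       analytic_spread fps_ring_xy (I n) = 2) \<and>
    (\<lambda>n. mult_seq fps_ring_xy (I n) 0) \<longlonglongrightarrow> 0 \<and>
    (\<lambda>n. mult_seq fps_ring_xy (I n) 1 / real n) \<longlonglongrightarrow> 1 \<and>
    liminf (\<lambda>n. ereal (mult_seq fps_ring_xy (I n) 2 / real n ^ 2)) = A \<and>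
    limsup (\<lambda>n. ereal (mult_seq fps_ring_xy (I n) 2 / real n ^ 2)) = B"
proof -
  define q where "q n = growth_exp (if even n then A else B) n" for n
  have q: "q n \<ge> 1" for n by (simp add: q_def growth_exp_def)
  define I :: "nat \<Rightarrow> 'k fps fps set" where
    "I n = (if n = 0 then UNIV else mon_ideal (pow_exp (n + 1) (q n) 1))" for n
  have "graded_filtration fps_ring_xy I"
    using graded_filtration_pow_exp[of q, OF q] by (simp add: I_def[abs_def])
  moreover have "I n \<noteq> {0} \<and> I n \<noteq> carrier fps_ring_xy \<and>
       integrally_closed fps_ring_xy (I n) \<and>
       ideal_radical fps_ring_xy (I n) = PIdl\<^bsub>fps_ring_xy\<^esub> var_x \<and>
       ideal_height fps_ring_xy (I n) = 1 \<and>
       analytic_spread fps_ring_xy (I n) = 2" if "n \<ge> 1" for n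
  proof -
    have I: "I n = mon_ideal (pow_exp (n + 1) (q n) 1)" using that by (simp add: I_def)
    have "fps_X ^ (n + 2) \<in> I n" "1 \<notin> I n"
      unfolding I by (auto simp: mem_mon_ideal_pow_exp_iff simp del: power_Suc)
    moreover have "fps_X ^ (n + 2) \<noteq> (0 :: 'k fps fps)" by simp
    ultimately have "I n \<noteq> {0}" "I n \<noteq> carrier fps_ring_xy"
      by (blast, simp only: ring_of_type_algebra_simps, blast)
    then show ?thesis
      unfolding I
      by (intro conjI integrally_closed_pow_exp ideal_radical_pow_exp ideal_height_pow_exp
          analytic_spread_pow_exp q) (assumption | simp)+
  qed
  \<comment> \<open>With a = n + 1 the values a and q (a + 1) become n + 1 and q(n)(n + 2). Index 0
    is left out because \<open>I 0\<close> is the unit ideal; the limits only see large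
    \<open>n\<close>.\<close>
  moreover have mult: "mult_seq fps_ring_xy (I n) 0 = 0" "mult_seq fps_ring_xy (I n) 1 = real (n + 1)"
    "mult_seq fps_ring_xy (I n) 2 = real (q n * (n + 2))" if "n \<ge> 1" for n
    using that mult_seq_pow_exp[OF q, of "n + 1" n, where 'k='k] by (simp_all add: I_def)
  have "(\<lambda>n. mult_seq fps_ring_xy (I n) 0) \<longlonglongrightarrow> 0"
    by (intro tendsto_eventually eventually_mono[OF eventually_ge_at_top[of "1::nat"]]) (rule mult(1))
  moreover have "(\<lambda>n. mult_seq fps_ring_xy (I n) 1 / real n) \<longlonglongrightarrow> 1"
  proof -
    have "(\<lambda>n. 1 + 1 / real n) \<longlonglongrightarrow> 1 + 0"
      by (intro tendsto_intros lim_const_over_n)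
    moreover have "eventually (\<lambda>n. 1 + 1 / real n = mult_seq fps_ring_xy (I n) 1 / real n) sequentially"
      using eventually_ge_at_top[of "1::nat"]
      by eventually_elim (simp add: mult(2) add_divide_distrib del: One_nat_def)
    ultimately show ?thesis by (simp add: tendsto_cong del: One_nat_def)
  qed
  moreover have "liminf (\<lambda>n. ereal (mult_seq fps_ring_xy (I n) 2 / real n ^ 2)) = A \<and>
      limsup (\<lambda>n. ereal (mult_seq fps_ring_xy (I n) 2 / real n ^ 2)) = B"
  proof -
    define h where "h T n = ereal (real (growth_exp T n * (n + 2)) / real n ^ 2)" for T n
    have "h A \<longlonglongrightarrow> A" "h B \<longlonglongrightarrow> B"
      using growth_exp_tendsto[of A] growth_exp_tendsto[of B] assms unfolding h_def[abs_def] by auto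
    from liminf_limsup_interleave[OF this assms(3)]
    have lim: "liminf (\<lambda>n. if even n then h A n else h B n) = A"
      "limsup (\<lambda>n. if even n then h A n else h B n) = B" .
    have "eventually (\<lambda>n. ereal (mult_seq fps_ring_xy (I n) 2 / real n ^ 2) =
      (if even n then h A n else h B n)) sequentially"
      using eventually_ge_at_top[of "1::nat"]
    proof eventually_elim
      case (elim n)
      show ?case unfolding mult(3)[OF elim] by (simp add: h_def q_def)
    qed
    from Liminf_eq[OF this] Limsup_eq[OF this] lim show ?thesis by simp
  qed
  ultimately show ?thesis by (intro exI[of _ I]) blast
qed

end
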